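(* Let $A$ be the port-Hamiltonian operator with domain $\operatorname{dom}(A)$ described in the context, and assume that $A$ generates a contraction semigroup $(T(t))_{t\ge 0}$ on $X$. Then the following conditions are equivalent: (i) $(T(t))_{t\ge0}$ is semi-uniformly stable, i.e. there is a function $f\colon[0,\infty)\to[0,\infty)$ with $f(t)\to0$ as $t\to\infty$ such that for all $x\in\operatorname{dom}(A)$ and all $t\ge 0$, $\|T(t)x\|_{\mathcal H}\le f(t)\|x\|_{\operatorname{dom}(A)}$. (ii) $(T(t))_{t\ge0}$ is asymptotically stable, i.e. for all $x\in X$, $T(t)x\to0$ as $t\to\infty$. (iii) The operator $A$ with domain $\operatorname{dom}(A)$ has no eigenvalues on the imaginary axis. (iv) The square matrix $\mathcal Q(i\omega):=W_B\begin{bmatrix}\Psi_{i\omega}(b)\\ I_{nN}\end{bmatrix}$ is invertible for all $\omega\in\mathbb R$. (v) For all $\omega\in\mathbb R$ the set $$\Big\{v_a\in\mathbb C^{nN}\ \Big|\ \mathcal Q(i\omega)v_a=0\ \text{ and }\ v_a^*\begin{bmatrix}\Psi_{i\omega}(b)^* & I_{nN}\end{bmatrix}\begin{bmatrix}Q&0\\0&-Q\end{bmatrix}\begin{bmatrix}\Psi_{i\omega}(b)\\ I_{nN}\end{bmatrix}v_a=0\Big\}$$ contains only the zero element.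
   Context: Let $a<b$ be real, $n,N\ge1$ integers, and $P_0,\dots,P_N\in\mathbb C^{n\times n}$ with $P_k^*=(-1)^{k+1}P_k$ for $k=0,\dots,N$ and $P_N$ invertible. Let $\mathcal H\colon(a,b)\to\mathbb C^{n\times n}$ be measurable and uniformly bounded, with $\mathcal H(\zeta)^*=\mathcal H(\zeta)$ and $\mathcal H(\zeta)\ge mI$ for almost every $\zeta$, for some constant $m>0$. Let $X=L_{2,\mathcal H}((a,b);\mathbb C^n)$, i.e. $L_2((a,b);\mathbb C^n)$ as a set with inner product $\langle f,g\rangle_{\mathcal H}=\frac12\int_a^b g(\zeta)^*\mathcal H(\zeta)f(\zeta)\,d\zeta$ and norm $\|\cdot\|_{\mathcal H}$. Let $W_B$ be a complex $nN\times 2nN$ matrix of full rank. The operator $A$ is $$A x=\Big(P_N\frac{d^N}{d\zeta^N}+\cdots+P_1\frac{d}{d\zeta}+P_0\Big)(\mathcal Hx),$$ with $\operatorname{dom}(A)$ the set of $x\in X$ such that $\mathcal Hx\in H^N((a,b);\mathbb C^n)$ and $$W_B\begin{bmatrix}(\mathcal Hx)(b)\\ \vdots\\ (\mathcal Hx)^{(N-1)}(b)\\ (\mathcal Hx)(a)\\ \vdots\\ (\mathcal Hx)^{(N-1)}(a)\end{bmatrix}=0.$$ $\|\cdot\|_{\operatorname{dom}(A)}$ is the graph norm of $A$. $Q=[Q_{ij}]_{i,j=1,\dots,N}$ is the $nN\times nN$ block matrix with $n\times n$ blocks $Q_{ij}=(-1)^{i-1}P_{i+j-1}$ if $i+j-1\le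 N$, and $Q_{ij}=0$ if $i+j-1>N$. For $\lambda\in\mathbb C$, let $\mathcal P_\lambda(\zeta)$ be the $nN\times nN$ block matrix $$\mathcal P_\lambda(\zeta)=\begin{bmatrix}0&I&0&\cdots&0\\0&0&I&&\vdots\\ \vdots&&\ddots&\ddots&0\\0&\cdots&\cdots&0&I\\ \lambda P_N^{-1}\mathcal H(\zeta)^{-1}-P_N^{-1}P_0&-P_N^{-1}P_1&\cdots&\cdots&-P_N^{-1}P_{N-1}\end{bmatrix}$$ (for $N=1$: $\mathcal P_\lambda=\lambda P_1^{-1}\mathcal H^{-1}-P_1^{-1}P_0$). $\Psi_\lambda\colon[a,b]\to\mathbb C^{nN\times nN}$ denotes the fundamental solution, i.e. the unique (continuous, $H^1$) matrix function with $\Psi_\lambda'(\zeta)=\mathcal P_\lambda(\zeta)\Psi_\lambda(\zeta)$ for a.e. $\zeta\in(a,b)$ and $\Psi_\lambda(a)=I_{nN}$. *)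

theory Defs
  imports "HOL-Analysis.Analysis"
begin

text \<open>
  Sizes are types: \<open>'n\<close> indexes the coordinates of \<open>\<complex>\<^sup>n\<close>, and a finite linearly ordered type
  \<open>'N\<close> with \<open>N = CARD('N)\<close> indexes the \<open>N\<close> blocks of a vector in \<open>\<complex>\<^bsup>nN\<^esup>\<close>, so that
  \<open>\<complex>\<^bsup>nN\<^esup>\<close> is \<open>complex ^ ('N \<times> 'n)\<close>. Block vectors and matrices with two
  \<open>nN\<close>-blocks are indexed by the sum type, with \<open>Inl\<close> for the first (upper or left) block.
\<close>


subsection \<open>Complex matrices\<close>

definition cmat_adjoint :: "complex ^ 'c ^ 'r \<Rightarrow> complex ^ 'r ^ 'c" where
  "cmat_adjoint A = (\<chi> i j. cnj (A $ j $ i))"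

text \<open>\<open>cdot v w\<close> is \<open>v\<^sup>* w\<close>, conjugate-linear in its first argument.\<close>

definition cdot :: "complex ^ 'k::finite \<Rightarrow> complex ^ 'k \<Rightarrow> complex" where
  "cdot v w = (\<Sum>i\<in>UNIV. cnj (v $ i) * w $ i)"

definition vstack :: "complex ^ 'c ^ 'r \<Rightarrow> complex ^ 'c ^ 's \<Rightarrow> complex ^ 'c ^ ('r + 's)" where
  "vstack A B = (\<chi> r. case r of Inl i \<Rightarrow> A $ i | Inr i \<Rightarrow> B $ i)"

definition hstack :: "complex ^ 'c ^ 'r \<Rightarrow> complex ^ 'd ^ 'r \<Rightarrow> complex ^ ('c + 'd) ^ 'r" where
  "hstack A B = (\<chi> r c. case c of Inl j \<Rightarrow> A $ r $ j | Inr j \<Rightarrow> B $ r $ j)"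

definition diag2 :: "complex ^ 'c ^ 'r \<Rightarrow> complex ^ 'd ^ 's \<Rightarrow> complex ^ ('c + 'd) ^ ('r + 's)" where
  "diag2 A B = vstack (hstack A 0) (hstack 0 B)"

text \<open>The position \<open>0, \<dots>, N - 1\<close> of a block index; the mathematical (1-based) index is one more.\<close>

definition pos :: "'N::{finite,linorder} \<Rightarrow> nat" where
  "pos i = card {j. j < i}"

definition block_matrix ::
  "(nat \<Rightarrow> nat \<Rightarrow> complex ^ 'n ^ 'n) \<Rightarrow>
   complex ^ ('N::{finite,linorder} \<times> 'n) ^ ('N \<times> 'n)" where
  "block_matrix B = (\<chi> r c. B (pos (fst r)) (pos (fst c)) $ snd r $ snd c)"

text \<open>\<open>Q\<^bsub>ij\<^esub> = (-1)\<^bsup>i-1\<^esup> P\<^bsub>i+j-1\<^esub>\<close> for \<open>i + j - 1 \<le> N\<close>, shifted to 0-based \<open>i, j\<close>.\<close>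

definition Q_matrix ::
  "(nat \<Rightarrow> complex ^ 'n ^ 'n) \<Rightarrow> complex ^ ('N::{finite,linorder} \<times> 'n) ^ ('N \<times> 'n)" where
  "Q_matrix P = block_matrix
     (\<lambda>i j. if i + j + 1 \<le> CARD('N) then (-1) ^ i *\<^sub>R P (i + j + 1) else 0)"

text \<open>The scalar \<open>\<mu>\<close> enters as the scalar matrix \<open>mat \<mu>\<close>.\<close>

definition companion ::
  "(nat \<Rightarrow> complex ^ 'n ^ 'n) \<Rightarrow> (real \<Rightarrow> complex ^ 'n ^ 'n) \<Rightarrow> complex \<Rightarrow> real \<Rightarrow>
   complex ^ ('N::{finite,linorder} \<times> 'n) ^ ('N \<times> 'n)" where
  "companion P \<H> \<mu> \<zeta> = (let N = CARD('N); R = matrix_inv (P N) in block_matrix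
     (\<lambda>i j. if i + 1 < N then (if j = i + 1 then mat 1 else 0)
            else if j = 0 then mat \<mu> ** R ** matrix_inv (\<H> \<zeta>) - R ** P 0
            else - (R ** P j)))"


subsection \<open>Square-integrable and Sobolev functions on an interval\<close>

text \<open>
  Elements of \<open>L\<^sub>2\<close> are represented by functions on \<open>\<real>\<close> whose values outside \<open>(a,b)\<close> are irrelevant,
  and equality in \<open>L\<^sub>2\<close> is \<open>ae_eq\<close>.
\<close>

definition L2 :: "real \<Rightarrow> real \<Rightarrow> (real \<Rightarrow> 'v::euclidean_space) set" where
  "L2 a b = {f. f \<in> borel_measurable (lebesgue_on {a<..<b}) \<and>
               integrable (lebesgue_on {a<..<b}) (\<lambda>\<zeta>. (norm (f \<zeta>))\<^sup>2)}"

definition ae_eq :: "real \<Rightarrow> real \<Rightarrow> (real \<Rightarrow> 'v) \<Rightarrow> (real \<Rightarrow> 'v) \<Rightarrow> bool" where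
  "ae_eq a b f g \<longleftrightarrow> (AE \<zeta> in lebesgue_on {a<..<b}. f \<zeta> = g \<zeta>)"

text \<open>
  \<open>u \<in> H\<^sup>N((a,b))\<close> with \<open>u\<^bsup>(k)\<^esup> = g k\<close> for \<open>k \<le> N\<close>. As usual for Sobolev functions of one variable,
  the derivatives of order \<open>k < N\<close> are taken to be their absolutely continuous representatives
  on \<open>[a,b]\<close>, i.e. \<open>g k\<close> is an indefinite integral of \<open>g (k + 1) \<in> L\<^sub>2\<close>; these give meaning to
  the boundary values \<open>u\<^bsup>(k)\<^esup>(a)\<close> and \<open>u\<^bsup>(k)\<^esup>(b)\<close>.
\<close>

definition sobolev_derivs ::
  "real \<Rightarrow> real \<Rightarrow> nat \<Rightarrow> (real \<Rightarrow> 'v::euclidean_space) \<Rightarrow> (nat \<Rightarrow> real \<Rightarrow> 'v) \<Rightarrow> bool" where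
  "sobolev_derivs a b N u g \<longleftrightarrow>
     ae_eq a b (g 0) u \<and>
     (\<forall>k\<le>N. g k \<in> L2 a b) \<and>
     (\<forall>k<N. \<forall>\<zeta>\<in>{a..b}. (g (Suc k) has_integral (g k \<zeta> - g k a)) {a..\<zeta>})"

definition Sobolev :: "real \<Rightarrow> real \<Rightarrow> nat \<Rightarrow> (real \<Rightarrow> 'v::euclidean_space) set" where
  "Sobolev a b N = {u. \<exists>g. sobolev_derivs a b N u g}"

text \<open>
  The \<open>k\<close>-th derivative of \<open>u \<in> H\<^sup>N((a,b))\<close>, \<open>k \<le> N\<close>: determined everywhere on \<open>[a,b]\<close> for \<open>k < N\<close>
  and almost everywhere for \<open>k = N\<close>.
\<close>

definition sobolev_deriv ::
  "real \<Rightarrow> real \<Rightarrow> nat \<Rightarrow> (real \<Rightarrow> 'v::euclidean_space) \<Rightarrow> nat \<Rightarrow> real \<Rightarrow> 'v" where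
  "sobolev_deriv a b N u = (SOME g. sobolev_derivs a b N u g)"


subsection \<open>The state space and the port-Hamiltonian operator\<close>

text \<open>As a set, \<open>X\<close> is \<open>L2 a b\<close>.\<close>

definition innerX ::
  "real \<Rightarrow> real \<Rightarrow> (real \<Rightarrow> complex ^ 'n ^ 'n) \<Rightarrow>
   (real \<Rightarrow> complex ^ 'n) \<Rightarrow> (real \<Rightarrow> complex ^ 'n) \<Rightarrow> complex" where
  "innerX a b \<H> f g = 1 / 2 * (LINT \<zeta>|lebesgue_on {a<..<b}. cdot (g \<zeta>) (\<H> \<zeta> *v f \<zeta>))"

definition normX ::
  "real \<Rightarrow> real \<Rightarrow> (real \<Rightarrow> complex ^ 'n ^ 'n) \<Rightarrow> (real \<Rightarrow> complex ^ 'n) \<Rightarrow> real" where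
  "normX a b \<H> f = sqrt (Re (innerX a b \<H> f f))"

definition boundary_values ::
  "real \<Rightarrow> real \<Rightarrow> (real \<Rightarrow> complex ^ 'n) \<Rightarrow>
   complex ^ (('N::{finite,linorder} \<times> 'n) + ('N \<times> 'n))" where
  "boundary_values a b u = (\<chi> r. case r of
      Inl (k, i) \<Rightarrow> sobolev_deriv a b CARD('N) u (pos k) b $ i
    | Inr (k, i) \<Rightarrow> sobolev_deriv a b CARD('N) u (pos k) a $ i)"

definition phs_dom ::
  "real \<Rightarrow> real \<Rightarrow> (real \<Rightarrow> complex ^ 'n ^ 'n) \<Rightarrow>
   complex ^ (('N::{finite,linorder} \<times> 'n) + ('N \<times> 'n)) ^ ('N \<times> 'n) \<Rightarrow>
   (real \<Rightarrow> complex ^ 'n) set" where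
  "phs_dom a b \<H> W = {x \<in> L2 a b. (\<lambda>\<zeta>. \<H> \<zeta> *v x \<zeta>) \<in> Sobolev a b CARD('N) \<and>
     W *v boundary_values a b (\<lambda>\<zeta>. \<H> \<zeta> *v x \<zeta>) = 0}"

definition phs_op ::
  "real \<Rightarrow> real \<Rightarrow> nat \<Rightarrow> (nat \<Rightarrow> complex ^ 'n ^ 'n) \<Rightarrow> (real \<Rightarrow> complex ^ 'n ^ 'n) \<Rightarrow>
   (real \<Rightarrow> complex ^ 'n) \<Rightarrow> real \<Rightarrow> complex ^ 'n" where
  "phs_op a b N P \<H> x =
     (\<lambda>\<zeta>. \<Sum>k\<le>N. P k *v sobolev_deriv a b N (\<lambda>\<xi>. \<H> \<xi> *v x \<xi>) k \<zeta>)"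

definition graph_norm ::
  "real \<Rightarrow> real \<Rightarrow> (real \<Rightarrow> complex ^ 'n ^ 'n) \<Rightarrow>
   ((real \<Rightarrow> complex ^ 'n) \<Rightarrow> real \<Rightarrow> complex ^ 'n) \<Rightarrow> (real \<Rightarrow> complex ^ 'n) \<Rightarrow> real" where
  "graph_norm a b \<H> A x = sqrt ((normX a b \<H> x)\<^sup>2 + (normX a b \<H> (A x))\<^sup>2)"

definition is_eigenvalue ::
  "real \<Rightarrow> real \<Rightarrow> (real \<Rightarrow> complex ^ 'n) set \<Rightarrow>
   ((real \<Rightarrow> complex ^ 'n) \<Rightarrow> real \<Rightarrow> complex ^ 'n) \<Rightarrow> complex \<Rightarrow> bool" where
  "is_eigenvalue a b D A \<mu> \<longleftrightarrow>
     (\<exists>x\<in>D. \<not> ae_eq a b x (\<lambda>_. 0) \<and> ae_eq a b (A x) (\<lambda>\<zeta>. \<mu> *s x \<zeta>))"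


subsection \<open>Contraction semigroups on the state space\<close>

text \<open>
  \<open>T t\<close> acts on representatives, so the algebraic laws are required up to \<open>ae_eq\<close>; together with
  linearity, contractivity makes \<open>T t\<close> compatible with \<open>ae_eq\<close>. Values at \<open>t < 0\<close> are irrelevant.
\<close>

definition contraction_semigroup ::
  "real \<Rightarrow> real \<Rightarrow> (real \<Rightarrow> complex ^ 'n ^ 'n) \<Rightarrow>
   (real \<Rightarrow> (real \<Rightarrow> complex ^ 'n) \<Rightarrow> real \<Rightarrow> complex ^ 'n) \<Rightarrow> bool" where
  "contraction_semigroup a b \<H> T \<longleftrightarrow>
     (\<forall>t\<ge>0. \<forall>x\<in>L2 a b. T t x \<in> L2 a b) \<and>
     (\<forall>t\<ge>0. \<forall>x\<in>L2 a b. \<forall>y\<in>L2 a b.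
        ae_eq a b (T t (\<lambda>\<zeta>. x \<zeta> + y \<zeta>)) (\<lambda>\<zeta>. T t x \<zeta> + T t y \<zeta>)) \<and>
     (\<forall>t\<ge>0. \<forall>x\<in>L2 a b. \<forall>c.
        ae_eq a b (T t (\<lambda>\<zeta>. c *s x \<zeta>)) (\<lambda>\<zeta>. c *s T t x \<zeta>)) \<and>
     (\<forall>t\<ge>0. \<forall>x\<in>L2 a b. normX a b \<H> (T t x) \<le> normX a b \<H> x) \<and>
     (\<forall>x\<in>L2 a b. ae_eq a b (T 0 x) x) \<and>
     (\<forall>s\<ge>0. \<forall>t\<ge>0. \<forall>x\<in>L2 a b. ae_eq a b (T (s + t) x) (T s (T t x))) \<and>
     (\<forall>x\<in>L2 a b. ((\<lambda>t. normX a b \<H> (\<lambda>\<zeta>. T t x \<zeta> - x \<zeta>)) \<longlongrightarrow> 0) (at_right 0))"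

definition right_derivative_at_0 ::
  "real \<Rightarrow> real \<Rightarrow> (real \<Rightarrow> complex ^ 'n ^ 'n) \<Rightarrow>
   (real \<Rightarrow> (real \<Rightarrow> complex ^ 'n) \<Rightarrow> real \<Rightarrow> complex ^ 'n) \<Rightarrow>
   (real \<Rightarrow> complex ^ 'n) \<Rightarrow> (real \<Rightarrow> complex ^ 'n) \<Rightarrow> bool" where
  "right_derivative_at_0 a b \<H> T x y \<longleftrightarrow>
     ((\<lambda>h. normX a b \<H> (\<lambda>\<zeta>. (1 / h) *\<^sub>R (T h x \<zeta> - x \<zeta>) - y \<zeta>)) \<longlongrightarrow> 0) (at_right 0)"

definition is_generator ::
  "real \<Rightarrow> real \<Rightarrow> (real \<Rightarrow> complex ^ 'n ^ 'n) \<Rightarrow>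
   (real \<Rightarrow> (real \<Rightarrow> complex ^ 'n) \<Rightarrow> real \<Rightarrow> complex ^ 'n) \<Rightarrow>
   (real \<Rightarrow> complex ^ 'n) set \<Rightarrow> ((real \<Rightarrow> complex ^ 'n) \<Rightarrow> real \<Rightarrow> complex ^ 'n) \<Rightarrow> bool" where
  "is_generator a b \<H> T D A \<longleftrightarrow>
     D = {x \<in> L2 a b. \<exists>y\<in>L2 a b. right_derivative_at_0 a b \<H> T x y} \<and>
     (\<forall>x\<in>D. right_derivative_at_0 a b \<H> T x (A x))"

definition semi_uniformly_stable ::
  "real \<Rightarrow> real \<Rightarrow> (real \<Rightarrow> complex ^ 'n ^ 'n) \<Rightarrow>
   (real \<Rightarrow> (real \<Rightarrow> complex ^ 'n) \<Rightarrow> real \<Rightarrow> complex ^ 'n) \<Rightarrow>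
   (real \<Rightarrow> complex ^ 'n) set \<Rightarrow> ((real \<Rightarrow> complex ^ 'n) \<Rightarrow> real \<Rightarrow> complex ^ 'n) \<Rightarrow> bool" where
  "semi_uniformly_stable a b \<H> T D A \<longleftrightarrow>
     (\<exists>f :: real \<Rightarrow> real. (\<forall>t\<ge>0. f t \<ge> 0) \<and> (f \<longlongrightarrow> 0) at_top \<and>
        (\<forall>x\<in>D. \<forall>t\<ge>0. normX a b \<H> (T t x) \<le> f t * graph_norm a b \<H> A x))"

definition asymptotically_stable ::
  "real \<Rightarrow> real \<Rightarrow> (real \<Rightarrow> complex ^ 'n ^ 'n) \<Rightarrow>
   (real \<Rightarrow> (real \<Rightarrow> complex ^ 'n) \<Rightarrow> real \<Rightarrow> complex ^ 'n) \<Rightarrow> bool" where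
  "asymptotically_stable a b \<H> T \<longleftrightarrow>
     (\<forall>x\<in>L2 a b. ((\<lambda>t. normX a b \<H> (T t x)) \<longlongrightarrow> 0) at_top)"


subsection \<open>The fundamental solution\<close>

definition is_fundamental_solution ::
  "real \<Rightarrow> real \<Rightarrow> (nat \<Rightarrow> complex ^ 'n ^ 'n) \<Rightarrow> (real \<Rightarrow> complex ^ 'n ^ 'n) \<Rightarrow> complex \<Rightarrow>
   (real \<Rightarrow> complex ^ ('N::{finite,linorder} \<times> 'n) ^ ('N \<times> 'n)) \<Rightarrow> bool" where
  "is_fundamental_solution a b P \<H> \<mu> \<Psi> \<longleftrightarrow>
     continuous_on {a..b} \<Psi> \<and> \<Psi> \<in> Sobolev a b 1 \<and>
     ae_eq a b (sobolev_deriv a b 1 \<Psi> 1) (\<lambda>\<zeta>. companion P \<H> \<mu> \<zeta> ** \<Psi> \<zeta>) \<and>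
     \<Psi> a = mat 1"

text \<open>
  A fundamental solution is unique on \<open>[a,b]\<close>, but not as a function on \<open>\<real>\<close>; hence \<open>SOME\<close>
  rather than \<open>THE\<close>.
\<close>

definition fundamental_solution ::
  "real \<Rightarrow> real \<Rightarrow> (nat \<Rightarrow> complex ^ 'n ^ 'n) \<Rightarrow> (real \<Rightarrow> complex ^ 'n ^ 'n) \<Rightarrow> complex \<Rightarrow>
   real \<Rightarrow> complex ^ ('N::{finite,linorder} \<times> 'n) ^ ('N \<times> 'n)" where
  "fundamental_solution a b P \<H> \<mu> = (SOME \<Psi>. is_fundamental_solution a b P \<H> \<mu> \<Psi>)"

end

theory Submission
  imports Defs "HOL-Complex_Analysis.Great_Picard" "HOL-Library.Function_Algebras"
begin

text \<open>
  For imaginary \<open>\<mu>\<close> the companion matrix is skew with respect to \<open>Q\<close>, so \<open>\<Psi>(b)\<^sup>* Q \<Psi>(b) = Q\<close>: the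
  quadratic condition in (v) is void, and (iii), (iv), (v) all say that the boundary value problem
  for \<open>A x = \<mu> x\<close> has only the zero solution.

  An imaginary eigenvalue gives an orbit of constant norm, which contradicts (i) and (ii).
  Conversely, if \<open>0\<close> is not an eigenvalue, solving the boundary value problem shows that \<open>A\<close> has an
  inverse \<open>K\<close>, compact by the Arzela-Ascoli theorem. An orbit starting in the domain then has a limit
  point \<open>y\<close>. If the orbit does not tend to \<open>0\<close>, then \<open>y\<close> is not zero and all \<open>K\<^sup>j y\<close> have isometric
  orbits, which makes \<open>K\<close> skew along this sequence; the normalised iterates \<open>K\<^sup>j y\<close> accumulate at an
  eigenvector of \<open>K\<^sup>2\<close> with negative eigenvalue, whence \<open>A\<close> has an imaginary eigenvalue. Finally,
  strong convergence is uniform on the relatively compact graph norm unit ball, which is (i).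
\<close>

subsection \<open>Contraction semigroups with compact inverse generator\<close>

text \<open>Vectors are representatives, norms are seminorms and the inverse comes from pointwise
  choice, so operator identities hold only up to null vectors. The abstract part is therefore
  confined to what survives this: norm inequalities, the real part of the inner product and limits
  of sequences. It uses neither completeness nor vector-valued integrals: compactness supplies the
  limit points, and \<open>mean_value_bound\<close> stands in for integration. Contractivity is
  exploited twice. It makes orbit norms decrease, and it excludes eigenvalues in the open right half
  plane. For the boundary value problem injectivity implies solvability, so
  \<open>l y - A y = f\<close> can be solved for every \<open>l > 0\<close>; Yosida approximation
  then shows that the domain is dense, which carries decay from the domain to all of
  \<open>X\<close>. On vectors with isometric orbits the inverse behaves like a compact skew-adjoint
  operator. Power iteration looks for an eigenvector along a single sequence, so that no subspace or
  spectral theorem has to be set up in the seminormed setting.\<close>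

lemma nonneg_quadratic_discriminant:
  fixes p q r :: real
  assumes "\<And>t. 0 \<le> p + 2 * q * t + r * t\<^sup>2" and "0 \<le> r"
  shows "q\<^sup>2 \<le> p * r"
proof (cases "r = 0")
  case True
  have "q = 0"
  proof (rule ccontr)
    assume "q \<noteq> 0"
    \<comment> \<open>At this point the remaining affine function takes the value
      \<open>-1\<close>.\<close>
    with assms(1)[of "- (p + 1) / (2 * q)"] True show False by (simp add: field_simps)
  qed
  then show ?thesis using True by simp
next
  case False
  then have r: "r > 0" using assms(2) by simp
  have "p + 2 * q * (- q / r) + r * (- q / r)\<^sup>2 = p - q\<^sup>2 / r"
    using r by (simp add: field_simps power2_eq_square)
  with assms(1)[of "- q / r"] have "q\<^sup>2 / r \<le> p" by linarith
  then show ?thesis using r by (simp add: field_simps)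
qed

text \<open>Elements of the state space are representatives, so \<open>ip\<close> is only semidefinite, and the laws of
  the semigroup hold up to vectors of norm zero.\<close>

locale complex_semi_inner_space = vector_space sc
  for sc :: "complex \<Rightarrow> 'v::ab_group_add \<Rightarrow> 'v" +
  fixes X :: "'v set" and ip :: "'v \<Rightarrow> 'v \<Rightarrow> real"
  assumes zero_closed [simp]: "0 \<in> X"
    and add_closed [simp]: "x \<in> X \<Longrightarrow> y \<in> X \<Longrightarrow> x + y \<in> X"
    and sc_closed [simp]: "x \<in> X \<Longrightarrow> sc c x \<in> X"
    and ip_add: "x \<in> X \<Longrightarrow> y \<in> X \<Longrightarrow> z \<in> X \<Longrightarrow> ip (x + y) z = ip x z + ip y z"
    and ip_commute: "x \<in> X \<Longrightarrow> y \<in> X \<Longrightarrow> ip x y = ip y x"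
    and ip_sc_real: "x \<in> X \<Longrightarrow> y \<in> X \<Longrightarrow> ip (sc (complex_of_real r) x) y = r * ip x y"
    and ip_sc_self: "x \<in> X \<Longrightarrow> ip (sc c x) (sc c x) = (cmod c)\<^sup>2 * ip x x"
    and ip_nonneg [simp]: "x \<in> X \<Longrightarrow> 0 \<le> ip x x"
begin

definition nrm :: "'v \<Rightarrow> real" where "nrm x = sqrt (ip x x)"

text \<open>Membership in \<open>X\<close> is part of the relation, so chains of equivalences carry
  the side conditions needed for the next step.\<close>

definition eqv :: "'v \<Rightarrow> 'v \<Rightarrow> bool" (infix "\<simeq>" 50) where
  "x \<simeq> y \<longleftrightarrow> x \<in> X \<and> y \<in> X \<and> nrm (x - y) = 0"

lemma uminus_closed [simp]: "x \<in> X \<Longrightarrow> - x \<in> X"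
  by (metis sc_closed scale_minus_left scale_one)

lemma diff_closed [simp]: "x \<in> X \<Longrightarrow> y \<in> X \<Longrightarrow> x - y \<in> X"
  by (metis add_closed uminus_closed diff_conv_add_uminus)

lemma ip_add_right: "x \<in> X \<Longrightarrow> y \<in> X \<Longrightarrow> z \<in> X \<Longrightarrow> ip z (x + y) = ip z x + ip z y"
  by (metis add_closed ip_add ip_commute)

lemma ip_sc_real_right: "x \<in> X \<Longrightarrow> y \<in> X \<Longrightarrow> ip x (sc (complex_of_real r) y) = r * ip x y"
  by (metis sc_closed ip_sc_real ip_commute)

lemma ip_uminus: "x \<in> X \<Longrightarrow> y \<in> X \<Longrightarrow> ip (- x) y = - ip x y"
  using ip_sc_real[of x y "-1"] by simp

lemma ip_uminus_right: "x \<in> X \<Longrightarrow> y \<in> X \<Longrightarrow> ip x (- y) = - ip x y"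
  by (metis uminus_closed ip_uminus ip_commute)

lemma ip_diff: "x \<in> X \<Longrightarrow> y \<in> X \<Longrightarrow> z \<in> X \<Longrightarrow> ip (x - y) z = ip x z - ip y z"
  using ip_add[of x "- y" z] by (simp add: ip_uminus)

lemma ip_diff_right: "x \<in> X \<Longrightarrow> y \<in> X \<Longrightarrow> z \<in> X \<Longrightarrow> ip z (x - y) = ip z x - ip z y"
  by (metis diff_closed ip_diff ip_commute)

lemmas ip_simps = ip_add ip_add_right ip_diff ip_diff_right ip_uminus ip_uminus_right
  ip_sc_real ip_sc_real_right

lemma nrm_ge_0 [simp]: "x \<in> X \<Longrightarrow> 0 \<le> nrm x"
  by (simp add: nrm_def)

lemma nrm_sq: "x \<in> X \<Longrightarrow> (nrm x)\<^sup>2 = ip x x"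
  by (simp add: nrm_def)

lemma nrm_0 [simp]: "nrm 0 = 0"
  using ip_sc_self[of 0 0] by (simp add: nrm_def)

lemma nrm_sc: "x \<in> X \<Longrightarrow> nrm (sc c x) = cmod c * nrm x"
  by (simp add: nrm_def ip_sc_self real_sqrt_mult)

lemma nrm_uminus: "x \<in> X \<Longrightarrow> nrm (- x) = nrm x"
  using nrm_sc[of x "-1"] by simp

lemma nrm_minus_commute: "x \<in> X \<Longrightarrow> y \<in> X \<Longrightarrow> nrm (x - y) = nrm (y - x)"
  using nrm_uminus[of "x - y"] by simp

lemma Cauchy_Schwarz: assumes "x \<in> X" "y \<in> X" shows "\<bar>ip x y\<bar> \<le> nrm x * nrm y"
proof -
  have "0 \<le> ip x x + 2 * ip x y * t + ip y y * t\<^sup>2" for t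
    using ip_nonneg[of "x + sc (of_real t) y"] assms ip_commute[of x y]
    by (simp add: ip_simps algebra_simps power2_eq_square)
  then have "(ip x y)\<^sup>2 \<le> ip x x * ip y y"
    by (rule nonneg_quadratic_discriminant) (simp add: assms)
  then show ?thesis
    by (metis nrm_def real_sqrt_abs real_sqrt_le_iff real_sqrt_mult)
qed

lemma nrm_triangle: assumes "x \<in> X" "y \<in> X" shows "nrm (x + y) \<le> nrm x + nrm y"
proof -
  have "(nrm (x + y))\<^sup>2 = (nrm x)\<^sup>2 + 2 * ip x y + (nrm y)\<^sup>2"
    using assms ip_commute[of x y] by (simp add: nrm_sq ip_simps)
  also have "\<dots> \<le> (nrm x + nrm y)\<^sup>2"
    using Cauchy_Schwarz[OF assms] by (simp add: power2_sum)
  finally show ?thesis using assms by (meson add_nonneg_nonneg nrm_ge_0 power2_le_imp_le)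
qed

lemma nrm_triangle_diff: "x \<in> X \<Longrightarrow> y \<in> X \<Longrightarrow> nrm (x - y) \<le> nrm x + nrm y"
  using nrm_triangle[of x "- y"] by (simp add: nrm_uminus)

lemma nrm_diff_triangle:
  "x \<in> X \<Longrightarrow> y \<in> X \<Longrightarrow> z \<in> X \<Longrightarrow> nrm (x - z) \<le> nrm (x - y) + nrm (y - z)"
  using nrm_triangle[of "x - y" "y - z"] by simp

lemma nrm_le_diff: "x \<in> X \<Longrightarrow> y \<in> X \<Longrightarrow> nrm x \<le> nrm (x - y) + nrm y"
  using nrm_triangle[of "x - y" y] by simp

lemma nrm_abs_diff: "x \<in> X \<Longrightarrow> y \<in> X \<Longrightarrow> \<bar>nrm x - nrm y\<bar> \<le> nrm (x - y)"
  using nrm_le_diff[of x y] nrm_le_diff[of y x] nrm_minus_commute[of x y] by linarith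

lemma parallelogram:
  "x \<in> X \<Longrightarrow> y \<in> X \<Longrightarrow> (nrm (x + y))\<^sup>2 + (nrm (x - y))\<^sup>2 = 2 * (nrm x)\<^sup>2 + 2 * (nrm y)\<^sup>2"
  using ip_commute[of x y] by (simp add: nrm_sq ip_simps)

lemma eqv_closed: "x \<simeq> y \<Longrightarrow> x \<in> X" "x \<simeq> y \<Longrightarrow> y \<in> X"
  by (auto simp: eqv_def)

lemma eqv_refl [simp]: "x \<simeq> x \<longleftrightarrow> x \<in> X"
  by (auto simp: eqv_def)

lemma eqv_sym: "x \<simeq> y \<Longrightarrow> y \<simeq> x"
  by (auto simp: eqv_def nrm_minus_commute)

lemma nrm_zero_iff_le: "x \<in> X \<Longrightarrow> nrm x \<le> 0 \<longleftrightarrow> nrm x = 0"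
  using nrm_ge_0[of x] by linarith

lemma eqvI: "x \<in> X \<Longrightarrow> y \<in> X \<Longrightarrow> nrm (x - y) \<le> 0 \<Longrightarrow> x \<simeq> y"
  by (simp add: eqv_def nrm_zero_iff_le)

lemma eqv_trans [trans]: "x \<simeq> y \<Longrightarrow> y \<simeq> z \<Longrightarrow> x \<simeq> z"
  using nrm_diff_triangle[of x y z] by (intro eqvI) (auto simp: eqv_def)

lemma eqv_nrm: "x \<simeq> y \<Longrightarrow> nrm x = nrm y"
  using nrm_abs_diff[of x y] by (auto simp: eqv_def)

lemma eqv_add: "x \<simeq> y \<Longrightarrow> x' \<simeq> y' \<Longrightarrow> x + x' \<simeq> y + y'"
  using nrm_triangle[of "x - y" "x' - y'"]
  by (intro eqvI) (auto simp: eqv_def algebra_simps)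

lemma eqv_sc: "x \<simeq> y \<Longrightarrow> sc c x \<simeq> sc c y"
  by (auto simp: eqv_def nrm_sc scale_right_diff_distrib[symmetric])

lemma eqv_uminus: "x \<simeq> y \<Longrightarrow> - x \<simeq> - y"
  using eqv_sc[of x y "-1"] by simp

lemma eqv_diff: "x \<simeq> y \<Longrightarrow> x' \<simeq> y' \<Longrightarrow> x - x' \<simeq> y - y'"
  using eqv_add[of x y "- x'" "- y'"] eqv_uminus by simp

text \<open>Summing the increments over finer and finer partitions replaces the integral of the derivative of \<open>\<phi>\<close>.\<close>

lemma mean_value_bound:
  assumes \<phi>: "\<And>t. 0 \<le> t \<Longrightarrow> t \<le> \<delta> \<Longrightarrow> \<phi> t \<in> X" and "0 < \<delta>"
    and inc: "\<And>e. \<epsilon> < e \<Longrightarrow> \<exists>d>0. \<forall>t h. 0 \<le> t \<and> 0 < h \<and> h \<le> d \<and> t + h \<le> \<delta>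
        \<longrightarrow> nrm (\<phi> (t + h) - \<phi> t) \<le> e * h"
  shows "nrm (\<phi> \<delta> - \<phi> 0) \<le> \<epsilon> * \<delta>"
proof -
  \<comment> \<open>The admissible mesh \<open>d\<close> depends on \<open>e\<close> and may shrink
    as \<open>e\<close> approaches \<open>\<epsilon>\<close>; hence each \<open>e\<close> is treated
    separately and the limit is taken only at the end.\<close>
  have *: "nrm (\<phi> \<delta> - \<phi> 0) \<le> e * \<delta>" if e: "\<epsilon> < e" for e
  proof -
    obtain d where "d > 0" and d: "\<And>t h. 0 \<le> t \<Longrightarrow> 0 < h \<Longrightarrow> h \<le> d \<Longrightarrow> t + h \<le> \<delta>
        \<Longrightarrow> nrm (\<phi> (t + h) - \<phi> t) \<le> e * h"
      using inc[OF e] by blast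
    obtain n :: nat where n: "\<delta> / d < n" using reals_Archimedean2 by blast
    have n0: "real n > 0" using n \<open>0 < \<delta>\<close> \<open>d > 0\<close> by (meson divide_pos_pos less_trans)
    define h where "h = \<delta> / n"
    have h: "0 < h" "h \<le> d" "n * h = \<delta>"
      using n n0 \<open>0 < \<delta>\<close> \<open>d > 0\<close> by (auto simp: h_def field_simps)
    have "nrm (\<phi> (k * h) - \<phi> 0) \<le> e * (k * h)" if "k \<le> n" for k
      using that
    proof (induction k)
      case 0
      then show ?case by simp
    next
      case (Suc k)
      have le: "real (Suc k) * h \<le> \<delta>"
        using Suc.prems h by (metis mult_right_mono less_eq_real_def of_nat_le_iff)
      have le': "real k * h + h \<le> \<delta>" using le by (simp add: algebra_simps)
      have le'': "real k * h \<le> \<delta>" using le' h by linarith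
      have k0: "0 \<le> real k * h" using h by simp
      have "nrm (\<phi> (Suc k * h) - \<phi> 0) \<le> nrm (\<phi> (k * h + h) - \<phi> (k * h)) + nrm (\<phi> (k * h) - \<phi> 0)"
        using nrm_diff_triangle[of "\<phi> (k * h + h)" "\<phi> (k * h)" "\<phi> 0"] \<phi> h k0 le' le'' \<open>0 < \<delta>\<close>
        by (simp add: algebra_simps)
      also have "\<dots> \<le> e * h + e * (k * h)"
        using d[of "k * h" h] Suc h k0 le' by fastforce
      finally show ?case by (simp add: algebra_simps)
    qed
    from this[of n] show ?thesis using h by simp
  qed
  have "(nrm (\<phi> \<delta> - \<phi> 0)) / \<delta> \<le> e" if "\<epsilon> < e" for e
    using *[OF that] \<open>0 < \<delta>\<close> by (simp add: field_simps)
  then have "(nrm (\<phi> \<delta> - \<phi> 0)) / \<delta> \<le> \<epsilon>" by (rule dense_ge)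
  then show ?thesis using \<open>0 < \<delta>\<close> by (simp add: field_simps)
qed

end

section \<open>Generators as right derivatives of orbits\<close>

locale contraction_semigroup_generator = complex_semi_inner_space sc X ip
  for sc :: "complex \<Rightarrow> 'v::ab_group_add \<Rightarrow> 'v" and X ip +
  fixes T :: "real \<Rightarrow> 'v \<Rightarrow> 'v" and D :: "'v set" and A :: "'v \<Rightarrow> 'v"
  assumes T_closed [simp]: "0 \<le> t \<Longrightarrow> x \<in> X \<Longrightarrow> T t x \<in> X"
    and T_add: "0 \<le> t \<Longrightarrow> x \<in> X \<Longrightarrow> y \<in> X \<Longrightarrow> T t (x + y) \<simeq> T t x + T t y"
    and T_sc: "0 \<le> t \<Longrightarrow> x \<in> X \<Longrightarrow> T t (sc c x) \<simeq> sc c (T t x)"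
    and T_contraction: "0 \<le> t \<Longrightarrow> x \<in> X \<Longrightarrow> nrm (T t x) \<le> nrm x"
    and T_0: "x \<in> X \<Longrightarrow> T 0 x \<simeq> x"
    and T_plus: "0 \<le> s \<Longrightarrow> 0 \<le> t \<Longrightarrow> x \<in> X \<Longrightarrow> T (s + t) x \<simeq> T s (T t x)"
    and T_continuous: "x \<in> X \<Longrightarrow> ((\<lambda>h. nrm (T h x - x)) \<longlongrightarrow> 0) (at_right 0)"
    and D_eq: "D = {x \<in> X. \<exists>y\<in>X.
      ((\<lambda>h. nrm (sc (complex_of_real (1 / h)) (T h x - x) - y)) \<longlongrightarrow> 0) (at_right 0)}"
    and A_closed [simp]: "x \<in> D \<Longrightarrow> A x \<in> X"
    and A_deriv: "x \<in> D \<Longrightarrow>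
      ((\<lambda>h. nrm (sc (complex_of_real (1 / h)) (T h x - x) - A x)) \<longlongrightarrow> 0) (at_right 0)"
begin

lemma T_uminus: "0 \<le> t \<Longrightarrow> x \<in> X \<Longrightarrow> T t (- x) \<simeq> - T t x"
  using T_sc[of t x "-1"] by simp

lemma T_diff: assumes "0 \<le> t" "x \<in> X" "y \<in> X" shows "T t (x - y) \<simeq> T t x - T t y"
proof -
  have "T t (x + - y) \<simeq> T t x + T t (- y)" using assms by (intro T_add) auto
  also have "\<dots> \<simeq> T t x + - T t y" using assms T_uminus by (intro eqv_add) auto
  finally show ?thesis by simp
qed

lemma nrm_T_diff: "0 \<le> t \<Longrightarrow> x \<in> X \<Longrightarrow> y \<in> X \<Longrightarrow> nrm (T t x - T t y) \<le> nrm (x - y)"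
  using eqv_nrm[OF T_diff] T_contraction[of t "x - y"] by simp

lemma eqv_T: "0 \<le> t \<Longrightarrow> x \<simeq> y \<Longrightarrow> T t x \<simeq> T t y"
  using nrm_T_diff[of t x y] by (intro eqvI) (auto simp: eqv_def)

lemma T_commute: assumes "0 \<le> s" "0 \<le> t" "x \<in> X" shows "T s (T t x) \<simeq> T t (T s x)"
proof -
  have "T s (T t x) \<simeq> T (s + t) x" using T_plus[OF assms] by (rule eqv_sym)
  also have "\<dots> \<simeq> T t (T s x)" using T_plus[of t s x] assms by (simp add: add.commute)
  finally show ?thesis .
qed

lemma D_subset: "x \<in> D \<Longrightarrow> x \<in> X"
  using D_eq by blast

text \<open>The expansion \<open>T h x = x + h y + o(h)\<close>, a form free of division. It is a
  relation because \<open>y\<close> is determined only up to null vectors, and it passes directly to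
  sums and to images under bounded maps.\<close>

definition rder :: "'v \<Rightarrow> 'v \<Rightarrow> bool" where
  "rder x y \<longleftrightarrow> x \<in> X \<and> y \<in> X \<and>
     (\<forall>e>0. \<exists>d>0. \<forall>h. 0 < h \<and> h \<le> d \<longrightarrow> nrm (T h x - x - sc (complex_of_real h) y) \<le> e * h)"

lemma rder_closed: "rder x y \<Longrightarrow> x \<in> X" "rder x y \<Longrightarrow> y \<in> X"
  by (auto simp: rder_def)

lemma rderD:
  assumes "rder x y" "0 < e"
  obtains d where "d > 0"
    "\<And>h. 0 < h \<Longrightarrow> h \<le> d \<Longrightarrow> nrm (T h x - x - sc (complex_of_real h) y) \<le> e * h"
  using assms unfolding rder_def by blast

lemma rder_iff_tendsto:
  assumes "x \<in> X" "y \<in> X"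
  shows "rder x y \<longleftrightarrow>
    ((\<lambda>h. nrm (sc (complex_of_real (1 / h)) (T h x - x) - y)) \<longlongrightarrow> 0) (at_right 0)"
proof -
  have eq: "nrm (sc (complex_of_real (1 / h)) (T h x - x) - y)
      = nrm (T h x - x - sc (complex_of_real h) y) / h" if "0 < h" for h
  proof -
    have "sc (complex_of_real (1 / h)) (T h x - x) - y
        = sc (complex_of_real (1 / h)) (T h x - x - sc (complex_of_real h) y)"
      using that by (simp add: scale_right_diff_distrib flip: of_real_mult)
    then have "nrm (sc (complex_of_real (1 / h)) (T h x - x) - y)
        = cmod (complex_of_real (1 / h)) * nrm (T h x - x - sc (complex_of_real h) y)"
      using assms that by (simp only:) (rule nrm_sc, simp)
    then show ?thesis using that by (simp add: norm_divide)
  qed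
  have ge0: "0 \<le> nrm (T h x - x - sc (complex_of_real h) y)" if "0 < h" for h
    using that assms by simp
  have "((\<lambda>h. nrm (sc (complex_of_real (1 / h)) (T h x - x) - y)) \<longlongrightarrow> 0) (at_right 0) \<longleftrightarrow>
    ((\<lambda>h. nrm (T h x - x - sc (complex_of_real h) y) / h) \<longlongrightarrow> 0) (at_right 0)"
    by (rule tendsto_cong, rule eventually_at_rightI[of 0 1]) (use eq in auto)
  also have "\<dots> \<longleftrightarrow>
    (\<forall>e>0. \<exists>d>0. \<forall>h. 0 < h \<and> h < d \<longrightarrow> nrm (T h x - x - sc (complex_of_real h) y) / h < e)"
  proof -
    have abs_eq: "\<bar>nrm (T h x - x - sc (complex_of_real h) y) / h\<bar>
        = nrm (T h x - x - sc (complex_of_real h) y) / h" if "0 < h" for h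
      using ge0[OF that] that by simp
    then show ?thesis
      unfolding tendsto_iff eventually_at_right_field dist_real_def diff_0_right
      by (simp add: imp_conjL abs_eq cong: imp_cong)
  qed
  also have "\<dots> \<longleftrightarrow> (\<forall>e>0. \<exists>d>0. \<forall>h. 0 < h \<and> h \<le> d \<longrightarrow>
      nrm (T h x - x - sc (complex_of_real h) y) \<le> e * h)"
  proof (intro iffI allI impI)
    fix e :: real assume e: "e > 0" and
      H: "\<forall>e>0. \<exists>d>0. \<forall>h. 0 < h \<and> h < d \<longrightarrow> nrm (T h x - x - sc (complex_of_real h) y) / h < e"
    obtain d where d: "d > 0"
      "\<And>h. 0 < h \<Longrightarrow> h < d \<Longrightarrow> nrm (T h x - x - sc (complex_of_real h) y) / h < e"
      using H e by blast
    have "nrm (T h x - x - sc (complex_of_real h) y) \<le> e * h" if "0 < h" "h \<le> d / 2" for h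
      using d(2)[of h] that \<open>d > 0\<close> by (simp add: field_simps)
    then show "\<exists>d>0. \<forall>h. 0 < h \<and> h \<le> d \<longrightarrow>
        nrm (T h x - x - sc (complex_of_real h) y) \<le> e * h"
      using \<open>d > 0\<close> by (intro exI[of _ "d / 2"]) auto
  next
    fix e :: real assume e: "e > 0" and H: "\<forall>e>0. \<exists>d>0. \<forall>h. 0 < h \<and> h \<le> d \<longrightarrow>
      nrm (T h x - x - sc (complex_of_real h) y) \<le> e * h"
    obtain d where d: "d > 0"
      "\<And>h. 0 < h \<Longrightarrow> h \<le> d \<Longrightarrow> nrm (T h x - x - sc (complex_of_real h) y) \<le> e / 2 * h"
      using H[rule_format, of "e / 2"] e by auto
    have "nrm (T h x - x - sc (complex_of_real h) y) / h < e" if "0 < h" "h < d" for h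
    proof -
      have "nrm (T h x - x - sc (complex_of_real h) y) / h \<le> e / 2"
        using d(2)[of h] that by (simp add: field_simps)
      then show ?thesis using e by linarith
    qed
    then show "\<exists>d>0. \<forall>h. 0 < h \<and> h < d \<longrightarrow>
        nrm (T h x - x - sc (complex_of_real h) y) / h < e"
      using d(1) by blast
  qed
  finally show ?thesis using assms by (simp add: rder_def)
qed

lemma rder_A: "x \<in> D \<Longrightarrow> rder x (A x)"
  using rder_iff_tendsto A_deriv D_subset by simp

text \<open>Maximality of \<open>D\<close> enters here: a constructed vector is shown to lie in the
  domain by exhibiting a derivative.\<close>

lemma rder_in_D: "rder x y \<Longrightarrow> x \<in> D"
  using rder_iff_tendsto[of x y] rder_closed[of x y] by (auto simp: D_eq)

lemma rder_add:
  assumes "rder x y" "rder x' y'"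
  shows "rder (x + x') (y + y')"
  unfolding rder_def
proof (intro conjI allI impI)
  note cl = rder_closed[OF assms(1)] rder_closed[OF assms(2)]
  show "x + x' \<in> X" "y + y' \<in> X" using cl by simp_all
  fix e :: real assume "e > 0"
  obtain d where d: "d > 0"
    "\<And>h. 0 < h \<Longrightarrow> h \<le> d \<Longrightarrow> nrm (T h x - x - sc (complex_of_real h) y) \<le> e/2 * h"
    using rderD[OF assms(1), of "e/2"] \<open>e > 0\<close> by auto
  obtain d' where d': "d' > 0"
    "\<And>h. 0 < h \<Longrightarrow> h \<le> d' \<Longrightarrow> nrm (T h x' - x' - sc (complex_of_real h) y') \<le> e/2 * h"
    using rderD[OF assms(2), of "e/2"] \<open>e > 0\<close> by auto
  have "nrm (T h (x + x') - (x + x') - sc (complex_of_real h) (y + y')) \<le> e * h"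
    if h: "0 < h" "h \<le> min d d'" for h
  proof -
    have "T h (x + x') - (x + x') - sc (complex_of_real h) (y + y') \<simeq>
      T h x + T h x' - (x + x') - sc (complex_of_real h) (y + y')"
      using cl h by (intro eqv_diff T_add) auto
    also have "T h x + T h x' - (x + x') - sc (complex_of_real h) (y + y')
       = (T h x - x - sc (complex_of_real h) y) + (T h x' - x' - sc (complex_of_real h) y')"
      by (simp add: scale_right_distrib)
    finally have "nrm (T h (x + x') - (x + x') - sc (complex_of_real h) (y + y'))
      = nrm ((T h x - x - sc (complex_of_real h) y) + (T h x' - x' - sc (complex_of_real h) y'))"
      by (rule eqv_nrm)
    also have "\<dots> \<le> nrm (T h x - x - sc (complex_of_real h) y)
        + nrm (T h x' - x' - sc (complex_of_real h) y')"
      using cl h by (intro nrm_triangle) auto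
    finally show ?thesis using d(2)[of h] d'(2)[of h] h by simp
  qed
  then show "\<exists>d>0. \<forall>h. 0 < h \<and> h \<le> d \<longrightarrow>
      nrm (T h (x + x') - (x + x') - sc (complex_of_real h) (y + y')) \<le> e * h"
    using d(1) d'(1) by (intro exI[of _ "min d d'"]) auto
qed

text \<open>A bounded linear map commuting with the semigroup sends the remainder at
  \<open>x\<close> to the remainder at \<open>U x\<close>. Common source of the rules for
  \<open>T t\<close> and for scalars.\<close>

lemma rder_image:
  assumes "rder x y" and U: "\<And>z. z \<in> X \<Longrightarrow> U z \<in> X"
    and add: "\<And>z w. z \<in> X \<Longrightarrow> w \<in> X \<Longrightarrow> U (z - w) \<simeq> U z - U w"
    and sc: "\<And>c z. z \<in> X \<Longrightarrow> U (sc c z) \<simeq> sc c (U z)"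
    and T: "\<And>h z. 0 \<le> h \<Longrightarrow> z \<in> X \<Longrightarrow> T h (U z) \<simeq> U (T h z)"
    and bound: "\<And>z. z \<in> X \<Longrightarrow> nrm (U z) \<le> C * nrm z" and C: "0 < C"
  shows "rder (U x) (U y)"
  unfolding rder_def
proof (intro conjI allI impI)
  note cl = rder_closed[OF assms(1)]
  show "U x \<in> X" "U y \<in> X" using cl U by auto
  fix e :: real assume "e > 0"
  then obtain d where d: "d > 0"
    "\<And>h. 0 < h \<Longrightarrow> h \<le> d \<Longrightarrow> nrm (T h x - x - sc (complex_of_real h) y) \<le> e / C * h"
    using rderD[OF assms(1), of "e / C"] C by auto
  have "nrm (T h (U x) - U x - sc (complex_of_real h) (U y)) \<le> e * h"
    if h: "0 < h" "h \<le> d" for h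
  proof -
    have "T h (U x) - U x - sc (complex_of_real h) (U y)
        \<simeq> U (T h x) - U x - U (sc (complex_of_real h) y)"
      using h cl U by (intro eqv_diff T) (auto intro!: eqv_sym[OF sc])
    also have "\<dots> \<simeq> U (T h x - x) - U (sc (complex_of_real h) y)"
      using h cl U by (intro eqv_diff eqv_sym[OF add]) auto
    also have "\<dots> \<simeq> U (T h x - x - sc (complex_of_real h) y)"
      using h cl U by (intro eqv_sym[OF add]) auto
    finally have "nrm (T h (U x) - U x - sc (complex_of_real h) (U y))
        = nrm (U (T h x - x - sc (complex_of_real h) y))"
      by (rule eqv_nrm)
    also have "\<dots> \<le> C * nrm (T h x - x - sc (complex_of_real h) y)"
      using h cl by (intro bound) auto
    also have "\<dots> \<le> C * (e / C * h)"
      using d(2)[of h] h C by (intro mult_left_mono) auto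
    finally show ?thesis using C by simp
  qed
  then show "\<exists>d>0. \<forall>h. 0 < h \<and> h \<le> d \<longrightarrow>
      nrm (T h (U x) - U x - sc (complex_of_real h) (U y)) \<le> e * h"
    using d(1) by blast
qed

lemma rder_T: "rder x y \<Longrightarrow> 0 \<le> t \<Longrightarrow> rder (T t x) (T t y)"
  using rder_image[of x y "T t" 1] T_diff T_sc T_commute T_contraction by auto

lemma rder_sc: assumes "rder x y" shows "rder (sc c x) (sc c y)"
proof -
  have "cmod c * nrm z \<le> (cmod c + 1) * nrm z" if "z \<in> X" for z
    using that by (intro mult_right_mono) auto
  moreover have "0 < cmod c + 1" by (rule add_nonneg_pos) auto
  moreover have "sc c (sc d z) = sc d (sc c z)" for d z
    by (rule scale_left_commute)
  ultimately show ?thesis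
    using rder_image[OF assms, of "sc c" "cmod c + 1"]
    by (simp add: T_sc nrm_sc scale_right_diff_distrib mult.commute)
qed

lemma rder_diff: "rder x y \<Longrightarrow> rder x' y' \<Longrightarrow> rder (x - x') (y - y')"
  using rder_add[of x y "- x'" "- y'"] rder_sc[of x' y' "-1"] by simp

text \<open>The difference \<open>x - x'\<close> is null, and by contractivity so is its whole
  orbit; the increment of the orbit then says nothing but that \<open>h (y - y')\<close> is
  \<open>o(h)\<close>.\<close>

lemma rder_unique:
  assumes "rder x y" "rder x' y'" "x \<simeq> x'"
  shows "y \<simeq> y'"
proof -
  have r: "rder (x - x') (y - y')" by (rule rder_diff[OF assms(1,2)])
  note cl = rder_closed[OF r]
  have z: "nrm (x - x') = 0" using assms(3) by (simp add: eqv_def)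
  have "nrm (y - y') \<le> e" if "e > 0" for e
  proof -
    obtain d where d: "d > 0"
      "\<And>h. 0 < h \<Longrightarrow> h \<le> d \<Longrightarrow>
        nrm (T h (x - x') - (x - x') - sc (complex_of_real h) (y - y')) \<le> e * h"
      using rderD[OF r \<open>e > 0\<close>] by blast
    have zT: "nrm (T d (x - x') - (x - x')) = 0"
      using T_contraction[of d "x - x'"] z d(1) cl
        nrm_triangle_diff[of "T d (x - x')" "x - x'"] nrm_ge_0[of "T d (x - x') - (x - x')"]
      by (smt (verit) T_closed diff_closed)
    have "d * nrm (y - y') = nrm (sc (complex_of_real d) (y - y'))"
      using d(1) cl by (simp add: nrm_sc)
    also have "\<dots> \<le> nrm (sc (complex_of_real d) (y - y') - (T d (x - x') - (x - x')))
        + nrm (T d (x - x') - (x - x'))"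
      using d(1) cl by (intro nrm_le_diff) auto
    also have "\<dots> \<le> e * d"
      using d(2)[of d] d(1) cl zT
        nrm_minus_commute[of "sc (complex_of_real d) (y - y')" "T d (x - x') - (x - x')"]
      by simp
    finally show ?thesis using d(1) by (simp add: field_simps)
  qed
  then have "nrm (y - y') \<le> 0" by (rule dense_ge)
  then show ?thesis using rder_closed assms(1,2) by (intro eqvI) auto
qed

lemma A_eqv: "rder x y \<Longrightarrow> A x \<simeq> y"
  by (metis rder_A rder_closed(1) rder_in_D rder_unique eqv_refl)

lemma rder_eqv:
  assumes "rder x y" "x' \<simeq> x" "y' \<simeq> y"
  shows "rder x' y'"
  unfolding rder_def
proof (intro conjI allI impI)
  note cl = rder_closed[OF assms(1)] eqv_closed[OF assms(2)] eqv_closed[OF assms(3)]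
  show "x' \<in> X" "y' \<in> X" using cl by auto
  fix e :: real assume "e > 0"
  then obtain d where d: "d > 0"
    "\<And>h. 0 < h \<Longrightarrow> h \<le> d \<Longrightarrow> nrm (T h x - x - sc (complex_of_real h) y) \<le> e * h"
    using rderD[OF assms(1)] by blast
  have "nrm (T h x' - x' - sc (complex_of_real h) y')
      = nrm (T h x - x - sc (complex_of_real h) y)" if "0 < h" for h
    using that assms by (intro eqv_nrm eqv_diff eqv_T eqv_sc) auto
  with d show "\<exists>d>0. \<forall>h. 0 < h \<and> h \<le> d \<longrightarrow>
      nrm (T h x' - x' - sc (complex_of_real h) y') \<le> e * h"
    by auto
qed

text \<open>The increments of \<open>t \<mapsto> e\<^sup>-\<^sup>\<mu>\<^sup>t T(t)x\<close> are \<open>o(h)\<close> uniformly in \<open>t\<close> because \<open>T(t)\<close> is a contraction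
  commuting with \<open>T(h)\<close>.\<close>

lemma exp_increment:
  assumes "0 \<le> t" "0 \<le> h" "x \<in> X" "y \<in> X" "0 \<le> Re \<mu>"
  shows "nrm (sc (exp (- \<mu> * of_real (t + h))) (T (t + h) x) - sc (exp (- \<mu> * of_real t)) (T t x)
      - sc (exp (- \<mu> * of_real t) * of_real h) (T t y))
    \<le> nrm (T h x - x - sc (of_real h) (y + sc \<mu> x))
      + cmod (exp (\<mu> * of_real h) - 1 - \<mu> * of_real h) * nrm x
      + cmod (exp (\<mu> * of_real h) - 1) * (h * nrm y)"
proof -
  define c where "c = exp (- \<mu> * of_real t)"
  define k where "k = exp (- \<mu> * of_real h)"
  define w where "w = sc k (T h x) - x - sc (of_real h) y"
  have c: "cmod c \<le> 1" using assms by (simp add: c_def)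
  have k: "cmod k \<le> 1" using assms by (simp add: k_def)
  have kk: "k * exp (\<mu> * of_real h) = 1" by (simp add: k_def flip: exp_add)
  have w: "w \<in> X" using assms by (simp add: w_def)
  have "T t w \<simeq> T t (sc k (T h x) - x) - T t (sc (of_real h) y)"
    unfolding w_def using assms by (intro T_diff) auto
  also have "\<dots> \<simeq> T t (sc k (T h x)) - T t x - sc (of_real h) (T t y)"
    using assms by (intro eqv_diff T_diff T_sc) auto
  also have "\<dots> \<simeq> sc k (T t (T h x)) - T t x - sc (of_real h) (T t y)"
    using assms by (intro eqv_diff T_sc) auto
  also have "\<dots> \<simeq> sc k (T (t + h) x) - T t x - sc (of_real h) (T t y)"
    using assms by (intro eqv_diff eqv_sc eqv_sym[OF T_plus]) auto
  finally have "sc c (T t w) \<simeq> sc c (sc k (T (t + h) x) - T t x - sc (of_real h) (T t y))"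
    by (rule eqv_sc)
  also have "\<dots> = sc (exp (- \<mu> * of_real (t + h))) (T (t + h) x) - sc c (T t x)
      - sc (c * of_real h) (T t y)"
    by (simp add: scale_right_diff_distrib c_def k_def ring_distribs flip: exp_add)
  finally have "nrm (sc (exp (- \<mu> * of_real (t + h))) (T (t + h) x) - sc c (T t x)
      - sc (c * of_real h) (T t y)) = nrm (sc c (T t w))"
    by (metis eqv_nrm)
  also have "\<dots> \<le> nrm (T t w)"
    using c w assms by (simp add: nrm_sc mult_left_le_one_le)
  also have "\<dots> \<le> nrm w" using w assms by (intro T_contraction) auto
  \<comment> \<open>Since \<open>k * exp (\<mu> h) = 1\<close>, the terms in \<open>x\<close> and
    \<open>y\<close> can be moved under the factor \<open>k\<close>. This isolates the remainder of
    the pair \<open>x\<close>, \<open>y + \<mu> x\<close> and two errors of the scalar exponential,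
    and \<open>k\<close> is then dropped because its modulus is at most one.\<close>
  also have "w = sc k (T h x - x - sc (of_real h) (y + sc \<mu> x)
      - sc (exp (\<mu> * of_real h) - 1 - \<mu> * of_real h) x
      - sc (exp (\<mu> * of_real h) - 1) (sc (of_real h) y))"
  proof -
    have "sc k (T h x - x - sc (of_real h) (y + sc \<mu> x)
      - sc (exp (\<mu> * of_real h) - 1 - \<mu> * of_real h) x
      - sc (exp (\<mu> * of_real h) - 1) (sc (of_real h) y))
      = sc k (T h x) - sc (k * exp (\<mu> * of_real h)) x
        - sc (k * exp (\<mu> * of_real h)) (sc (of_real h) y)"
      by (simp add: scale_right_diff_distrib scale_right_distrib scale_left_diff_distrib
          scale_left_distrib algebra_simps)
    then show ?thesis by (simp add: kk w_def)
  qed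
  also have "nrm \<dots> \<le> nrm (T h x - x - sc (of_real h) (y + sc \<mu> x)
      - sc (exp (\<mu> * of_real h) - 1 - \<mu> * of_real h) x
      - sc (exp (\<mu> * of_real h) - 1) (sc (of_real h) y))"
    using k assms by (subst nrm_sc) (auto simp: mult_left_le_one_le)
  also have "\<dots> \<le> nrm (T h x - x - sc (of_real h) (y + sc \<mu> x)
      - sc (exp (\<mu> * of_real h) - 1 - \<mu> * of_real h) x)
      + nrm (sc (exp (\<mu> * of_real h) - 1) (sc (of_real h) y))"
    using assms by (intro nrm_triangle_diff) auto
  also have "\<dots> \<le> nrm (T h x - x - sc (of_real h) (y + sc \<mu> x))
      + nrm (sc (exp (\<mu> * of_real h) - 1 - \<mu> * of_real h) x)
      + nrm (sc (exp (\<mu> * of_real h) - 1) (sc (of_real h) y))"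
    using assms by (intro add_right_mono nrm_triangle_diff) auto
  finally show ?thesis using assms by (simp add: nrm_sc c_def norm_mult mult.assoc)
qed

end

section \<open>Rescaled orbits and density of the domain\<close>

lemma exp_remainder_bound:
  fixes \<mu> :: complex
  assumes "0 < e"
  shows "\<exists>d>0. \<forall>h. 0 < h \<and> h \<le> d \<longrightarrow> cmod (exp (\<mu> * of_real h) - 1 - \<mu> * of_real h) \<le> e * h
      \<and> cmod (exp (\<mu> * of_real h) - 1) \<le> e"
proof -
  have "((\<lambda>z. exp (\<mu> * z)) has_derivative (\<lambda>z. \<mu> * z)) (at 0)"
    by (auto intro!: derivative_eq_intros)
  then obtain d where "d > 0" and
    d: "\<And>z. cmod z < d \<Longrightarrow> cmod (exp (\<mu> * z) - 1 - \<mu> * z) \<le> e * cmod z"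
    using assms unfolding has_derivative_at_alt by fastforce
  \<comment> \<open>The first entry makes the linearisation applicable, the second gives
    \<open>h * (e + cmod \<mu>) \<le> e\<close>.\<close>
  define d' where "d' = min (d / 2) (e / (e + cmod \<mu>))"
  have pos: "0 < e + cmod \<mu>" using assms by (rule add_pos_nonneg) simp
  have "cmod (exp (\<mu> * of_real h) - 1 - \<mu> * of_real h) \<le> e * h
      \<and> cmod (exp (\<mu> * of_real h) - 1) \<le> e" if h: "0 < h" "h \<le> d'" for h
  proof
    have "h \<le> d / 2" using h by (simp add: d'_def)
    then have "h < d" using \<open>d > 0\<close> by linarith
    then show 1: "cmod (exp (\<mu> * of_real h) - 1 - \<mu> * of_real h) \<le> e * h"
      using d[of "of_real h"] h by simp
    have "cmod (exp (\<mu> * of_real h) - 1) \<le>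
        cmod (exp (\<mu> * of_real h) - 1 - \<mu> * of_real h) + cmod (\<mu> * of_real h)"
      by norm
    also have "\<dots> \<le> e * h + cmod \<mu> * h" using 1 h by (simp add: norm_mult)
    also have "\<dots> = h * (e + cmod \<mu>)" by (simp add: algebra_simps)
    also have "\<dots> \<le> e" using h pos by (simp add: d'_def field_simps)
    finally show "cmod (exp (\<mu> * of_real h) - 1) \<le> e" .
  qed
  moreover have "0 < d'" using \<open>d > 0\<close> assms pos by (simp add: d'_def)
  ultimately show ?thesis by blast
qed

lemma decreasing_nonneg_tendsto:
  fixes g :: "real \<Rightarrow> real"
  assumes "\<And>t. 0 \<le> t \<Longrightarrow> 0 \<le> g t" and "\<And>s t. 0 \<le> s \<Longrightarrow> s \<le> t \<Longrightarrow> g t \<le> g s"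
  shows "\<exists>L. (g \<longlongrightarrow> L) at_top"
proof
  have bdd: "bdd_below (g ` {0..})" using assms(1) by (intro bdd_belowI[of _ 0]) auto
  show "(g \<longlongrightarrow> Inf (g ` {0..})) at_top"
  proof (rule decreasing_tendsto)
    show "\<forall>\<^sub>F t in at_top. Inf (g ` {0..}) \<le> g t"
      using eventually_ge_at_top[of 0] by eventually_elim (auto intro!: cINF_lower bdd)
    fix x assume "Inf (g ` {0..}) < x"
    then obtain s where s: "0 \<le> s" "g s < x" using bdd by (auto simp: cINF_less_iff)
    show "\<forall>\<^sub>F t in at_top. g t < x"
      using eventually_ge_at_top[of s] by eventually_elim (use s assms(2) in force)
  qed
qed

context contraction_semigroup_generator
begin

lemma T_zero: "0 \<le> t \<Longrightarrow> T t 0 \<simeq> 0"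
  using T_sc[of t 0 0] by simp

text \<open>The rescaled orbit has derivative zero, uniformly in time by
  \<open>exp_increment\<close>, so \<open>mean_value_bound\<close> applies with \<epsilon> = 0. The
  sign of \<open>Re \<mu>\<close> keeps the scalar factors bounded by one.\<close>

lemma exp_orbit_constant:
  assumes "rder x y" "y \<simeq> sc \<mu> x" "0 \<le> Re \<mu>" "0 \<le> t"
  shows "sc (exp (- \<mu> * of_real t)) (T t x) \<simeq> x"
proof (cases "t = 0")
  case True
  then show ?thesis using T_0[of x] rder_closed(1)[OF assms(1)] by simp
next
  case False
  note cl = rder_closed[OF assms(1)]
  have r: "rder x (sc \<mu> x)" using rder_eqv[OF assms(1) _ eqv_sym[OF assms(2)]] cl by simp
  define \<phi> where "\<phi> = (\<lambda>t. sc (exp (- \<mu> * of_real t)) (T t x))"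
  have "nrm (\<phi> t - \<phi> 0) \<le> 0 * t"
  proof (rule mean_value_bound)
    show "\<phi> s \<in> X" if "0 \<le> s" for s using that cl by (simp add: \<phi>_def)
    show "0 < t" using False assms by simp
    fix e :: real assume "0 < e"
    define e' where "e' = e / (1 + nrm x)"
    have n1: "0 < 1 + nrm x" using nrm_ge_0[of x] cl by linarith
    have "0 < e'" using \<open>0 < e\<close> n1 by (simp add: e'_def)
    obtain d1 where d1: "d1 > 0"
      "\<And>h. 0 < h \<Longrightarrow> h \<le> d1 \<Longrightarrow> nrm (T h x - x - sc (complex_of_real h) (sc \<mu> x)) \<le> e' * h"
      using rderD[OF r \<open>0 < e'\<close>] by blast
    obtain d2 where d2: "d2 > 0"
      "\<And>h. 0 < h \<Longrightarrow> h \<le> d2 \<Longrightarrow> cmod (exp (\<mu> * of_real h) - 1 - \<mu> * of_real h) \<le> e' * h"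
      using exp_remainder_bound[OF \<open>0 < e'\<close>] by blast
    have "nrm (\<phi> (s + h) - \<phi> s) \<le> e * h" if s: "0 \<le> s" "0 < h" "h \<le> min d1 d2" for s h
    proof -
      \<comment> \<open>\<open>exp_increment\<close> is applied with its \<open>y\<close> equal to
        0, because the derivative of \<open>x\<close> is \<open>0 + \<mu> x\<close>; the vector
        \<open>T s 0\<close> is only known to be null.\<close>
      have "sc (exp (- \<mu> * of_real s) * of_real h) (T s 0) \<simeq> 0"
        using eqv_sc[OF T_zero[OF s(1)]] by simp
      then have "\<phi> (s + h) - \<phi> s - sc (exp (- \<mu> * of_real s) * of_real h) (T s 0)
          \<simeq> \<phi> (s + h) - \<phi> s - 0"
        using s cl by (intro eqv_diff) (auto simp: \<phi>_def)
      then have "nrm (\<phi> (s + h) - \<phi> s)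
          = nrm (\<phi> (s + h) - \<phi> s - sc (exp (- \<mu> * of_real s) * of_real h) (T s 0))"
        using eqv_nrm by fastforce
      also have "\<dots> \<le> nrm (T h x - x - sc (of_real h) (0 + sc \<mu> x))
          + cmod (exp (\<mu> * of_real h) - 1 - \<mu> * of_real h) * nrm x
          + cmod (exp (\<mu> * of_real h) - 1) * (h * nrm 0)"
        unfolding \<phi>_def using s cl assms by (intro exp_increment) auto
      also have "\<dots> \<le> e' * h + e' * h * nrm x + 0"
        using s cl d1(2)[of h] d2(2)[of h] by (intro add_mono mult_right_mono) auto
      also have "\<dots> = e' * (1 + nrm x) * h" by (simp add: algebra_simps)
      also have "\<dots> = e * h" using n1 by (simp add: e'_def)
      finally show ?thesis .
    qed
    then show "\<exists>d>0. \<forall>s h. 0 \<le> s \<and> 0 < h \<and> h \<le> d \<and> s + h \<le> t \<longrightarrow> nrm (\<phi> (s + h) - \<phi> s) \<le> e * h"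
      using d1(1) d2(1) by (intro exI[of _ "min d1 d2"]) auto
  qed
  then have "\<phi> t \<simeq> \<phi> 0" using cl assms by (intro eqvI) (auto simp: \<phi>_def)
  also have "\<phi> 0 \<simeq> x" using T_0[of x] cl by (simp add: \<phi>_def)
  finally show ?thesis by (simp add: \<phi>_def)
qed

text \<open>Constancy of the rescaled orbit forces the orbit itself to grow like
  \<open>exp (Re \<mu> t)\<close>; time 1 already contradicts contractivity. This will make the
  boundary matrix invertible at positive reals.\<close>

lemma no_positive_eigenvalue:
  assumes "rder x y" "y \<simeq> sc \<mu> x" "0 < Re \<mu>"
  shows "nrm x = 0"
proof -
  note cl = rder_closed[OF assms(1)]
  have "nrm x = nrm (sc (exp (- \<mu> * of_real 1)) (T 1 x))"
    using eqv_nrm[OF exp_orbit_constant[OF assms(1,2), of 1]] assms(3) by simp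
  also have "\<dots> \<le> exp (- Re \<mu>) * nrm x"
    using cl T_contraction[of 1 x] by (simp add: nrm_sc)
  finally have "(1 - exp (- Re \<mu>)) * nrm x \<le> 0" by (simp add: algebra_simps)
  moreover have "0 < 1 - exp (- Re \<mu>)" using assms(3) by simp
  ultimately have "nrm x \<le> 0" by (meson mult_le_0_iff not_le)
  then show ?thesis using cl by (simp add: nrm_zero_iff_le)
qed

lemma imaginary_eigenvector_nrm:
  assumes "x \<in> D" "A x \<simeq> sc \<mu> x" "Re \<mu> = 0" "0 \<le> t"
  shows "nrm (T t x) = nrm x"
proof -
  have "nrm x = nrm (sc (exp (- \<mu> * of_real t)) (T t x))"
    using eqv_nrm[OF exp_orbit_constant[OF rder_A[OF assms(1)] assms(2)]] assms by simp
  then show ?thesis using assms D_subset[OF assms(1)] by (simp add: nrm_sc)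
qed

text \<open>The path \<open>t \<mapsto> e\<^sup>-\<^sup>\<lambda>\<^sup>t T(t)y + (1 - e\<^sup>-\<^sup>\<lambda>\<^sup>t) x / \<lambda>\<close> leads from \<open>y\<close> to nearly \<open>x / \<lambda>\<close>, and its
  derivative is \<open>- e\<^sup>-\<^sup>\<lambda>\<^sup>t (T(t)x - x)\<close>.\<close>

lemma resolvent_approximation:
  assumes r: "rder y z" and "x \<in> X" and z: "sc (complex_of_real l) y - z \<simeq> x" and "0 < l" "0 < L"
    and small: "\<And>s. 0 \<le> s \<Longrightarrow> s \<le> L / l \<Longrightarrow> nrm (T s x - x) \<le> \<epsilon>"
  shows "nrm (sc (complex_of_real l) y - x)
    \<le> L * \<epsilon> + exp (- L) * (nrm (sc (complex_of_real l) y) + nrm x)"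
proof -
  note cl = rder_closed[OF assms(1)] \<open>x \<in> X\<close>
  define \<mu> where "\<mu> = complex_of_real l"
  define E where "E = (\<lambda>t. exp (- \<mu> * of_real t))"
  define \<phi> where "\<phi> = (\<lambda>t. sc (E t) (T t y) + sc ((1 - E t) / \<mu>) x)"
  \<comment> \<open>Large \<open>l\<close> makes the time \<open>L / l\<close> short, while the
    weight \<open>exp (- l \<delta>) = exp (- L)\<close> left at the end is governed by
    \<open>L\<close> alone.\<close>
  define \<delta> where "\<delta> = L / l"
  have \<mu>0: "\<mu> \<noteq> 0" using \<open>0 < l\<close> by (simp add: \<mu>_def)
  have E_le: "cmod (E t) \<le> 1" if "0 \<le> t" for t using that \<open>0 < l\<close> by (simp add: E_def \<mu>_def)
  \<comment> \<open>The resolvent equation solved for the derivative of \<open>y\<close>, in the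
    shape that \<open>exp_increment\<close> expects with \<open>- x\<close> in place of its
    \<open>y\<close>.\<close>
  have r': "rder y (- x + sc \<mu> y)"
  proof (rule rder_eqv[OF r])
    show "y \<simeq> y" using cl by simp
    have "sc \<mu> y - x \<simeq> sc \<mu> y - (sc \<mu> y - z)"
      using z cl by (intro eqv_diff eqv_sym[OF z[folded \<mu>_def]]) auto
    then show "- x + sc \<mu> y \<simeq> z" by simp
  qed
  have "nrm (\<phi> \<delta> - \<phi> 0) \<le> \<epsilon> * \<delta>"
  proof (rule mean_value_bound)
    show "\<phi> s \<in> X" if "0 \<le> s" for s using that cl by (simp add: \<phi>_def)
    show "0 < \<delta>" using \<open>0 < l\<close> \<open>0 < L\<close> by (simp add: \<delta>_def)
    fix e :: real assume "\<epsilon> < e"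
    \<comment> \<open>Sum of the coefficients of all error terms of order \<open>e' * h\<close>
      below, so that \<open>e' * M\<close> is exactly the slack
      \<open>e - \<epsilon>\<close>.\<close>
    define M where "M = 1 + nrm y + nrm x + nrm x / l"
    define e' where "e' = (e - \<epsilon>) / M"
    have M: "0 < M" unfolding M_def using cl \<open>0 < l\<close>
      by (intro add_pos_nonneg divide_nonneg_pos) auto
    have "0 < e'" using \<open>\<epsilon> < e\<close> M by (simp add: e'_def)
    obtain d1 where d1: "d1 > 0"
      "\<And>h. 0 < h \<Longrightarrow> h \<le> d1 \<Longrightarrow> nrm (T h y - y - sc (complex_of_real h) (- x + sc \<mu> y)) \<le> e' * h"
      using rderD[OF r' \<open>0 < e'\<close>] by blast
    obtain d2 where d2: "d2 > 0"
      "\<And>h. 0 < h \<Longrightarrow> h \<le> d2 \<Longrightarrow> cmod (exp (\<mu> * of_real h) - 1 - \<mu> * of_real h) \<le> e' * h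
        \<and> cmod (exp (\<mu> * of_real h) - 1) \<le> e'"
      using exp_remainder_bound[OF \<open>0 < e'\<close>] by blast
    obtain d3 where d3: "d3 > 0"
      "\<And>h. 0 < h \<Longrightarrow> h \<le> d3 \<Longrightarrow> cmod (exp ((- \<mu>) * of_real h) - 1 - (- \<mu>) * of_real h) \<le> e' * h"
      using exp_remainder_bound[OF \<open>0 < e'\<close>, of "- \<mu>"] by blast
    have "nrm (\<phi> (t + h) - \<phi> t) \<le> e * h"
      if t: "0 \<le> t" "0 < h" "h \<le> min d1 (min d2 d3)" "t + h \<le> \<delta>" for t h
    proof -
      \<comment> \<open>The increment splits into the remainder \<open>u\<close> of the rescaled
        orbit, the part \<open>w\<close> measured by \<open>T t x - x\<close>, which is controlled
        by \<open>\<epsilon>\<close>, and the scalar error \<open>c\<close> of linearising the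
        exponential in the coefficient of \<open>x\<close>.\<close>
      define u where "u = sc (E (t + h)) (T (t + h) y) - sc (E t) (T t y)
        - sc (E t * of_real h) (T t (- x))"
      define w where "w = sc (E t * of_real h) (T t (- x) + x)"
      define c where "c = (E t - E (t + h)) / \<mu> - E t * of_real h"
      have cl': "u \<in> X" "w \<in> X" "sc c x \<in> X" using cl t by (auto simp: u_def w_def)
      have "\<phi> (t + h) - \<phi> t = u + w + sc c x"
        by (simp add: \<phi>_def u_def w_def c_def diff_divide_distrib scale_left_diff_distrib
            scale_right_distrib)
      then have "nrm (\<phi> (t + h) - \<phi> t) \<le> nrm u + nrm w + nrm (sc c x)"
        using nrm_triangle[of "u + w" "sc c x"] nrm_triangle[of u w] cl' by simp
      also have "nrm u \<le> nrm (T h y - y - sc (of_real h) (- x + sc \<mu> y))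
          + cmod (exp (\<mu> * of_real h) - 1 - \<mu> * of_real h) * nrm y
          + cmod (exp (\<mu> * of_real h) - 1) * (h * nrm (- x))"
        unfolding u_def E_def using t cl \<open>0 < l\<close> by (intro exp_increment) (auto simp: \<mu>_def)
      also have "\<dots> \<le> e' * h + e' * h * nrm y + e' * (h * nrm x)"
        using t cl d1(2)[of h] d2(2)[of h] unfolding nrm_uminus[OF \<open>x \<in> X\<close>]
        by (intro add_mono mult_right_mono) auto
      also have "nrm w \<le> h * \<epsilon>"
      proof -
        have "T t (- x) + x \<simeq> - T t x + x"
          using t cl by (intro eqv_add T_uminus) auto
        also have "- T t x + x = - (T t x - x)" by simp
        finally have "nrm (T t (- x) + x) = nrm (T t x - x)"
          using t cl by (metis eqv_nrm nrm_uminus diff_closed T_closed)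
        moreover have "nrm (T t x - x) \<le> \<epsilon>" using t by (intro small) (auto simp: \<delta>_def)
        moreover have "cmod (E t * of_real h) \<le> h"
          using E_le[of t] t by (simp add: norm_mult mult_left_le_one_le)
        ultimately show ?thesis
          using t cl by (simp add: w_def nrm_sc mult_mono del: norm_mult)
      qed
      also have "nrm (sc c x) \<le> e' * h / l * nrm x"
      proof -
        have "c = - E t * (exp ((- \<mu>) * of_real h) - 1 - (- \<mu>) * of_real h) / \<mu>"
          using \<mu>0 by (simp add: c_def E_def ring_distribs exp_add diff_divide_distrib add_divide_distrib
              flip: exp_add)
        then have "cmod c = cmod (E t) * cmod (exp ((- \<mu>) * of_real h) - 1 - (- \<mu>) * of_real h) / l"
          using \<open>0 < l\<close> by (simp add: norm_mult norm_divide \<mu>_def)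
        also have "\<dots> \<le> 1 * (e' * h) / l"
          using d3(2)[of h] t E_le[of t] \<open>0 < l\<close> by (intro divide_right_mono mult_mono) auto
        finally have "cmod c * nrm x \<le> (1 * (e' * h) / l) * nrm x"
          using cl by (intro mult_right_mono) auto
        then show ?thesis using cl by (simp add: nrm_sc)
      qed
      finally have "nrm (\<phi> (t + h) - \<phi> t) \<le> e' * M * h + h * \<epsilon>"
        by (simp add: M_def algebra_simps)
      also have "e' * M = e - \<epsilon>" using M by (simp add: e'_def)
      finally show ?thesis by (simp add: algebra_simps)
    qed
    then show "\<exists>d>0. \<forall>t h. 0 \<le> t \<and> 0 < h \<and> h \<le> d \<and> t + h \<le> \<delta> \<longrightarrow> nrm (\<phi> (t + h) - \<phi> t) \<le> e * h"
      using d1(1) d2(1) d3(1) by (intro exI[of _ "min d1 (min d2 d3)"]) auto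
  qed
  moreover have "\<phi> 0 \<simeq> y" using T_0[of y] cl by (simp add: \<phi>_def E_def)
  ultimately have *: "nrm (\<phi> \<delta> - y) \<le> \<epsilon> * \<delta>"
    using cl \<open>0 < l\<close> \<open>0 < L\<close> eqv_nrm[OF eqv_diff[of "\<phi> \<delta>" "\<phi> \<delta>" "\<phi> 0" y]]
    by (simp add: \<phi>_def \<delta>_def)
  have \<delta>0: "0 \<le> \<delta>" using \<open>0 < l\<close> \<open>0 < L\<close> by (simp add: \<delta>_def)
  have E\<delta>: "E \<delta> = of_real (exp (- L))" using \<open>0 < l\<close> by (simp add: E_def \<delta>_def \<mu>_def exp_of_real[symmetric])
  have cl2: "\<phi> \<delta> \<in> X" "T \<delta> y \<in> X" using cl \<delta>0 by (auto simp: \<phi>_def)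
  \<comment> \<open>The end of the path misses \<open>x / \<mu>\<close> by \<open>E \<delta>\<close>
    times \<open>T \<delta> y - x / \<mu>\<close>; the second summand is this defect multiplied by
    \<open>\<mu>\<close>.\<close>
  have "sc \<mu> y - x = sc \<mu> (y - \<phi> \<delta>) + sc (E \<delta>) (sc \<mu> (T \<delta> y) - x)"
    using \<mu>0 by (simp add: \<phi>_def scale_right_distrib scale_right_diff_distrib scale_left_diff_distrib
        mult.commute)
  then have "nrm (sc \<mu> y - x) \<le> nrm (sc \<mu> (y - \<phi> \<delta>)) + nrm (sc (E \<delta>) (sc \<mu> (T \<delta> y) - x))"
    using nrm_triangle[of "sc \<mu> (y - \<phi> \<delta>)" "sc (E \<delta>) (sc \<mu> (T \<delta> y) - x)"] cl cl2 by simp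
  also have "nrm (sc \<mu> (y - \<phi> \<delta>)) \<le> L * \<epsilon>"
  proof -
    have "nrm (sc \<mu> (y - \<phi> \<delta>)) = l * nrm (\<phi> \<delta> - y)"
      using \<open>0 < l\<close> cl cl2 nrm_minus_commute[of y "\<phi> \<delta>"] nrm_sc[of "y - \<phi> \<delta>" \<mu>] by (simp add: \<mu>_def)
    also have "\<dots> \<le> l * (\<epsilon> * \<delta>)" using * \<open>0 < l\<close> by (intro mult_left_mono) auto
    also have "\<dots> = L * \<epsilon>" using \<open>0 < l\<close> by (simp add: \<delta>_def)
    finally show ?thesis .
  qed
  also have "nrm (sc (E \<delta>) (sc \<mu> (T \<delta> y) - x)) = exp (- L) * nrm (sc \<mu> (T \<delta> y) - x)"
    using cl cl2 by (simp add: nrm_sc E\<delta>)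
  also have "nrm (sc \<mu> (T \<delta> y) - x) \<le> nrm (sc \<mu> (T \<delta> y)) + nrm x"
    using cl cl2 by (intro nrm_triangle_diff) auto
  also have "nrm (sc \<mu> (T \<delta> y)) \<le> nrm (sc \<mu> y)"
    using cl cl2 \<delta>0 T_contraction[of \<delta> y] by (simp add: nrm_sc mult_left_mono)
  finally show ?thesis by (simp add: \<mu>_def mult_left_mono)
qed

text \<open>Yosida approximation: if \<open>l y - A y = x\<close>, then \<open>l y\<close> is close
  to \<open>x\<close> for large \<open>l\<close>. It replaces the usual averages of orbits, which
  would be vector-valued integrals.\<close>

lemma dense_domain:
  assumes res: "\<And>l f. 0 < l \<Longrightarrow> f \<in> X \<Longrightarrow> \<exists>y\<in>D. sc (complex_of_real l) y - A y \<simeq> f"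
    and x: "x \<in> X" and e: "0 < e"
  shows "\<exists>y\<in>D. nrm (x - y) \<le> e"
proof -
  \<comment> \<open>With \<open>z\<close> the distance from \<open>l y\<close> to \<open>x\<close>,
    the weight \<open>exp (- L)\<close> multiplies at most \<open>z + 2 * nrm x\<close>. Here
    \<open>L \<ge> 1\<close> lets half of \<open>z\<close> be absorbed, the summand
    \<open>8 * nrm x / e\<close> makes the rest at most \<open>e / 4\<close>, and
    \<open>\<epsilon>\<close> is chosen so that \<open>L * \<epsilon> = e / 4\<close>.\<close>
  define L where "L = 1 + 8 * nrm x / e"
  have L: "1 \<le> L" using x e by (simp add: L_def)
  define \<epsilon> where "\<epsilon> = e / (4 * L)"
  have \<epsilon>: "0 < \<epsilon>" using e L by (simp add: \<epsilon>_def)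
  have "\<forall>\<^sub>F h in at_right 0. dist (nrm (T h x - x)) 0 < \<epsilon>"
    using T_continuous[OF x] \<epsilon> by (rule tendstoD)
  then obtain d where d: "d > 0" and d': "\<forall>h>0. h < d \<longrightarrow> \<bar>nrm (T h x - x)\<bar> < \<epsilon>"
    unfolding eventually_at_right_field by (auto simp: dist_real_def)
  have small: "nrm (T s x - x) \<le> \<epsilon>" if "0 \<le> s" "s \<le> L / (2 * L / d)" for s
  proof (cases "s = 0")
    case True
    then show ?thesis using T_0[OF x] \<epsilon> by (simp add: eqv_def)
  next
    case False
    have "L / (2 * L / d) = d / 2" using L d by (simp add: field_simps)
    with False that d show ?thesis using d'[rule_format, of s] by simp
  qed
  \<comment> \<open>Puts the final time \<open>L / l\<close> at \<open>d / 2\<close>, where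
    \<open>T s x\<close> is still within \<open>\<epsilon>\<close> of \<open>x\<close>.\<close>
  define l where "l = 2 * L / d"
  have l: "0 < l" using L d by (simp add: l_def)
  obtain y where y: "y \<in> D" "sc (complex_of_real l) y - A y \<simeq> x" using res[OF l x] by blast
  define z where "z = nrm (sc (complex_of_real l) y - x)"
  have yX: "y \<in> X" using y D_subset by blast
  have z0: "0 \<le> z" using x yX by (simp add: z_def)
  have exp_le: "exp (- L) \<le> 1 / (1 + L)"
    using exp_ge_add_one_self[of L] L by (simp add: exp_minus field_simps)
  have "z \<le> L * \<epsilon> + exp (- L) * (nrm (sc (complex_of_real l) y) + nrm x)"
    unfolding z_def using L small l
    by (intro resolvent_approximation[OF rder_A[OF y(1)] x y(2)]) (auto simp: l_def)
  also have "\<dots> \<le> L * \<epsilon> + exp (- L) * (z + 2 * nrm x)"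
    using nrm_le_diff[of "sc (complex_of_real l) y" x] x yX by (simp add: z_def)
  also have "\<dots> \<le> e / 4 + 1 / (1 + L) * (z + 2 * nrm x)"
  proof -
    have "L * \<epsilon> = e / 4" using L by (simp add: \<epsilon>_def)
    moreover have "exp (- L) * (z + 2 * nrm x) \<le> 1 / (1 + L) * (z + 2 * nrm x)"
      using exp_le z0 x by (intro mult_right_mono) auto
    ultimately show ?thesis by simp
  qed
  also have "\<dots> \<le> e / 4 + (z / 2 + e / 4)"
  proof -
    have "1 / (1 + L) * z \<le> 1 / 2 * z" using L z0 by (intro mult_right_mono) (auto simp: field_simps)
    moreover have "2 * nrm x \<le> e / 4 * (1 + L)"
      using e by (simp add: L_def field_simps)
    then have "1 / (1 + L) * (2 * nrm x) \<le> e / 4" using L by (simp add: field_simps)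
    ultimately show ?thesis by (simp add: distrib_left)
  qed
  finally have "z \<le> e" by simp
  moreover have "sc (complex_of_real l) y \<in> D"
    using rder_in_D rder_sc rder_A y(1) by blast
  ultimately show ?thesis
    using nrm_minus_commute[of "sc (complex_of_real l) y" x] x yX unfolding z_def
    by (intro bexI[of _ "sc (complex_of_real l) y"]) auto
qed


text \<open>Sequential compactness of the inverse, phrased without an inverse operator. Only the
  images \<open>A (xs n)\<close> are bounded, not the \<open>xs n\<close> themselves.\<close>

definition compact_inverse :: bool where
  "compact_inverse \<longleftrightarrow> (\<forall>xs C. (\<forall>n. xs n \<in> D \<and> nrm (A (xs n)) \<le> C) \<longrightarrow>
     (\<exists>(r :: nat \<Rightarrow> nat) y. strict_mono r \<and> y \<in> X \<and> (\<lambda>n. nrm (xs (r n) - y)) \<longlonglongrightarrow> 0))"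

lemma compact_inverseE:
  assumes "compact_inverse" "\<And>n. xs n \<in> D" "\<And>n. nrm (A (xs n)) \<le> C"
  obtains r :: "nat \<Rightarrow> nat" and y where "strict_mono r" "y \<in> X" "(\<lambda>n. nrm (xs (r n) - y)) \<longlonglongrightarrow> 0"
  using assms unfolding compact_inverse_def by meson

lemma nrm_tendsto:
  assumes "(\<lambda>n. nrm (xs n - y)) \<longlonglongrightarrow> 0" "\<And>n. xs n \<in> X" "y \<in> X"
  shows "(\<lambda>n. nrm (xs n)) \<longlonglongrightarrow> nrm y"
proof -
  have "(\<lambda>n. nrm (xs n) - nrm y) \<longlonglongrightarrow> 0"
    by (rule Lim_null_comparison[OF _ assms(1)])
      (use assms nrm_abs_diff in \<open>auto intro!: always_eventually\<close>)
  then show ?thesis using LIM_zero_iff by blast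
qed

lemma nrm_T_antimono:
  assumes "x \<in> X" "0 \<le> s" "s \<le> t" shows "nrm (T t x) \<le> nrm (T s x)"
proof -
  have "nrm (T t x) = nrm (T (t - s) (T s x))"
    using eqv_nrm[OF T_plus[of "t - s" s x]] assms by simp
  also have "\<dots> \<le> nrm (T s x)" using assms by (intro T_contraction) auto
  finally show ?thesis .
qed

text \<open>Otherwise vectors scaled to image norm one would have norms growing beyond every bound,
  although a subsequence converges. The kernel condition allows the scaling.\<close>

lemma compact_inverse_bounded:
  assumes comp: "compact_inverse"
    and no_ev: "\<And>x. x \<in> D \<Longrightarrow> A x \<simeq> sc 0 x \<Longrightarrow> nrm x = 0"
  obtains C where "0 < C" "\<And>x y. rder x y \<Longrightarrow> nrm x \<le> C * nrm y"
proof -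
  have "\<exists>C>0. \<forall>x\<in>D. nrm x \<le> C * nrm (A x)"
  proof (rule ccontr)
    assume "\<not> (\<exists>C>0. \<forall>x\<in>D. nrm x \<le> C * nrm (A x))"
    then have "\<forall>n. \<exists>x\<in>D. real (Suc n) * nrm (A x) < nrm x"
      by (meson not_le of_nat_0_less_iff zero_less_Suc)
    then obtain xs where xs: "\<And>n. xs n \<in> D" "\<And>n. real (Suc n) * nrm (A (xs n)) < nrm (xs n)"
      by metis
    have pos: "0 < nrm (A (xs n))" for n
    proof (rule ccontr)
      assume "\<not> 0 < nrm (A (xs n))"
      then have "A (xs n) \<simeq> sc 0 (xs n)" using xs(1) D_subset by (intro eqvI) auto
      then have "nrm (xs n) = 0" using no_ev xs(1) by blast
      with xs(2)[of n] have "real (Suc n) * nrm (A (xs n)) < 0" by simp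
      moreover have "0 \<le> real (Suc n) * nrm (A (xs n))" using xs(1) by simp
      ultimately show False by linarith
    qed
    define ws where "ws n = sc (of_real (1 / nrm (A (xs n)))) (xs n)" for n
    have r: "rder (ws n) (sc (of_real (1 / nrm (A (xs n)))) (A (xs n)))" for n
      unfolding ws_def by (intro rder_sc rder_A xs)
    have D: "ws n \<in> D" for n using r rder_in_D by blast
    have A1: "nrm (A (ws n)) \<le> 1" for n
      using eqv_nrm[OF A_eqv[OF r]] xs(1) pos[of n] by (simp add: nrm_sc norm_divide)
    obtain r y where ry: "strict_mono r" "y \<in> X" "(\<lambda>n. nrm (ws (r n) - y)) \<longlonglongrightarrow> 0"
      by (rule compact_inverseE[OF comp D A1])
    have lim: "(\<lambda>n. nrm (ws (r n))) \<longlonglongrightarrow> nrm y"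
      using ry D D_subset by (intro nrm_tendsto) auto
    have big: "real n \<le> nrm (ws n)" for n
    proof -
      have "nrm (ws n) = nrm (xs n) / nrm (A (xs n))"
        using xs(1) pos[of n] D_subset by (simp add: ws_def nrm_sc norm_divide)
      moreover have "real (Suc n) * nrm (A (xs n)) \<le> nrm (xs n)" using xs(2)[of n] by simp
      ultimately have "real (Suc n) \<le> nrm (ws n)" using pos[of n] by (simp add: pos_le_divide_eq)
      then show ?thesis by simp
    qed
    have "filterlim (\<lambda>n. nrm (ws (r n))) at_top sequentially"
    proof (rule filterlim_at_top_mono[OF filterlim_real_sequentially], rule always_eventually, rule allI)
      fix n
      have "real n \<le> real (r n)" using ry(1) by (simp add: seq_suble)
      then show "real n \<le> nrm (ws (r n))" using big[of "r n"] by linarith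
    qed
    with lim show False
      using not_tendsto_and_filterlim_at_infinity[of sequentially] filterlim_at_top_imp_at_infinity
        sequentially_bot by blast
  qed
  then obtain C where C: "C > 0" "\<And>x. x \<in> D \<Longrightarrow> nrm x \<le> C * nrm (A x)" by blast
  show thesis
  proof
    show "0 < C" by fact
    show "nrm x \<le> C * nrm y" if "rder x y" for x y
      using C(2)[OF rder_in_D[OF that]] eqv_nrm[OF A_eqv[OF that]] by simp
  qed
qed

text \<open>The conservation of \<open>nrm (T t p)\<^sup>2\<close> along the orbit, differentiated at \<open>t = 0\<close>.\<close>

lemma isometric_orbit_skew:
  assumes r: "rder p q" and iso: "\<And>s. 0 \<le> s \<Longrightarrow> nrm (T s p) = nrm p"
  shows "ip p q = 0"
proof -
  note cl = rder_closed[OF r]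
  have "\<bar>ip p q\<bar> \<le> e" if "0 < e" for e
  proof -
    define e' where "e' = e / (nrm p + 1)"
    have n1: "0 < nrm p + 1" using nrm_ge_0[OF cl(1)] by linarith
    have e': "0 < e'" using that n1 by (simp add: e'_def)
    obtain d where d: "d > 0"
      "\<And>h. 0 < h \<Longrightarrow> h \<le> d \<Longrightarrow> nrm (T h p - p - sc (complex_of_real h) q) \<le> e' * h"
      using rderD[OF r e'] by blast
    define M where "M = (nrm q + e')\<^sup>2"
    have M: "0 < M" using add_nonneg_pos[OF nrm_ge_0[OF cl(2)] e'] by (simp add: M_def)
    \<comment> \<open>\<open>M\<close> bounds the square of \<open>nrm v / h\<close>. The second
      entry keeps \<open>h * M\<close> below \<open>2 * e'\<close>, so division by
      \<open>2 * h\<close> leaves \<open>e' * (nrm p + 1) = e\<close>.\<close>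
    define h where "h = min d (2 * e' / M)"
    have h: "0 < h" "h \<le> d" "h * M \<le> 2 * e'"
      using d e' M by (auto simp: h_def min_def field_simps)
    define w where "w = T h p - p - sc (complex_of_real h) q"
    define v where "v = sc (complex_of_real h) q + w"
    have w: "w \<in> X" "nrm w \<le> e' * h" using cl h d(2)[of h] by (auto simp: w_def)
    have v: "v \<in> X" using cl w by (simp add: v_def)
    have Tp: "T h p = p + v" by (simp add: v_def w_def)
    have nv: "nrm v \<le> h * (nrm q + e')"
      using nrm_triangle[of "sc (complex_of_real h) q" w] cl w h
      by (simp add: v_def nrm_sc algebra_simps)
    have "(nrm p)\<^sup>2 = (nrm (p + v))\<^sup>2" using iso[of h] h Tp by simp
    also have "\<dots> = (nrm p)\<^sup>2 + 2 * ip p v + (nrm v)\<^sup>2"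
      using cl v ip_commute[of p v] by (simp add: nrm_sq ip_simps)
    also have "ip p v = h * ip p q + ip p w"
      using cl w by (simp add: v_def ip_simps)
    finally have "2 * h * ip p q = - 2 * ip p w - (nrm v)\<^sup>2" by (simp add: algebra_simps)
    then have "2 * h * \<bar>ip p q\<bar> \<le> 2 * \<bar>ip p w\<bar> + (nrm v)\<^sup>2"
    proof -
      have "\<bar>2 * h * ip p q\<bar> = 2 * h * \<bar>ip p q\<bar>" using h by (simp add: abs_mult)
      moreover have "0 \<le> (nrm v)\<^sup>2" by simp
      moreover have "- \<bar>ip p w\<bar> \<le> ip p w" "ip p w \<le> \<bar>ip p w\<bar>" by auto
      ultimately show ?thesis using \<open>2 * h * ip p q = - 2 * ip p w - (nrm v)\<^sup>2\<close> by linarith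
    qed
    also have "\<dots> \<le> 2 * (nrm p * (e' * h)) + (h * (nrm q + e'))\<^sup>2"
    proof -
      have "\<bar>ip p w\<bar> \<le> nrm p * (e' * h)"
        using Cauchy_Schwarz[OF cl(1) w(1)] mult_left_mono[OF w(2) nrm_ge_0[OF cl(1)]] by linarith
      then show ?thesis using power_mono[OF nv nrm_ge_0[OF v], of 2] by linarith
    qed
    also have "\<dots> = h * (2 * nrm p * e' + h * M)" by (simp add: M_def power2_eq_square algebra_simps)
    also have "\<dots> \<le> h * (2 * nrm p * e' + 2 * e')" using h by (intro mult_left_mono) auto
    also have "\<dots> = 2 * h * (e' * (nrm p + 1))" by (simp add: algebra_simps)
    also have "\<dots> = 2 * h * e" using n1 by (simp add: e'_def)
    finally show ?thesis using h by simp
  qed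
  then have "\<bar>ip p q\<bar> \<le> 0" by (rule dense_ge)
  then show ?thesis by simp
qed

text \<open>By the parallelogram law the squared norms of sum and difference have the same total
  before and after \<open>T s\<close>. Neither can increase, hence neither decreases.\<close>

lemma isometric_orbit_add:
  assumes "p \<in> X" "q \<in> X" "0 \<le> s" "nrm (T s p) = nrm p" "nrm (T s q) = nrm q"
  shows "nrm (T s (p + q)) = nrm (p + q)"
proof -
  have "(nrm (T s (p + q)))\<^sup>2 + (nrm (T s (p - q)))\<^sup>2
      = (nrm (T s p + T s q))\<^sup>2 + (nrm (T s p - T s q))\<^sup>2"
    using assms eqv_nrm[OF T_add] eqv_nrm[OF T_diff] by simp
  also have "\<dots> = (nrm (p + q))\<^sup>2 + (nrm (p - q))\<^sup>2"
    using assms by (simp add: parallelogram)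
  finally have *: "(nrm (T s (p + q)))\<^sup>2 + (nrm (T s (p - q)))\<^sup>2 = \<dots>" .
  have "(nrm (T s (p - q)))\<^sup>2 \<le> (nrm (p - q))\<^sup>2"
    using assms by (intro power_mono T_contraction) auto
  with * have "(nrm (p + q))\<^sup>2 \<le> (nrm (T s (p + q)))\<^sup>2" by linarith
  then have "nrm (p + q) \<le> nrm (T s (p + q))" using assms by (auto intro: power2_le_imp_le)
  then show ?thesis using T_contraction[of s "p + q"] assms by simp
qed


text \<open>Strong convergence of contractions is uniform on the relatively compact graph norm unit ball.\<close>

lemma semi_uniform_decay:
  assumes comp: "compact_inverse"
    and stable: "\<And>x. x \<in> X \<Longrightarrow> ((\<lambda>t. nrm (T t x)) \<longlongrightarrow> 0) at_top"
  shows "\<exists>f :: real \<Rightarrow> real. (\<forall>t\<ge>0. 0 \<le> f t) \<and> (f \<longlongrightarrow> 0) at_top \<and>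
    (\<forall>x\<in>D. \<forall>t\<ge>0. nrm (T t x) \<le> f t * sqrt ((nrm x)\<^sup>2 + (nrm (A x))\<^sup>2))"
proof -
  define G where "G x = sqrt ((nrm x)\<^sup>2 + (nrm (A x))\<^sup>2)" for x
  define B where "B = {x \<in> D. G x \<le> 1}"
  define f where "f t = Sup ((\<lambda>x. nrm (T t x)) ` B)" for t
  have BX: "x \<in> X" "nrm x \<le> 1" "nrm (A x) \<le> 1" if "x \<in> B" for x
  proof -
    show x: "x \<in> X" using that D_subset by (auto simp: B_def)
    have "nrm x \<le> G x" unfolding G_def by (rule real_sqrt_sum_squares_ge1)
    then show "nrm x \<le> 1" using that by (simp add: B_def)
    have "nrm (A x) \<le> G x" unfolding G_def by (rule real_sqrt_sum_squares_ge2)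
    then show "nrm (A x) \<le> 1" using that by (simp add: B_def)
  qed
  have r0: "rder 0 0" using T_zero unfolding rder_def eqv_def
    by (auto intro!: exI[of _ 1])
  then have B0: "0 \<in> B" using rder_in_D[OF r0] eqv_nrm[OF A_eqv[OF r0]] by (simp add: B_def G_def)
  have T1: "nrm (T t x) \<le> 1" if "x \<in> B" "0 \<le> t" for x t
    using BX[OF that(1)] T_contraction[OF that(2), of x] by linarith
  have bdd: "bdd_above ((\<lambda>x. nrm (T t x)) ` B)" if "0 \<le> t" for t
    using T1 that by (intro bdd_aboveI[of _ 1]) auto
  have upper: "nrm (T t x) \<le> f t" if "x \<in> B" "0 \<le> t" for x t
    unfolding f_def using that bdd by (intro cSUP_upper) auto
  have f0: "0 \<le> f t" if "0 \<le> t" for t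
    using upper[OF B0 that] that nrm_ge_0[of "T t 0"] by (simp del: nrm_ge_0)
  \<comment> \<open>If this fails, some vector of \<open>B\<close> has norm above \<open>e\<close>
    at a time at least \<open>n\<close>, hence also at time \<open>n\<close>, since orbit norms
    decrease. Contractions keep these orbits close to that of a limit point \<open>y\<close>, whose
    norm would then stay away from 0.\<close>
  have decay: "\<exists>n. \<forall>t\<ge>real n. \<forall>x\<in>B. nrm (T t x) \<le> e" if "0 < e" for e
  proof (rule ccontr)
    assume "\<not> (\<exists>n. \<forall>t\<ge>real n. \<forall>x\<in>B. nrm (T t x) \<le> e)"
    then have "\<forall>n. \<exists>x\<in>B. \<exists>t\<ge>real n. e < nrm (T t x)" by (meson not_le)
    then obtain xs where xs: "\<And>n. xs n \<in> B" "\<And>n. \<exists>t\<ge>real n. e < nrm (T t (xs n))" by metis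
    have big: "e < nrm (T (real n) (xs n))" for n
      using xs(2)[of n] nrm_T_antimono[OF BX(1)[OF xs(1)]] by (meson less_le_trans of_nat_0_le_iff)
    have "xs n \<in> D" for n using xs(1) by (simp add: B_def)
    then obtain r y where ry: "strict_mono r" "y \<in> X" "(\<lambda>n. nrm (xs (r n) - y)) \<longlonglongrightarrow> 0"
      by (rule compact_inverseE[OF comp _ BX(3)[OF xs(1)]])
    have "filterlim (\<lambda>n. real (r n)) at_top sequentially"
      using ry(1) by (intro filterlim_compose[OF filterlim_real_sequentially] filterlim_subseq)
    then have "(\<lambda>n. nrm (T (real (r n)) y)) \<longlonglongrightarrow> 0"
      by (rule filterlim_compose[OF stable[OF ry(2)]])
    then have "(\<lambda>n. nrm (xs (r n) - y) + nrm (T (real (r n)) y)) \<longlonglongrightarrow> 0 + 0"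
      using ry(3) by (intro tendsto_add)
    moreover have "e \<le> nrm (xs (r n) - y) + nrm (T (real (r n)) y)" for n
    proof -
      have X: "xs (r n) \<in> X" using BX(1) xs(1) by blast
      have "e < nrm (T (real (r n)) (xs (r n)))" by (rule big)
      also have "\<dots> \<le> nrm (T (real (r n)) (xs (r n)) - T (real (r n)) y) + nrm (T (real (r n)) y)"
        using X ry(2) by (intro nrm_le_diff) auto
      also have "\<dots> \<le> nrm (xs (r n) - y) + nrm (T (real (r n)) y)"
        using X ry(2) nrm_T_diff by simp
      finally show ?thesis by simp
    qed
    ultimately have "e \<le> 0 + 0" by (intro Lim_bounded2) auto
    with that show False by simp
  qed
  have lim: "(f \<longlongrightarrow> 0) at_top"
  proof (rule tendstoI)
    fix e :: real assume e: "0 < e"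
    then obtain n where n: "\<And>t x. real n \<le> t \<Longrightarrow> x \<in> B \<Longrightarrow> nrm (T t x) \<le> e / 2"
      using decay[of "e / 2"] by auto
    show "\<forall>\<^sub>F t in at_top. dist (f t) 0 < e"
      using eventually_ge_at_top[of "real n"]
    proof eventually_elim
      case (elim t)
      have "f t \<le> e / 2" unfolding f_def using B0 n[OF elim] by (intro cSUP_least) auto
      moreover have "0 \<le> f t" using elim by (intro f0) (meson of_nat_0_le_iff order_trans)
      ultimately show ?case using e by (simp add: dist_real_def)
    qed
  qed
  have "nrm (T t x) \<le> f t * G x" if x: "x \<in> D" and t: "0 \<le> t" for x t
  proof (cases "G x = 0")
    case True
    have "nrm x \<le> G x" unfolding G_def by (rule real_sqrt_sum_squares_ge1)
    then show ?thesis using True T_contraction[OF t D_subset[OF x]] by simp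
  next
    case False
    have G: "0 < G x" using False unfolding G_def by (metis real_sqrt_ge_zero sum_power2_ge_zero order_le_less)
    define c where "c = 1 / G x"
    have c: "0 < c" using G by (simp add: c_def)
    have r: "rder (sc (of_real c) x) (sc (of_real c) (A x))" by (intro rder_sc rder_A x)
    have "G (sc (of_real c) x) = c * G x"
    proof -
      have "(nrm (sc (of_real c) x))\<^sup>2 + (nrm (A (sc (of_real c) x)))\<^sup>2
          = c\<^sup>2 * ((nrm x)\<^sup>2 + (nrm (A x))\<^sup>2)"
        using eqv_nrm[OF A_eqv[OF r]] x D_subset[OF x]
        by (simp add: nrm_sc power_mult_distrib distrib_left)
      then show ?thesis using c by (simp add: G_def real_sqrt_mult)
    qed
    then have "sc (of_real c) x \<in> B" using rder_in_D[OF r] G by (simp add: B_def c_def)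
    then have "nrm (T t (sc (of_real c) x)) \<le> f t" using t by (rule upper)
    moreover have "nrm (T t (sc (of_real c) x)) = c * nrm (T t x)"
      using eqv_nrm[OF T_sc[OF t D_subset[OF x], of "of_real c"]] x t D_subset[OF x] c
      by (simp add: nrm_sc)
    ultimately have "c * nrm (T t x) \<le> f t" by simp
    then show ?thesis using G by (simp add: c_def pos_divide_le_eq)
  qed
  then show ?thesis using f0 lim unfolding G_def by blast
qed

end

section \<open>The bounded inverse on isometric orbits\<close>

locale boundedly_invertible_generator = contraction_semigroup_generator +
  fixes K :: "'a \<Rightarrow> 'a" and C :: real
  assumes rder_K: "f \<in> X \<Longrightarrow> rder (K f) f"
    and C_pos: "0 < C"
    and C_bound: "rder x y \<Longrightarrow> nrm x \<le> C * nrm y"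
begin

lemma K_closed [simp]: "f \<in> X \<Longrightarrow> K f \<in> X"
  using rder_K rder_closed by blast

text \<open>The bound holds for every derivative pair, not just for values of \<open>K\<close>. It
  therefore pins down \<open>K\<close> up to null vectors, and linearity and commutation with
  \<open>T t\<close> follow from the rules for derivatives.\<close>

lemma K_eqv: assumes "rder x y" "y \<simeq> f" shows "K f \<simeq> x"
proof -
  note cl = rder_closed[OF assms(1)] eqv_closed[OF assms(2)]
  have "nrm (K f - x) \<le> C * nrm (f - y)"
    by (intro C_bound rder_diff rder_K cl assms)
  also have "nrm (f - y) = 0" using eqv_sym[OF assms(2)] by (simp add: eqv_def)
  finally show ?thesis using cl by (intro eqvI) auto
qed

lemma eqv_K: "f \<simeq> g \<Longrightarrow> K f \<simeq> K g"
  using K_eqv rder_K eqv_closed eqv_sym by meson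

lemma K_diff: "f \<in> X \<Longrightarrow> g \<in> X \<Longrightarrow> K (f - g) \<simeq> K f - K g"
  by (rule K_eqv[OF rder_diff[OF rder_K rder_K]]) auto

lemma K_sc: "f \<in> X \<Longrightarrow> K (sc c f) \<simeq> sc c (K f)"
  by (rule K_eqv[OF rder_sc[OF rder_K]]) auto

lemma K_T: "f \<in> X \<Longrightarrow> 0 \<le> t \<Longrightarrow> K (T t f) \<simeq> T t (K f)"
  by (rule K_eqv[OF rder_T[OF rder_K]]) auto

lemma nrm_K_le: "f \<in> X \<Longrightarrow> nrm (K f) \<le> C * nrm f"
  using C_bound rder_K by blast

lemma K_funpow_closed [simp]: "f \<in> X \<Longrightarrow> (K ^^ j) f \<in> X"
  by (induction j) auto

lemma K_funpow_diff: assumes "f \<in> X" "g \<in> X" shows "(K ^^ j) (f - g) \<simeq> (K ^^ j) f - (K ^^ j) g"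
proof (induction j)
  case (Suc j)
  have "K ((K ^^ j) (f - g)) \<simeq> K ((K ^^ j) f - (K ^^ j) g)" by (rule eqv_K[OF Suc])
  also have "\<dots> \<simeq> K ((K ^^ j) f) - K ((K ^^ j) g)" using assms by (intro K_diff) auto
  finally show ?case by simp
qed (use assms in auto)

lemma K_funpow_T: assumes "f \<in> X" "0 \<le> t" shows "(K ^^ j) (T t f) \<simeq> T t ((K ^^ j) f)"
proof (induction j)
  case (Suc j)
  have "K ((K ^^ j) (T t f)) \<simeq> K (T t ((K ^^ j) f))" by (rule eqv_K[OF Suc])
  also have "\<dots> \<simeq> T t (K ((K ^^ j) f))" using assms by (intro K_T) auto
  finally show ?case by simp
qed (use assms in auto)

lemma nrm_K_funpow_le: "f \<in> X \<Longrightarrow> nrm ((K ^^ j) f) \<le> C ^ j * nrm f"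
proof (induction j)
  case (Suc j)
  have "nrm (K ((K ^^ j) f)) \<le> C * nrm ((K ^^ j) f)" using Suc.prems by (intro nrm_K_le) auto
  also have "\<dots> \<le> C * (C ^ j * nrm f)" using Suc C_pos by (intro mult_left_mono) auto
  finally show ?case by (simp add: mult.assoc)
qed auto

text \<open>A null \<open>K f\<close> has derivative 0 as well as \<open>f\<close>, and derivatives
  are unique. This keeps the iterates of \<open>K\<close> from vanishing.\<close>

lemma nrm_K_eq_0: assumes "f \<in> X" "nrm (K f) = 0" shows "nrm f = 0"
proof -
  have "rder 0 0" using rder_diff[OF rder_K rder_K, of f f] assms by simp
  moreover have "K f \<simeq> 0" using assms by (simp add: eqv_def)
  ultimately have "f \<simeq> 0" using rder_unique[OF rder_K] assms by blast
  then show ?thesis by (simp add: eqv_def)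
qed

lemma nrm_K_funpow_diff_le:
  assumes "f \<in> X" "g \<in> X" shows "nrm ((K ^^ j) f - (K ^^ j) g) \<le> C ^ j * nrm (f - g)"
  using eqv_nrm[OF K_funpow_diff[OF assms]] nrm_K_funpow_le[of "f - g" j] assms by simp

text \<open>\<open>p + K p\<close> also has an isometric orbit, so polarisation of \<open>isometric_orbit_skew\<close> applies.\<close>

lemma isometric_orbit_K_skew:
  assumes y: "y \<in> X" and iso: "\<And>j s. j \<le> 2 \<Longrightarrow> 0 \<le> s \<Longrightarrow> nrm (T s ((K ^^ j) y)) = nrm ((K ^^ j) y)"
  shows "ip y (K (K y)) = - (nrm (K y))\<^sup>2"
proof -
  define p where "p = K y"
  define q where "q = K p"
  have cl: "p \<in> X" "q \<in> X" using y by (auto simp: p_def q_def)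
  have rp: "rder p y" and rq: "rder q p" using rder_K y cl by (auto simp: p_def q_def)
  have ip: "nrm (T s p) = nrm p" and iq: "nrm (T s q) = nrm q" if "0 \<le> s" for s
    using iso[of 1 s] iso[of 2 s] that by (auto simp: p_def q_def numeral_2_eq_2)
  have "ip p y = 0" using isometric_orbit_skew[OF rp] ip by blast
  moreover have "ip q p = 0" using isometric_orbit_skew[OF rq] iq by blast
  moreover have "ip (p + q) (y + p) = 0"
    using isometric_orbit_skew[OF rder_add[OF rp rq]] isometric_orbit_add[OF cl] ip iq by blast
  ultimately have "ip q y = - ip p p"
    using y cl by (simp add: ip_simps)
  then show ?thesis using y cl ip_commute[of y q] by (simp add: p_def q_def nrm_sq)
qed


text \<open>Along the orbit of \<open>x\<close> every \<open>nrm (T t (K\<^sup>j x))\<close> is decreasing, hence convergent.\<close>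

lemma orbit_limit_isometric:
  assumes x: "x \<in> X" and y: "y \<in> X" and r: "strict_mono (r :: nat \<Rightarrow> nat)"
    and lim: "(\<lambda>n. nrm (T (real (r n)) x - y)) \<longlonglongrightarrow> 0" and s: "0 \<le> s"
  shows "nrm (T s ((K ^^ j) y)) = nrm ((K ^^ j) y)"
proof -
  define w where "w = (K ^^ j) x"
  have w: "w \<in> X" using x by (simp add: w_def)
  obtain L where L: "((\<lambda>t. nrm (T t w)) \<longlongrightarrow> L) at_top"
    using decreasing_nonneg_tendsto[of "\<lambda>t. nrm (T t w)"] nrm_T_antimono[OF w] w by auto
  have r_lim: "filterlim (\<lambda>n. real (r n)) at_top sequentially"
    using r by (intro filterlim_compose[OF filterlim_real_sequentially] filterlim_subseq)
  \<comment> \<open>Up to null vectors \<open>T s ((K ^^ j) y)\<close> is the limit of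
    \<open>w\<close> at the times \<open>s + r n\<close>. A shift of time does not change the limit
    \<open>L\<close>, so the value is the same for every \<open>s\<close>, in particular for
    0.\<close>
  have *: "nrm (T s ((K ^^ j) y)) = L" if s: "0 \<le> s" for s
  proof -
    have "filterlim (\<lambda>n. s + real (r n)) at_top sequentially"
      by (rule filterlim_tendsto_add_at_top[OF tendsto_const r_lim])
    then have "(\<lambda>n. nrm (T (s + real (r n)) w)) \<longlonglongrightarrow> L"
      by (rule filterlim_compose[OF L])
    moreover have "nrm (T (s + real (r n)) w) = nrm (T s (T (real (r n)) w))" for n
      using w s by (intro eqv_nrm T_plus) auto
    ultimately have 1: "(\<lambda>n. nrm (T s (T (real (r n)) w))) \<longlonglongrightarrow> L" by simp
    have le: "nrm (T s (T (real (r n)) w) - T s ((K ^^ j) y)) \<le> C ^ j * nrm (T (real (r n)) x - y)" for n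
    proof -
      have "nrm (T s (T (real (r n)) w) - T s ((K ^^ j) y)) \<le> nrm (T (real (r n)) w - (K ^^ j) y)"
        using w y s by (intro nrm_T_diff) auto
      also have "\<dots> = nrm ((K ^^ j) (T (real (r n)) x) - (K ^^ j) y)"
        unfolding w_def using x y by (intro eqv_nrm eqv_diff eqv_sym[OF K_funpow_T]) auto
      also have "\<dots> \<le> C ^ j * nrm (T (real (r n)) x - y)"
        using x y by (intro nrm_K_funpow_diff_le) auto
      finally show ?thesis .
    qed
    have lim': "(\<lambda>n. C ^ j * nrm (T (real (r n)) x - y)) \<longlonglongrightarrow> C ^ j * 0"
      by (intro tendsto_mult lim tendsto_const)
    have "(\<lambda>n. nrm (T s (T (real (r n)) w) - T s ((K ^^ j) y))) \<longlonglongrightarrow> 0"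
    proof (rule Lim_null_comparison[rotated])
      show "\<forall>\<^sub>F n in sequentially. norm (nrm (T s (T (real (r n)) w) - T s ((K ^^ j) y)))
          \<le> C ^ j * nrm (T (real (r n)) x - y)"
        by (rule always_eventually) (use le w y s in simp)
    qed (use lim' in simp)
    then have "(\<lambda>n. nrm (T s (T (real (r n)) w))) \<longlonglongrightarrow> nrm (T s ((K ^^ j) y))"
      using w y s by (intro nrm_tendsto) auto
    with 1 show ?thesis using LIMSEQ_unique by blast
  qed
  have "nrm ((K ^^ j) y) = nrm (T 0 ((K ^^ j) y))"
    using eqv_nrm[OF T_0] y by simp
  then show ?thesis using * s by simp
qed

text \<open>Power iteration: \<open>K\<close> is skew along the sequence \<open>K\<^sup>j y\<close>, so by Cauchy-Schwarz the growth ratios of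
  \<open>nrm (K\<^sup>j y)\<close> increase, and their convergence makes the normalised iterates approximate
  eigenvectors of \<open>K\<^sup>2\<close>.\<close>

lemma power_iteration:
  assumes comp: "compact_inverse" and y: "y \<in> X" "nrm y \<noteq> 0"
    and iso: "\<And>j s. 0 \<le> s \<Longrightarrow> nrm (T s ((K ^^ j) y)) = nrm ((K ^^ j) y)"
  obtains e l where "e \<in> X" "nrm e = 1" "0 < l" "K (K e) \<simeq> sc (- (complex_of_real l)\<^sup>2) e"
proof -
  define ys where "ys j = (K ^^ j) y" for j
  define n where "n j = nrm (ys j)" for j
  have ysX [simp]: "ys j \<in> X" for j using y by (simp add: ys_def)
  have Kys: "K (ys j) = ys (Suc j)" for j by (simp add: ys_def)
  have n0: "n j \<noteq> 0" for j
  proof (induction j)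
    case 0
    then show ?case using y by (simp add: n_def ys_def)
  next
    case (Suc j)
    then show ?case using nrm_K_eq_0[of "ys j"] by (auto simp: n_def Kys)
  qed
  have n_pos: "0 < n j" for j using n0[of j] nrm_ge_0[of "ys j"] unfolding n_def by (simp del: nrm_ge_0)
  have skew: "ip (ys j) (ys (Suc (Suc j))) = - (n (Suc j))\<^sup>2" for j
  proof -
    have "nrm (T s ((K ^^ i) (ys j))) = nrm ((K ^^ i) (ys j))" if "0 \<le> s" for i s
      using iso[OF that, of "i + j"] by (simp add: ys_def funpow_add)
    then show ?thesis
      using isometric_orbit_K_skew[of "ys j"] by (simp add: Kys n_def)
  qed
  define q where "q j = n (Suc j) / n j" for j
  have q_pos: "0 < q j" for j using n_pos by (simp add: q_def)
  have "q j \<le> q (Suc j)" for j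
  proof -
    have "(n (Suc j))\<^sup>2 \<le> n j * n (Suc (Suc j))"
      using Cauchy_Schwarz[of "ys j" "ys (Suc (Suc j))"] skew[of j] by (simp add: n_def)
    then show ?thesis using n_pos[of j] n_pos[of "Suc j"] by (simp add: q_def field_simps power2_eq_square)
  qed
  then have inc: "incseq q" by (rule incseq_SucI)
  have "q j \<le> C" for j
    using nrm_K_le[of "ys j"] n_pos[of j] by (simp add: q_def n_def Kys pos_divide_le_eq)
  then obtain l where l: "q \<longlonglongrightarrow> l" "\<And>j. q j \<le> l"
    using incseq_convergent[OF inc, of C] by blast
  have l_pos: "0 < l" using l(2)[of 0] q_pos[of 0] by linarith
  define p where "p j = sc (of_real (1 / n j)) (ys j)" for j
  have pX [simp]: "p j \<in> X" for j by (simp add: p_def)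
  have p1: "nrm (p j) = 1" for j using n_pos[of j] by (simp add: p_def nrm_sc norm_divide n_def)
  \<comment> \<open>Indices start at one: these vectors are multiples of values of \<open>K\<close>
    and so lie in \<open>D\<close>, while \<open>p 0\<close> need not. Their images have norm
    \<open>1 / q j\<close>, bounded because \<open>q\<close> increases.\<close>
  have rp: "rder (p (Suc j)) (sc (of_real (1 / n (Suc j))) (ys j))" for j
    unfolding p_def Kys[symmetric] by (intro rder_sc rder_K ysX)
  have "nrm (A (p (Suc j))) = 1 / q j" for j
    using eqv_nrm[OF A_eqv[OF rp[of j]]] n_pos[of j] n_pos[of "Suc j"]
    by (simp add: nrm_sc norm_divide q_def n_def)
  moreover have "1 / q j \<le> 1 / q 0" for j
    using incseqD[OF inc, of 0 j] q_pos by (intro divide_left_mono) auto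
  ultimately have Ap: "nrm (A (p (Suc j))) \<le> 1 / q 0" for j by simp
  have pD: "p (Suc j) \<in> D" for j using rp rder_in_D by blast
  obtain r e where re: "strict_mono r" "e \<in> X" "(\<lambda>m. nrm (p (Suc (r m)) - e)) \<longlonglongrightarrow> 0"
    by (rule compact_inverseE[OF comp, of "\<lambda>j. p (Suc j)", OF pD Ap])
  have "(\<lambda>m. nrm (p (Suc (r m)))) \<longlonglongrightarrow> nrm e" using re by (intro nrm_tendsto) auto
  then have e1: "nrm e = 1" by (simp add: p1 LIMSEQ_const_iff)
  define c where "c = complex_of_real (l\<^sup>2)"
  \<comment> \<open>The residual of \<open>K (K p) = - l\<^sup>2 p\<close>. By skewness its squared
    norm is a polynomial in two consecutive ratios, which vanishes when both equal
    \<open>l\<close>.\<close>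
  define u where "u j = K (K (p j)) + sc c (p j)" for j
  have uX [simp]: "u j \<in> X" for j by (simp add: u_def)
  have p4: "l ^ 4 = l\<^sup>2 * l\<^sup>2" by (simp flip: power_add)
  have u_sq: "(nrm (u j))\<^sup>2 = (q j * q (Suc j))\<^sup>2 - 2 * l\<^sup>2 * (q j)\<^sup>2 + l ^ 4" for j
  proof -
    have "K (K (p j)) \<simeq> K (sc (of_real (1 / n j)) (ys (Suc j)))"
      unfolding p_def Kys[symmetric] by (intro eqv_K K_sc ysX)
    also have "\<dots> \<simeq> sc (of_real (1 / n j)) (ys (Suc (Suc j)))"
      unfolding Kys[symmetric, of "Suc j"] by (intro K_sc ysX)
    finally have "K (K (p j)) \<simeq> sc (of_real (1 / n j)) (ys (Suc (Suc j)))" .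
    then have "u j \<simeq> sc (of_real (1 / n j)) (ys (Suc (Suc j))) + sc c (p j)"
      unfolding u_def by (intro eqv_add) auto
    also have "\<dots> = sc (of_real (1 / n j)) (ys (Suc (Suc j)) + sc c (ys j))"
      by (simp add: p_def scale_right_distrib mult.commute)
    finally have "nrm (u j) = 1 / n j * nrm (ys (Suc (Suc j)) + sc c (ys j))"
      using n_pos[of j] by (simp add: eqv_nrm nrm_sc norm_divide)
    then have "(nrm (u j))\<^sup>2 = (nrm (ys (Suc (Suc j)) + sc c (ys j)))\<^sup>2 / (n j)\<^sup>2"
      by (simp add: power_divide)
    also have "(nrm (ys (Suc (Suc j)) + sc c (ys j)))\<^sup>2
        = (nrm (ys (Suc (Suc j))))\<^sup>2 + 2 * l\<^sup>2 * ip (ys j) (ys (Suc (Suc j))) + l ^ 4 * (nrm (ys j))\<^sup>2"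
      using ip_commute[of "ys j" "ys (Suc (Suc j))"]
      unfolding p4 by (simp add: nrm_sq ip_simps c_def algebra_simps del: of_real_power)
    also have "\<dots> = (n (Suc (Suc j)))\<^sup>2 - 2 * l\<^sup>2 * (n (Suc j))\<^sup>2 + l ^ 4 * (n j)\<^sup>2"
      by (simp add: skew n_def)
    finally show ?thesis using n_pos[of j] n_pos[of "Suc j"]
      by (simp add: q_def field_simps power2_eq_square)
  qed
  have qS: "(\<lambda>j. q (Suc j)) \<longlonglongrightarrow> l" using l(1) by (rule LIMSEQ_Suc)
  have "(\<lambda>j. (q j * q (Suc j))\<^sup>2 - 2 * l\<^sup>2 * (q j)\<^sup>2 + l ^ 4) \<longlonglongrightarrow> (l * l)\<^sup>2 - 2 * l\<^sup>2 * l\<^sup>2 + l ^ 4"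
    by (intro tendsto_intros l(1) qS)
  moreover have "(l * l)\<^sup>2 - 2 * l\<^sup>2 * l\<^sup>2 + l ^ 4 = 0"
    by (simp add: power2_eq_square power4_eq_xxxx)
  ultimately have "(\<lambda>j. (nrm (u j))\<^sup>2) \<longlonglongrightarrow> 0" by (simp only: u_sq)
  then have "(\<lambda>j. sqrt ((nrm (u j))\<^sup>2)) \<longlonglongrightarrow> sqrt 0" by (rule tendsto_real_sqrt)
  then have "(\<lambda>j. nrm (u j)) \<longlonglongrightarrow> 0" by simp
  then have u_lim: "(\<lambda>m. nrm (u (Suc (r m)))) \<longlonglongrightarrow> 0"
    using LIMSEQ_subseq_LIMSEQ[OF LIMSEQ_Suc re(1)] by (simp add: o_def)
  define v where "v = K (K e) + sc c e"
  have vX: "v \<in> X" using re by (simp add: v_def)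
  have le: "nrm v \<le> nrm (u (Suc (r m))) + (C\<^sup>2 + cmod c) * nrm (p (Suc (r m)) - e)" for m
  proof -
    have "nrm v \<le> nrm (v - u (Suc (r m))) + nrm (u (Suc (r m)))" using vX by (intro nrm_le_diff) auto
    also have "v - u (Suc (r m)) = ((K ^^ 2) e - (K ^^ 2) (p (Suc (r m)))) + sc c (e - p (Suc (r m)))"
      by (simp add: v_def u_def numeral_2_eq_2 scale_right_diff_distrib)
    also have "nrm \<dots> \<le> nrm ((K ^^ 2) e - (K ^^ 2) (p (Suc (r m)))) + nrm (sc c (e - p (Suc (r m))))"
      using re by (intro nrm_triangle) auto
    also have "\<dots> \<le> C\<^sup>2 * nrm (e - p (Suc (r m))) + cmod c * nrm (e - p (Suc (r m)))"
      using re by (intro add_mono nrm_K_funpow_diff_le) (auto simp: nrm_sc[of "e - p (Suc (r m))" c])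
    finally show ?thesis
      using nrm_minus_commute[of e "p (Suc (r m))"] re by (simp add: algebra_simps)
  qed
  have "(\<lambda>m. nrm (u (Suc (r m))) + (C\<^sup>2 + cmod c) * nrm (p (Suc (r m)) - e)) \<longlonglongrightarrow> 0 + (C\<^sup>2 + cmod c) * 0"
    by (intro tendsto_intros u_lim re)
  then have "nrm v \<le> 0 + (C\<^sup>2 + cmod c) * 0" using le by (intro Lim_bounded2) auto
  then have "K (K e) \<simeq> sc (- c) e" using re by (intro eqvI) (auto simp: v_def)
  then show thesis using that[of e l] re e1 l_pos by (simp add: c_def)
qed

text \<open>\<open>A\<close> commutes with the semigroup, so \<open>A\<close> stays bounded along
  the orbit and compactness provides a limit point at integer times. Monotonicity of the norm lets
  one subsequence decide the limit.\<close>

lemma orbit_tendsto_0: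
  assumes comp: "compact_inverse" and x: "x \<in> D"
    and no_ev: "\<And>x \<mu>. x \<in> D \<Longrightarrow> Re \<mu> = 0 \<Longrightarrow> A x \<simeq> sc \<mu> x \<Longrightarrow> nrm x = 0"
  shows "((\<lambda>t. nrm (T t x)) \<longlongrightarrow> 0) at_top"
proof -
  have xX: "x \<in> X" using x D_subset by blast
  obtain L where L: "((\<lambda>t. nrm (T t x)) \<longlongrightarrow> L) at_top"
    using decreasing_nonneg_tendsto[of "\<lambda>t. nrm (T t x)"] nrm_T_antimono[OF xX] xX by auto
  have rT: "rder (T (real n) x) (T (real n) (A x))" for n by (intro rder_T rder_A x) simp
  have le: "nrm (A (T (real n) x)) \<le> nrm (A x)" for n
    using eqv_nrm[OF A_eqv[OF rT[of n]]] T_contraction[of "real n" "A x"] x by simp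
  obtain r y where ry: "strict_mono r" "y \<in> X" "(\<lambda>n. nrm (T (real (r n)) x - y)) \<longlonglongrightarrow> 0"
    by (rule compact_inverseE[OF comp rder_in_D[OF rT] le])
  have "filterlim (\<lambda>n. real (r n)) at_top sequentially"
    using ry(1) by (intro filterlim_compose[OF filterlim_real_sequentially] filterlim_subseq)
  then have "(\<lambda>n. nrm (T (real (r n)) x)) \<longlonglongrightarrow> L" by (rule filterlim_compose[OF L])
  moreover have "(\<lambda>n. nrm (T (real (r n)) x)) \<longlonglongrightarrow> nrm y"
    using ry xX by (intro nrm_tendsto) auto
  ultimately have Ly: "L = nrm y" by (rule LIMSEQ_unique)
  have "nrm y = 0"
  proof (rule ccontr)
    assume "nrm y \<noteq> 0"
    then obtain e l where el: "e \<in> X" "nrm e = 1" "0 < l" "K (K e) \<simeq> sc (- (complex_of_real l)\<^sup>2) e"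
      using power_iteration[OF comp ry(2)] orbit_limit_isometric[OF xX ry(2,1,3)] by metis
    \<comment> \<open>Factor \<open>K\<^sup>2 + l\<^sup>2\<close> as
      \<open>(K - i l) (K + i l)\<close>. If \<open>w = (K + i l) e\<close> is null, then
      \<open>e\<close> is an eigenvector of \<open>K\<close> with eigenvalue \<open>- i l\<close>;
      otherwise \<open>w\<close> is one with eigenvalue \<open>i l\<close>. Inverting gives an
      imaginary eigenvalue of \<open>A\<close>.\<close>
    define w where "w = K e + sc (\<i> * of_real l) e"
    have w: "w \<in> X" using el by (simp add: w_def)
    show False
    proof (cases "nrm w = 0")
      case True
      then have Ke: "K e \<simeq> sc (- (\<i> * of_real l)) e"
        using el by (intro eqvI) (auto simp: w_def)
      have "sc (\<i> / of_real l) (K e) \<simeq> sc (\<i> / of_real l) (sc (- (\<i> * of_real l)) e)"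
        by (rule eqv_sc[OF Ke])
      then have "e \<simeq> sc (\<i> / of_real l) (K e)" using el(3) eqv_sym by simp
      with A_eqv[OF rder_K[OF el(1)]] have "A (K e) \<simeq> sc (\<i> / of_real l) (K e)" by (rule eqv_trans)
      then have "nrm (K e) = 0"
        using rder_in_D[OF rder_K[OF el(1)]] by (intro no_ev[of _ "\<i> / of_real l"]) auto
      then have "nrm e = 0" using nrm_K_eq_0 el(1) by blast
      then show False using el(2) by simp
    next
      case False
      have "rder (K (K e) + sc (\<i> * of_real l) (K e)) w"
        unfolding w_def by (intro rder_add rder_sc rder_K K_closed el(1))
      moreover have "sc (\<i> * of_real l) w \<simeq> K (K e) + sc (\<i> * of_real l) (K e)"
      proof -
        have "sc (\<i> * of_real l) w = sc (- (of_real l)\<^sup>2) e + sc (\<i> * of_real l) (K e)"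
        proof -
          have "\<i> * of_real l * (\<i> * of_real l) = - (complex_of_real l)\<^sup>2"
            by (simp add: power_mult_distrib flip: power2_eq_square)
          then show ?thesis by (simp add: w_def scale_right_distrib add.commute)
        qed
        also have "\<dots> \<simeq> K (K e) + sc (\<i> * of_real l) (K e)"
          using el by (intro eqv_add eqv_sym[OF el(4)]) auto
        finally show ?thesis .
      qed
      ultimately have r: "rder (sc (\<i> * of_real l) w) w"
        by (rule rder_eqv) (use w in simp)
      have "A (sc (\<i> * of_real l) w) \<simeq> w" by (rule A_eqv[OF r])
      also have "w = sc (1 / (\<i> * of_real l)) (sc (\<i> * of_real l) w)" using el by simp
      finally have "nrm (sc (\<i> * of_real l) w) = 0"
        using rder_in_D[OF r] by (intro no_ev[of _ "1 / (\<i> * of_real l)"]) (auto simp: Re_divide)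
      then show False using False el w by (simp add: nrm_sc norm_mult)
    qed
  qed
  then show ?thesis using L Ly by simp
qed

end

section \<open>Decay of all orbits\<close>

context contraction_semigroup_generator
begin

text \<open>Decay is obtained on \<open>D\<close>; contractivity makes the error of approximating
  \<open>x\<close> from \<open>D\<close> uniform in time, so density extends it to
  \<open>X\<close>.\<close>

theorem asymptotic_stability:
  assumes comp: "compact_inverse"
    and surj: "\<And>f. f \<in> X \<Longrightarrow> \<exists>x\<in>D. A x \<simeq> f"
    and res: "\<And>l f. 0 < l \<Longrightarrow> f \<in> X \<Longrightarrow> \<exists>y\<in>D. sc (complex_of_real l) y - A y \<simeq> f"
    and no_ev: "\<And>x \<mu>. x \<in> D \<Longrightarrow> Re \<mu> = 0 \<Longrightarrow> A x \<simeq> sc \<mu> x \<Longrightarrow> nrm x = 0"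
    and x: "x \<in> X"
  shows "((\<lambda>t. nrm (T t x)) \<longlongrightarrow> 0) at_top"
proof -
  obtain C where C: "0 < C" "\<And>x y. rder x y \<Longrightarrow> nrm x \<le> C * nrm y"
    by (rule compact_inverse_bounded[OF comp no_ev[of _ 0]]) auto
  obtain K where K: "\<And>f. f \<in> X \<Longrightarrow> K f \<in> D \<and> A (K f) \<simeq> f" using surj by metis
  interpret boundedly_invertible_generator sc X ip T D A K C
  proof
    show "rder (K f) f" if "f \<in> X" for f
      using rder_eqv[OF rder_A, of "K f" "K f" f] K[OF that] D_subset eqv_sym by simp
  qed (use C in auto)
  show ?thesis
  proof (rule tendstoI)
    fix e :: real assume e: "0 < e"
    obtain y where y: "y \<in> D" "nrm (x - y) \<le> e / 2"
      using dense_domain[OF res x, of "e / 2"] e by auto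
    have yX: "y \<in> X" using y D_subset by blast
    have "((\<lambda>t. nrm (T t y)) \<longlongrightarrow> 0) at_top" by (rule orbit_tendsto_0[OF comp y(1) no_ev])
    then have "\<forall>\<^sub>F t in at_top. dist (nrm (T t y)) 0 < e / 2" using e by (intro tendstoD) auto
    then show "\<forall>\<^sub>F t in at_top. dist (nrm (T t x)) 0 < e"
      using eventually_ge_at_top[of 0]
    proof eventually_elim
      case (elim t)
      have "nrm (T t x) \<le> nrm (T t x - T t y) + nrm (T t y)" using elim x yX by (intro nrm_le_diff) auto
      moreover have "nrm (T t x - T t y) \<le> nrm (x - y)" using elim x yX by (intro nrm_T_diff) auto
      moreover have "0 \<le> nrm (T t x)" using elim x by simp
      ultimately show ?case using elim y by (simp add: dist_real_def)
    qed
  qed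
qed

end

subsection \<open>Square-integrable functions and linear integral equations\<close>

text \<open>The endpoints are put into the exceptional set, which turns a statement on the open
  interval into one usable for integrals over closed subintervals.\<close>

lemma ae_eq_negligible:
  assumes "AE \<zeta> in lebesgue_on {a<..<b::real}. R \<zeta>"
  obtains S where "negligible S" "\<And>\<zeta>. \<zeta> \<in> {a..b} - S \<Longrightarrow> R \<zeta>"
proof -
  have "AE \<zeta> in lebesgue. \<zeta> \<in> {a<..<b} \<longrightarrow> R \<zeta>"
    using assms by (subst (asm) AE_restrict_space_iff) auto
  then obtain S where S: "S \<in> null_sets lebesgue" "\<forall>\<zeta>. \<zeta> \<notin> S \<longrightarrow> \<zeta> \<in> {a<..<b} \<longrightarrow> R \<zeta>"
    by (auto elim!: AE_E3 simp: space_completion)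
  show thesis
  proof
    show "negligible (S \<union> {a, b})"
      using S(1) by (simp add: negligible_iff_null_sets[symmetric] negligible_Un)
    show "R \<zeta>" if "\<zeta> \<in> {a..b} - (S \<union> {a, b})" for \<zeta>
    proof -
      have "\<zeta> \<in> {a<..<b}" using that by auto
      then show ?thesis using that S(2) by blast
    qed
  qed
qed

lemma L2_add:
  assumes "f \<in> L2 a b" "g \<in> L2 a b" shows "(\<lambda>\<zeta>. f \<zeta> + g \<zeta>) \<in> L2 a b"
proof -
  have "integrable (lebesgue_on {a<..<b}) (\<lambda>\<zeta>. (norm (f \<zeta> + g \<zeta>))\<^sup>2)"
  proof (rule Bochner_Integration.integrable_bound)
    show "integrable (lebesgue_on {a<..<b}) (\<lambda>\<zeta>. 2 * (norm (f \<zeta>))\<^sup>2 + 2 * (norm (g \<zeta>))\<^sup>2)"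
      using assms by (auto simp: L2_def)
    show "(\<lambda>\<zeta>. (norm (f \<zeta> + g \<zeta>))\<^sup>2) \<in> borel_measurable (lebesgue_on {a<..<b})"
      using assms by (auto simp: L2_def)
    have "(norm (x + y))\<^sup>2 \<le> 2 * (norm x)\<^sup>2 + 2 * (norm y)\<^sup>2" for x y :: 'a
    proof -
      have "(norm (x + y))\<^sup>2 \<le> (norm x + norm y)\<^sup>2" by (intro power_mono norm_triangle_ineq) auto
      also have "\<dots> \<le> 2 * (norm x)\<^sup>2 + 2 * (norm y)\<^sup>2"
        using sum_squares_bound[of "norm x" "norm y"] by (simp add: power2_sum)
      finally show ?thesis .
    qed
    then show "AE \<zeta> in lebesgue_on {a<..<b}. norm ((norm (f \<zeta> + g \<zeta>))\<^sup>2)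
        \<le> norm (2 * (norm (f \<zeta>))\<^sup>2 + 2 * (norm (g \<zeta>))\<^sup>2)"
      by (intro always_eventually) auto
  qed
  then show ?thesis using assms by (auto simp: L2_def)
qed

lemma L2_dominated:
  fixes f :: "real \<Rightarrow> 'a::euclidean_space" and g :: "real \<Rightarrow> 'b::euclidean_space"
  assumes "f \<in> borel_measurable (lebesgue_on {a<..<b})" "g \<in> L2 a b"
    and le: "AE \<zeta> in lebesgue_on {a<..<b}. norm (f \<zeta>) \<le> C * norm (g \<zeta>)"
  shows "f \<in> L2 a b"
proof -
  have "integrable (lebesgue_on {a<..<b}) (\<lambda>\<zeta>. (norm (f \<zeta>))\<^sup>2)"
  proof (rule Bochner_Integration.integrable_bound)
    show "integrable (lebesgue_on {a<..<b}) (\<lambda>\<zeta>. C\<^sup>2 * (norm (g \<zeta>))\<^sup>2)"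
      using assms by (auto simp: L2_def)
    show "(\<lambda>\<zeta>. (norm (f \<zeta>))\<^sup>2) \<in> borel_measurable (lebesgue_on {a<..<b})"
      using assms by auto
    show "AE \<zeta> in lebesgue_on {a<..<b}. norm ((norm (f \<zeta>))\<^sup>2) \<le> norm (C\<^sup>2 * (norm (g \<zeta>))\<^sup>2)"
      using le
    proof eventually_elim
      case (elim \<zeta>)
      then have "(norm (f \<zeta>))\<^sup>2 \<le> (C * norm (g \<zeta>))\<^sup>2" by (intro power_mono) auto
      then show ?case by (simp add: power_mult_distrib)
    qed
  qed
  then show ?thesis using assms by (auto simp: L2_def)
qed

lemma L2_bounded:
  fixes f :: "real \<Rightarrow> 'a::euclidean_space"
  assumes "f \<in> borel_measurable (lebesgue_on {a<..<b})"
    and "AE \<zeta> in lebesgue_on {a<..<b}. norm (f \<zeta>) \<le> C"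
  shows "f \<in> L2 a b"
proof (rule L2_dominated[OF assms(1)])
  interpret finite_measure "lebesgue_on {a<..<b}"
    by (rule finite_measure_lebesgue_on) simp
  show "(\<lambda>_. 1 :: real) \<in> L2 a b" by (simp add: L2_def)
  show "AE \<zeta> in lebesgue_on {a<..<b}. norm (f \<zeta>) \<le> C * norm (1::real)" using assms(2) by simp
qed

lemma L2_scaleR: "f \<in> L2 a b \<Longrightarrow> (\<lambda>\<zeta>. c *\<^sub>R f \<zeta>) \<in> L2 a b"
  by (rule L2_dominated[of _ a b f "\<bar>c\<bar>"]) (auto simp: L2_def)

lemma L2_linear:
  fixes f :: "real \<Rightarrow> 'a::euclidean_space" and h :: "'a \<Rightarrow> 'b::euclidean_space"
  assumes "bounded_linear h" "f \<in> L2 a b" shows "(\<lambda>\<zeta>. h (f \<zeta>)) \<in> L2 a b"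
proof -
  obtain C where C: "\<And>x. norm (h x) \<le> C * norm x"
    using bounded_linear.bounded[OF assms(1)] by (auto simp: mult.commute)
  have "h \<in> borel_measurable borel"
    by (intro borel_measurable_continuous_onI linear_continuous_on assms(1))
  then show ?thesis
    by (intro L2_dominated[OF measurable_compose[of f _ borel] assms(2), of _ C])
      (use assms(2) C in \<open>auto simp: L2_def\<close>)
qed

lemma L2_continuous:
  fixes f :: "real \<Rightarrow> 'a::euclidean_space"
  assumes "continuous_on {a..b} f" shows "f \<in> L2 a b"
proof -
  have "bounded (f ` {a..b})" by (intro compact_imp_bounded compact_continuous_image assms) simp
  then obtain C where C: "\<forall>\<zeta>\<in>{a..b}. norm (f \<zeta>) \<le> C" by (auto simp: bounded_iff)
  have "f \<in> borel_measurable (lebesgue_on {a<..<b})"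
    by (intro continuous_imp_measurable_on_sets_lebesgue continuous_on_subset[OF assms]) auto
  moreover have "AE \<zeta> in lebesgue_on {a<..<b}. norm (f \<zeta>) \<le> C"
    using C by (intro AE_I2) (auto simp: less_imp_le)
  ultimately show ?thesis by (rule L2_bounded)
qed

lemma L2_absolutely_integrable:
  fixes f :: "real \<Rightarrow> 'a::euclidean_space"
  assumes "f \<in> L2 a b" shows "f absolutely_integrable_on {a..b}"
proof -
  interpret finite_measure "lebesgue_on {a<..<b}"
    by (rule finite_measure_lebesgue_on) simp
  have "f absolutely_integrable_on {a<..<b}"
  proof (rule measurable_bounded_by_integrable_imp_absolutely_integrable)
    have "integrable (lebesgue_on {a<..<b}) (\<lambda>\<zeta>. 1 + (norm (f \<zeta>))\<^sup>2)"
      using assms by (intro Bochner_Integration.integrable_add) (auto simp: L2_def)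
    then show "(\<lambda>\<zeta>. 1 + (norm (f \<zeta>))\<^sup>2) integrable_on {a<..<b}"
      by (rule integrable_on_lebesgue_on) simp
    show "norm (f \<zeta>) \<le> 1 + (norm (f \<zeta>))\<^sup>2" for \<zeta>
      using sum_squares_bound[of 1 "norm (f \<zeta>)"] norm_ge_zero[of "f \<zeta>"] by (simp del: norm_ge_zero)
  qed (use assms in \<open>auto simp: L2_def\<close>)
  then show ?thesis
    by (simp add: absolutely_integrable_on_def integrable_on_Icc_iff_Ioo)
qed

lemma has_integral_ae_cong:
  fixes f g :: "real \<Rightarrow> 'a::banach"
  assumes "AE \<zeta> in lebesgue_on {a<..<b}. f \<zeta> = g \<zeta>" "t \<in> {a..b}"
    and "(f has_integral I) {a..t}"
  shows "(g has_integral I) {a..t}"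
proof -
  obtain S where S: "negligible S" "\<And>\<zeta>. \<zeta> \<in> {a..b} - S \<Longrightarrow> f \<zeta> = g \<zeta>"
    using ae_eq_negligible[OF assms(1)] by blast
  show ?thesis using assms S by (intro has_integral_spike[OF S(1) _ assms(3)]) auto
qed

text \<open>A null set has dense complement in the interval. This is what makes boundary values
  independent of the representative.\<close>

lemma ae_continuous_zero:
  fixes f :: "real \<Rightarrow> 'a::real_normed_vector"
  assumes "a < b" "continuous_on {a..b} f" "AE \<zeta> in lebesgue_on {a<..<b}. f \<zeta> = 0" "t \<in> {a..b}"
  shows "f t = 0"
proof -
  obtain S where S: "negligible S" "\<And>\<zeta>. \<zeta> \<in> {a..b} - S \<Longrightarrow> f \<zeta> = 0"
    using ae_eq_negligible[OF assms(3)] by blast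
  have "closure ({a<..<b} - S) = {a..b}"
  proof -
    have "{a<..<b} \<subseteq> closure ({a<..<b} - S)"
    proof
      fix x assume x: "x \<in> {a<..<b}"
      show "x \<in> closure ({a<..<b} - S)"
        unfolding closure_approachable
      proof (intro allI impI)
        fix e :: real assume "0 < e"
        have "x \<in> ball x e \<inter> {a<..<b}" using x \<open>0 < e\<close> by simp
        moreover have "open (ball x e \<inter> {a<..<b})" by (intro open_Int) auto
        ultimately have "\<not> negligible (ball x e \<inter> {a<..<b})" using open_not_negligible by blast
        then have "\<not> ball x e \<inter> {a<..<b} \<subseteq> S" using S(1) negligible_subset by blast
        then obtain z where "z \<in> ball x e \<inter> {a<..<b}" "z \<notin> S" by blast
        then show "\<exists>y\<in>{a<..<b} - S. dist y x < e" by (intro bexI[of _ z]) (auto simp: dist_commute)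
      qed
    qed
    then have "closure {a<..<b} \<subseteq> closure ({a<..<b} - S)" by (simp add: closure_minimal)
    moreover have "closure ({a<..<b} - S) \<subseteq> closure {a<..<b}" by (intro closure_mono) auto
    ultimately show ?thesis using assms(1) by auto
  qed
  then show ?thesis
    using continuous_constant_on_closure[of "{a<..<b} - S" f 0 t] assms S by auto
qed

section \<open>Gronwall's inequality and Picard iteration\<close>

lemma gronwall:
  fixes y :: "real \<Rightarrow> real"
  assumes cont: "continuous_on {a..b} y" and K: "0 \<le> K"
    and le: "\<And>t. t \<in> {a..b} \<Longrightarrow> y t \<le> c + K * integral {a..t} y"
    and t: "t \<in> {a..b}"
  shows "y t \<le> c * exp (K * (t - a))"
proof -
  \<comment> \<open>The right-hand side of the hypothesis times its integrating factor; the
    hypothesis says precisely that the derivative of \<open>g\<close> is at most 0.\<close>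
  define g where "g = (\<lambda>s. exp (- K * (s - a)) * (c + K * integral {a..s} y))"
  have at: "a \<le> t" "t \<le> b" using t by auto
  have sub: "continuous_on {a..t} y" using cont at by (auto intro: continuous_on_subset)
  have der: "(g has_real_derivative exp (- K * (s - a)) * (K * (y s - c - K * integral {a..s} y)))
      (at s within {a..t})" if "s \<in> {a..t}" for s
  proof -
    note [derivative_intros] = integral_has_real_derivative[OF sub that]
    show ?thesis unfolding g_def
      by (auto intro!: derivative_eq_intros simp: algebra_simps)
  qed
  have "g t \<le> g a"
  proof (rule DERIV_nonpos_imp_decreasing_open[OF at(1)])
    fix s assume s: "a < s" "s < t"
    have "(g has_real_derivative exp (- K * (s - a)) * (K * (y s - c - K * integral {a..s} y))) (at s)"
      using der[of s] s by (simp add: at_within_Icc_at)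
    moreover have "exp (- K * (s - a)) * (K * (y s - c - K * integral {a..s} y)) \<le> 0"
      using le[of s] s at K by (intro mult_nonneg_nonpos) auto
    ultimately show "\<exists>y. (g has_real_derivative y) (at s) \<and> y \<le> 0" by blast
  next
    show "continuous_on {a..t} g"
      unfolding continuous_on_eq_continuous_within using der DERIV_continuous by blast
  qed
  then have "exp (- K * (t - a)) * (c + K * integral {a..t} y) \<le> c" by (simp add: g_def)
  then have "exp (K * (t - a)) * (exp (- K * (t - a)) * (c + K * integral {a..t} y)) \<le> exp (K * (t - a)) * c"
    by (intro mult_left_mono) auto
  then have "c + K * integral {a..t} y \<le> c * exp (K * (t - a))"
    by (simp add: mult.assoc[symmetric] mult.commute flip: exp_add)
  then show ?thesis using le[OF t] by linarith
qed

text \<open>Gronwall applied to the norm of \<open>w\<close>, with the inhomogeneity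
  \<open>h\<close> absorbed into the constant by integrating it over the whole interval.\<close>

lemma integral_equation_bound:
  fixes w g :: "real \<Rightarrow> 'a::euclidean_space"
  assumes cont: "continuous_on {a..b} w" and K: "0 \<le> K"
    and int: "\<And>t. t \<in> {a..b} \<Longrightarrow> (g has_integral (w t - w a)) {a..t}"
    and le: "AE s in lebesgue_on {a<..<b}. norm (g s) \<le> K * norm (w s) + h s"
    and h: "h integrable_on {a..b}" "\<And>s. 0 \<le> h s"
    and t: "t \<in> {a..b}"
  shows "norm (w t) \<le> (norm (w a) + integral {a..b} h) * exp (K * (t - a))"
proof (rule gronwall[OF _ K _ t])
  show "continuous_on {a..b} (\<lambda>s. norm (w s))" by (intro continuous_intros cont)
  fix t assume t: "t \<in> {a..b}"
  obtain S where S: "negligible S" "\<And>s. s \<in> {a..b} - S \<Longrightarrow> norm (g s) \<le> K * norm (w s) + h s"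
    using ae_eq_negligible[OF le] by blast
  \<comment> \<open>The norm bound for integrals is needed at every point; on the null set the value
    0 satisfies it, as \<open>K\<close> and \<open>h\<close> are nonnegative.\<close>
  define g' where "g' s = (if s \<in> S then 0 else g s)" for s
  have g': "(g' has_integral (w t - w a)) {a..t}"
    by (rule has_integral_spike[OF S(1) _ int[OF t]]) (simp add: g'_def)
  have sub: "{a..t} \<subseteq> {a..b}" using t by auto
  have nw: "(\<lambda>s. norm (w s)) integrable_on {a..t}"
    using cont sub by (intro integrable_continuous_real continuous_intros) (auto intro: continuous_on_subset)
  have ht: "h integrable_on {a..t}" using h(1) sub by (rule integrable_on_subinterval)
  have "norm (w t - w a) \<le> integral {a..t} (\<lambda>s. K * norm (w s) + h s)"
  proof -
    have "norm (integral {a..t} g') \<le> integral {a..t} (\<lambda>s. K * norm (w s) + h s)"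
    proof (rule Henstock_Kurzweil_Integration.integral_norm_bound_integral)
      show "g' integrable_on {a..t}" using g' by blast
      show "(\<lambda>s. K * norm (w s) + h s) integrable_on {a..t}"
        using nw ht by (intro integrable_add integrable_on_mult_right)
      show "norm (g' s) \<le> K * norm (w s) + h s" if "s \<in> {a..t}" for s
        using that sub S(2)[of s] K h(2)[of s] by (auto simp: g'_def)
    qed
    then show ?thesis using g' by (simp add: integral_unique)
  qed
  also have "\<dots> = K * integral {a..t} (\<lambda>s. norm (w s)) + integral {a..t} h"
    using nw ht by (simp add: Henstock_Kurzweil_Integration.integral_add integrable_on_mult_right)
  also have "integral {a..t} h \<le> integral {a..b} h"
    using h ht sub by (intro integral_subset_le) auto
  finally have "norm (w t - w a) \<le> K * integral {a..t} (\<lambda>s. norm (w s)) + integral {a..b} h" by simp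
  then show "norm (w t) \<le> norm (w a) + integral {a..b} h + K * integral {a..t} (\<lambda>s. norm (w s))"
    using norm_triangle_ineq2[of "w t" "w a"] by linarith
qed

text \<open>Picard iteration, as a contraction for the norm \<open>sup e\<^sup>-\<^sup>c\<^sup>(\<^sup>t\<^sup>-\<^sup>a\<^sup>) |v(t)|\<close> with \<open>c > K\<close>.\<close>

lemma integral_equation_solution:
  fixes G :: "real \<Rightarrow> 'a::euclidean_space \<Rightarrow> 'a"
  assumes "a \<le> b" and K: "0 \<le> K"
    and int: "\<And>v. continuous_on {a..b} v \<Longrightarrow> (\<lambda>s. G s (v s)) integrable_on {a..b}"
    and lip: "\<And>s v w. s \<in> {a..b} \<Longrightarrow> norm (G s v - G s w) \<le> K * norm (v - w)"
  shows "\<exists>v. continuous_on {a..b} v \<and>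
    (\<forall>t\<in>{a..b}. ((\<lambda>s. G s (v s)) has_integral (v t - c)) {a..t})"
proof -
  \<comment> \<open>Any rate above \<open>K\<close> makes the contraction factor
    \<open>K / r\<close> less than one.\<close>
  define r where "r = K + 1"
  have r: "0 < r" "K < r" using K by (auto simp: r_def)
  \<comment> \<open>Bounded continuous functions here live on the whole line; the retraction
    \<open>cl\<close> onto the interval extends functions given on it.\<close>
  define cl where "cl t = max a (min b t)" for t
  have cl: "cl t \<in> {a..b}" for t using \<open>a \<le> b\<close> by (auto simp: cl_def)
  have cl_id: "cl t = t" if "t \<in> {a..b}" for t using that by (auto simp: cl_def)
  have cl_cont: "continuous_on UNIV cl" unfolding cl_def by (intro continuous_intros)
  \<comment> \<open>The iteration acts on the weighted unknown \<open>w\<close>, for which the plain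
    sup metric is the weighted one; \<open>U\<close> removes the weight and recovers
    \<open>v\<close>.\<close>
  define U where "U w s = exp (r * (s - a)) *\<^sub>R apply_bcontfun w s" for w :: "real \<Rightarrow>\<^sub>C 'a" and s
  have U_cont: "continuous_on S (U w)" for S w
    unfolding U_def using apply_bcontfun[of w]
    by (intro continuous_intros) (auto simp: bcontfun_def intro: continuous_on_subset)
  have GU: "(\<lambda>s. G s (U w s)) integrable_on {a..t}" if "t \<in> {a..b}" for w t
    using int[OF U_cont] by (rule integrable_on_subinterval) (use that in auto)
  define F where "F w t = exp (- r * (t - a)) *\<^sub>R (c + integral {a..t} (\<lambda>s. G s (U w s)))" for w t
  have F_cont: "continuous_on {a..b} (F w)" for w
    unfolding F_def by (intro continuous_intros indefinite_integral_continuous_1 int U_cont)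
  define \<Phi> where "\<Phi> w = Bcontfun (\<lambda>t. F w (cl t))" for w
  have "(\<lambda>t. F w (cl t)) \<in> bcontfun" for w
  proof -
    have "continuous_on UNIV (\<lambda>t. F w (cl t))"
      using cl by (intro continuous_on_compose2[OF F_cont cl_cont]) auto
    moreover have "bounded (F w ` {a..b})"
      by (intro compact_imp_bounded compact_continuous_image F_cont) simp
    then have "bounded (range (\<lambda>t. F w (cl t)))" by (rule bounded_subset) (use cl in auto)
    ultimately show ?thesis by (simp add: bcontfun_def)
  qed
  then have \<Phi>: "apply_bcontfun (\<Phi> w) t = F w (cl t)" for w t
    by (simp add: \<Phi>_def Bcontfun_inverse)
  have contr: "dist (\<Phi> w1) (\<Phi> w2) \<le> K / r * dist w1 w2" for w1 w2
  proof (rule dist_bound)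
    fix t0
    define t where "t = cl t0"
    have t: "t \<in> {a..b}" using cl by (simp add: t_def)
    define E where "E = (\<lambda>s. K * dist w1 w2 * exp (r * (s - a)))"
    have E_int: "(E has_integral (K * dist w1 w2 / r * (exp (r * (t - a)) - 1))) {a..t}"
    proof -
      have "((\<lambda>s. K * dist w1 w2 / r * exp (r * (s - a))) has_real_derivative E s) (at s within {a..t})" for s
        unfolding E_def using r by (auto intro!: derivative_eq_intros)
      then have "(E has_integral (K * dist w1 w2 / r * exp (r * (t - a)) - K * dist w1 w2 / r * exp (r * (a - a)))) {a..t}"
        using t by (intro fundamental_theorem_of_calculus) (auto simp: has_real_derivative_iff_has_vector_derivative)
      then show ?thesis by (simp add: right_diff_distrib)
    qed
    have "norm (integral {a..t} (\<lambda>s. G s (U w1 s) - G s (U w2 s))) \<le> integral {a..t} E"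
    proof (rule Henstock_Kurzweil_Integration.integral_norm_bound_integral)
      show "(\<lambda>s. G s (U w1 s) - G s (U w2 s)) integrable_on {a..t}"
        using GU[OF t] by (intro integrable_diff)
      show "E integrable_on {a..t}" using E_int by blast
      fix s assume s: "s \<in> {a..t}"
      have "U w1 s - U w2 s = exp (r * (s - a)) *\<^sub>R (apply_bcontfun w1 s - apply_bcontfun w2 s)"
        by (simp add: U_def scaleR_diff_right)
      then have le: "norm (U w1 s - U w2 s) \<le> exp (r * (s - a)) * dist w1 w2"
        using dist_bounded[of w1 s w2] by (simp add: dist_norm)
      have "norm (G s (U w1 s) - G s (U w2 s)) \<le> K * norm (U w1 s - U w2 s)"
        using s t by (intro lip) auto
      then show "norm (G s (U w1 s) - G s (U w2 s)) \<le> E s"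
        using mult_left_mono[OF le K] by (simp add: E_def algebra_simps)
    qed
    also have "integral {a..t} E = K * dist w1 w2 / r * (exp (r * (t - a)) - 1)"
      using E_int by (rule integral_unique)
    also have "\<dots> \<le> K * dist w1 w2 / r * exp (r * (t - a))"
      using K r by (intro mult_left_mono) auto
    finally have *: "norm (integral {a..t} (\<lambda>s. G s (U w1 s) - G s (U w2 s))) \<le> K * dist w1 w2 / r * exp (r * (t - a))" .
    have "F w1 t - F w2 t = exp (- r * (t - a)) *\<^sub>R integral {a..t} (\<lambda>s. G s (U w1 s) - G s (U w2 s))"
      using GU[OF t] by (simp add: F_def Henstock_Kurzweil_Integration.integral_diff scaleR_diff_right[symmetric])
    then have "dist (F w1 t) (F w2 t) = exp (- r * (t - a)) * norm (integral {a..t} (\<lambda>s. G s (U w1 s) - G s (U w2 s)))"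
      by (simp add: dist_norm)
    also have "\<dots> \<le> exp (- r * (t - a)) * (K * dist w1 w2 / r * exp (r * (t - a)))"
      using * by (intro mult_left_mono) auto
    also have "\<dots> = K * dist w1 w2 / r * (exp (- r * (t - a)) * exp (r * (t - a)))"
      by (rule mult.left_commute)
    also have "exp (- r * (t - a)) * exp (r * (t - a)) = 1" by (simp flip: exp_add)
    finally show "dist (apply_bcontfun (\<Phi> w1) t0) (apply_bcontfun (\<Phi> w2) t0) \<le> K / r * dist w1 w2"
      by (simp add: \<Phi> t_def)
  qed
  have "\<exists>!w. \<Phi> w = w"
    by (rule banach_fix_type[of "K / r"]) (use K r contr in auto)
  then obtain w where w: "\<Phi> w = w" by blast
  define v where "v = U w"
  have "((\<lambda>s. G s (v s)) has_integral (v t - c)) {a..t}" if t: "t \<in> {a..b}" for t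
  proof -
    have "apply_bcontfun w t = F w t" using \<Phi>[of w t] t by (simp add: w cl_id)
    then have "v t = c + integral {a..t} (\<lambda>s. G s (v s))"
      by (simp add: v_def U_def F_def flip: exp_add)
    then show ?thesis using GU[OF t, of w] by (simp add: v_def integrable_integral)
  qed
  then show ?thesis using U_cont[of _ w] by (intro exI[of _ v]) (auto simp: v_def)
qed

lemma bounded_bilinear_matrix_vector_mult:
  "bounded_bilinear ((*v) :: complex ^ 'c ^ 'r \<Rightarrow> complex ^ 'c \<Rightarrow> complex ^ 'r)"
  unfolding bilinear_conv_bounded_bilinear[symmetric] bilinear_def
  by (intro conjI allI linearI)
    (simp_all add: matrix_vector_mult_def vec_eq_iff sum.distrib scaleR_sum_right algebra_simps
      matrix_vector_mult_add_rdistrib)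

lemma bounded_bilinear_cdot: "bounded_bilinear (cdot :: complex ^ 'k::finite \<Rightarrow> complex ^ 'k \<Rightarrow> complex)"
  unfolding bilinear_conv_bounded_bilinear[symmetric] bilinear_def
  by (intro conjI allI linearI)
    (simp_all add: cdot_def sum.distrib scaleR_sum_right algebra_simps)

text \<open>If the integrals over all intervals vanish, Henstock's lemma makes the Riemann sums of
  \<open>norm (f x)\<close> small.\<close>

lemma zero_indefinite_integral:
  fixes f :: "real \<Rightarrow> 'a::euclidean_space"
  assumes f: "f \<in> L2 a b" and zero: "\<And>t. t \<in> {a..b} \<Longrightarrow> (f has_integral 0) {a..t}" and "a < b"
  shows "AE \<zeta> in lebesgue_on {a<..<b}. f \<zeta> = 0"
proof -
  have abs: "f absolutely_integrable_on {a..b}" using f by (rule L2_absolutely_integrable)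
  have int0: "integral {u..v} f = 0" if "{u..v} \<subseteq> {a..b}" for u v
  proof (cases "u \<le> v")
    case True
    then have uv: "a \<le> u" "v \<le> b" using that by auto
    have "integral {a..u} f + integral {u..v} f = integral {a..v} f"
      using True uv zero[of v] by (intro Henstock_Kurzweil_Integration.integral_combine) auto
    then show ?thesis using zero[of u] zero[of v] True uv by (simp add: integral_unique)
  qed simp
  have nf: "((\<lambda>x. norm (f x)) has_integral 0) (cbox a b)"
    unfolding has_integral
  proof (intro allI impI)
    fix e :: real assume "0 < e"
    have "f integrable_on cbox a b" using abs by (simp add: absolutely_integrable_on_def)
    then obtain \<gamma> where g: "gauge \<gamma>" and
      \<gamma>: "\<And>p. \<lbrakk>p tagged_partial_division_of (cbox a b); \<gamma> fine p\<rbrakk> \<Longrightarrow>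
             sum (\<lambda>(x,k). norm (measure lborel k *\<^sub>R f x - integral k f)) p < e"
      using \<open>0 < e\<close> by (rule Henstock_lemma) blast
    have *: "norm ((\<Sum>(x, k)\<in>p. measure lborel k *\<^sub>R norm (f x)) - 0) < e"
      if p: "p tagged_division_of cbox a b" "\<gamma> fine p" for p
    proof -
      have "(\<Sum>(x, k)\<in>p. measure lborel k *\<^sub>R norm (f x))
          = (\<Sum>(x, k)\<in>p. norm (measure lborel k *\<^sub>R f x - integral k f))"
      proof (rule sum.cong[OF refl], clarify)
        fix x k assume xk: "(x, k) \<in> p"
        obtain u v where k: "k = cbox u v" using tagged_division_ofD(4)[OF p(1) xk] by (elim exE)
        moreover have "k \<subseteq> cbox a b" by (rule tagged_division_ofD(3)[OF p(1) xk])
        ultimately show "measure lborel k *\<^sub>R norm (f x) = norm (measure lborel k *\<^sub>R f x - integral k f)"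
          using int0[of u v] by simp
      qed
      also have "\<dots> < e"
        using p unfolding tagged_division_of_def by (intro \<gamma>) auto
      finally have "(\<Sum>(x, k)\<in>p. measure lborel k *\<^sub>R norm (f x)) < e" .
      moreover have "0 \<le> (\<Sum>(x, k)\<in>p. measure lborel k *\<^sub>R norm (f x))"
        by (intro sum_nonneg) auto
      ultimately show ?thesis by simp
    qed
    show "\<exists>\<gamma>. gauge \<gamma> \<and> (\<forall>p. p tagged_division_of cbox a b \<and> \<gamma> fine p \<longrightarrow>
        norm ((\<Sum>(x, k)\<in>p. measure lborel k *\<^sub>R norm (f x)) - 0) < e)"
      by (intro exI[of _ \<gamma>] conjI allI impI g) (elim conjE, rule *)
  qed
  have "(\<lambda>x. norm (f x)) \<in> borel_measurable (lebesgue_on {a<..<b})" using f by (auto simp: L2_def)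
  moreover have "f absolutely_integrable_on {a<..<b}"
    using abs by (simp add: absolutely_integrable_on_def integrable_on_Icc_iff_Ioo)
  ultimately have int: "integrable (lebesgue_on {a<..<b}) (\<lambda>x. norm (f x))"
    by (simp add: absolutely_integrable_measurable o_def)
  have "((\<lambda>x. norm (f x)) has_integral (LINT x|lebesgue_on {a<..<b}. norm (f x))) {a<..<b}"
    using int by (rule has_integral_integral_lebesgue_on) simp
  moreover have "((\<lambda>x. norm (f x)) has_integral 0) {a<..<b}"
    using nf by (simp add: has_integral_Icc_iff_Ioo)
  ultimately have "(LINT x|lebesgue_on {a<..<b}. norm (f x)) = 0" by (rule has_integral_unique)
  then have "AE x in lebesgue_on {a<..<b}. norm (f x) = 0"
    using integral_nonneg_eq_0_iff_AE[OF int] by simp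
  then show ?thesis by simp
qed

section \<open>Measurable matrix functions and the complex inner product\<close>

lemma borel_measurable_vec:
  fixes f :: "'x \<Rightarrow> 'a::euclidean_space ^ 'k"
  assumes "\<And>i. (\<lambda>x. f x $ i) \<in> borel_measurable M"
  shows "f \<in> borel_measurable M"
proof -
  have "bounded_linear (axis i :: 'a \<Rightarrow> 'a ^ 'k)" for i
    by (rule linear_conv_bounded_linear[THEN iffD1], rule linearI) (auto simp: axis_def vec_eq_iff)
  then have "(axis i :: 'a \<Rightarrow> 'a ^ 'k) \<in> borel_measurable borel" for i
    by (intro borel_measurable_continuous_onI linear_continuous_on)
  then have "(\<lambda>x. \<Sum>i\<in>UNIV. axis i (f x $ i)) \<in> borel_measurable M"
    using assms by (intro borel_measurable_sum) (rule measurable_compose)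
  also have "(\<lambda>x. \<Sum>i\<in>UNIV. axis i (f x $ i)) = f"
    by (auto simp: fun_eq_iff vec_eq_iff axis_def if_distrib cong: if_cong)
  finally show ?thesis .
qed

lemma borel_measurable_vec_nth:
  fixes f :: "'x \<Rightarrow> 'a::euclidean_space ^ 'k"
  assumes "f \<in> borel_measurable M" shows "(\<lambda>x. f x $ i) \<in> borel_measurable M"
  by (rule measurable_compose[OF assms])
    (intro borel_measurable_continuous_onI linear_continuous_on bounded_linear_vec_nth)

lemma matrix_inv_works:
  fixes A :: "'a::field ^ 'n ^ 'n"
  assumes "invertible A" shows "A ** matrix_inv A = mat 1" "matrix_inv A ** A = mat 1"
proof -
  have "A ** matrix_inv A = mat 1 \<and> matrix_inv A ** A = mat 1"
    unfolding matrix_inv_def by (rule someI_ex) (use assms in \<open>simp add: invertible_def\<close>)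
  then show "A ** matrix_inv A = mat 1" "matrix_inv A ** A = mat 1" by auto
qed

lemma matrix_inv_vector:
  fixes A :: "'a::field ^ 'n ^ 'n"
  assumes "invertible A" shows "A *v (matrix_inv A *v x) = x" "matrix_inv A *v (A *v x) = x"
  by (simp_all add: matrix_vector_mul_assoc matrix_inv_works[OF assms])

text \<open>Cramer's rule; on singular matrices \<open>matrix_inv\<close> is \<open>SOME\<close> over an empty predicate, a constant.\<close>

lemma borel_measurable_matrix_inv:
  fixes A :: "'x \<Rightarrow> complex ^ 'n ^ 'n"
  assumes "A \<in> borel_measurable M"
  shows "(\<lambda>x. matrix_inv (A x)) \<in> borel_measurable M"
proof -
  define c :: "complex ^ 'n ^ 'n" where "c = (SOME B. False)"
  define cof :: "complex ^ 'n ^ 'n \<Rightarrow> complex ^ 'n ^ 'n" where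
    "cof B = (\<chi> k i. det (\<chi> p q. if q = k then (if p = i then 1 else 0) else B $ p $ q) / det B)" for B
  have ent: "(\<lambda>x. A x $ p $ q) \<in> borel_measurable M" for p q
    by (intro borel_measurable_vec_nth assms)
  have det: "(\<lambda>x. det (B x)) \<in> borel_measurable M"
    if "\<And>p q. (\<lambda>x. B x $ p $ q) \<in> borel_measurable M" for B :: "'x \<Rightarrow> complex ^ 'n ^ 'n"
    unfolding det_def by (intro borel_measurable_sum borel_measurable_times borel_measurable_prod that) simp
  have "(\<lambda>x. cof (A x)) \<in> borel_measurable M"
  proof (rule borel_measurable_vec, rule borel_measurable_vec)
    fix k i
    have "(\<lambda>x. det (\<chi> p q. if q = k then (if p = i then 1 else 0) else A x $ p $ q) / det (A x))
        \<in> borel_measurable M"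
      using ent by (intro borel_measurable_divide det) (auto intro: det)
    then show "(\<lambda>x. cof (A x) $ k $ i) \<in> borel_measurable M" by (simp add: cof_def)
  qed
  moreover have "(\<lambda>x. det (A x)) \<in> borel_measurable M" by (intro det ent)
  then have "{x \<in> space M. det (A x) = 0} \<in> sets M"
    using measurable_sets[of "\<lambda>x. det (A x)" M borel "{0}"]
    by (simp add: vimage_def Int_def conj_commute)
  ultimately have "(\<lambda>x. if det (A x) = 0 then c else cof (A x)) \<in> borel_measurable M"
    by (intro measurable_If) auto
  moreover have "(if det B = 0 then c else cof B) = matrix_inv B" for B
  proof (cases "det B = 0")
    case True
    then have "\<not> invertible B" by (simp add: invertible_det_nz)
    then have "(\<lambda>B'. B ** B' = mat 1 \<and> B' ** B = mat 1) = (\<lambda>_. False)"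
      by (auto simp: invertible_def)
    then show ?thesis using True by (simp add: matrix_inv_def c_def)
  next
    case False
    then have inv: "invertible B" by (simp add: invertible_det_nz)
    have "matrix_inv B $ k $ i = cof B $ k $ i" for k i
    proof -
      have "B *v (matrix_inv B *v axis i 1) = axis i 1" by (rule matrix_inv_vector[OF inv])
      then have "matrix_inv B *v axis i 1
          = (\<chi> k. det (\<chi> p q. if q = k then axis i 1 $ p else B $ p $ q) / det B)"
        using cramer[OF False] by blast
      then have "(matrix_inv B *v axis i 1) $ k = det (\<chi> p q. if q = k then axis i 1 $ p else B $ p $ q) / det B"
        by simp
      also have "(matrix_inv B *v axis i 1) $ k = matrix_inv B $ k $ i"
        by (simp add: matrix_vector_mult_def axis_def if_distrib cong: if_cong)
      also have "(\<chi> p q. if q = k then axis i 1 $ p else B $ p $ q)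
          = (\<chi> p q. if q = k then (if p = i then 1 else 0) else B $ p $ q)"
        by (simp add: vec_eq_iff axis_def)
      finally show ?thesis by (simp add: cof_def)
    qed
    then show ?thesis using False by (simp add: vec_eq_iff)
  qed
  ultimately show ?thesis by simp
qed

text \<open>Lets Hermitian forms be estimated by the Euclidean inner product of the underlying real
  space.\<close>

lemma Re_cdot: "Re (cdot v w) = v \<bullet> w"
  by (simp add: cdot_def inner_vec_def inner_complex_def)

lemma cdot_scale: "cdot (c *s v) (d *s w) = cnj c * d * cdot v w"
  by (simp add: cdot_def sum_distrib_left algebra_simps)

lemma cdot_adjoint: "cdot v (A *v w) = cdot (cmat_adjoint A *v v) w"
proof -
  have "cdot v (A *v w) = (\<Sum>i\<in>UNIV. \<Sum>j\<in>UNIV. cnj (v $ i) * (A $ i $ j * w $ j))"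
    by (simp add: cdot_def matrix_vector_mult_def sum_distrib_left)
  also have "\<dots> = (\<Sum>j\<in>UNIV. \<Sum>i\<in>UNIV. cnj (v $ i) * (A $ i $ j * w $ j))"
    by (rule sum.swap)
  also have "\<dots> = cdot (cmat_adjoint A *v v) w"
    by (simp add: cdot_def matrix_vector_mult_def cmat_adjoint_def sum_distrib_right sum_distrib_left
        algebra_simps)
  finally show ?thesis .
qed

lemma cdot_commute: "cdot w v = cnj (cdot v w)"
  by (simp add: cdot_def mult.commute)

subsection \<open>Block vectors\<close>

lemma pos_less: "pos (i :: 'N::{finite,linorder}) < CARD('N)"
  unfolding pos_def by (intro psubset_card_mono) auto

lemma pos_strict_mono: "i < j \<Longrightarrow> pos (i :: 'N::{finite,linorder}) < pos j"
  unfolding pos_def by (intro psubset_card_mono) auto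

lemma inj_pos: "inj (pos :: 'N::{finite,linorder} \<Rightarrow> nat)"
  by (rule linorder_injI) (metis pos_strict_mono less_irrefl)

lemma bij_betw_pos: "bij_betw (pos :: 'N::{finite,linorder} \<Rightarrow> nat) UNIV {..<CARD('N)}"
proof -
  have "range (pos :: 'N \<Rightarrow> nat) = {..<CARD('N)}"
    by (rule card_subset_eq) (auto simp: pos_less card_image inj_pos)
  then show ?thesis using inj_pos by (simp add: bij_betw_def)
qed

text \<open>Inverse of \<open>pos\<close>, unspecified from \<open>CARD('N)\<close> on; hence the
  range conditions in the block lemmas.\<close>

definition idx :: "nat \<Rightarrow> 'N::{finite,linorder}" where "idx k = inv_into UNIV pos k"

lemma idx_pos [simp]: "idx (pos i) = i"
  by (simp add: idx_def inj_pos)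

lemma pos_idx: "k < CARD('N) \<Longrightarrow> pos (idx k :: 'N::{finite,linorder}) = k"
  using bij_betw_pos unfolding idx_def bij_betw_def by (metis f_inv_into_f lessThan_iff)

definition block :: "nat \<Rightarrow> 'a ^ ('N::{finite,linorder} \<times> 'n::finite) \<Rightarrow> 'a ^ 'n" where
  "block k v = (\<chi> i. v $ (idx k, i))"

definition unblock :: "(nat \<Rightarrow> 'a ^ 'n) \<Rightarrow> 'a ^ ('N::{finite,linorder} \<times> 'n::finite)" where
  "unblock g = (\<chi> r. g (pos (fst r)) $ snd r)"

lemma block_unblock: "k < CARD('N) \<Longrightarrow> block k (unblock g :: 'a ^ ('N::{finite,linorder} \<times> 'n::finite)) = g k"
  by (simp add: block_def unblock_def vec_eq_iff pos_idx)

lemma block_eqI: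
  fixes v w :: "'a ^ ('N::{finite,linorder} \<times> 'n::finite)"
  assumes "\<And>k. k < CARD('N) \<Longrightarrow> block k v = block k w" shows "v = w"
proof -
  have "v $ (j, i) = w $ (j, i)" for j i
    using assms[OF pos_less[of j]] by (simp add: block_def vec_eq_iff)
  then show ?thesis by (simp add: vec_eq_iff split_paired_all)
qed

lemma bounded_linear_block:
  "bounded_linear (block k :: complex ^ ('N::{finite,linorder} \<times> 'n::finite) \<Rightarrow> complex ^ 'n)"
  by (rule linear_conv_bounded_linear[THEN iffD1], rule linearI) (auto simp: block_def vec_eq_iff)

lemma block_add: "block k (v + w) = block k v + block k w"
  by (simp add: block_def vec_eq_iff)

lemma block_zero [simp]: "block k 0 = 0"
  by (simp add: block_def vec_eq_iff)

definition emb :: "nat \<Rightarrow> complex ^ 'n \<Rightarrow> complex ^ ('N::{finite,linorder} \<times> 'n::finite)" where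
  "emb k y = (\<chi> r. if pos (fst r) = k then y $ snd r else 0)"

lemma bounded_linear_emb:
  "bounded_linear (emb k :: complex ^ 'n \<Rightarrow> complex ^ ('N::{finite,linorder} \<times> 'n::finite))"
  by (rule linear_conv_bounded_linear[THEN iffD1], rule linearI) (auto simp: emb_def vec_eq_iff)

lemma block_emb: "p < CARD('N) \<Longrightarrow>
    block p (emb k y :: complex ^ ('N::{finite,linorder} \<times> 'n::finite)) = (if p = k then y else 0)"
  by (simp add: block_def emb_def vec_eq_iff pos_idx)

lemma unblock_sum_emb:
  "(unblock g :: complex ^ ('N::{finite,linorder} \<times> 'n::finite)) = (\<Sum>k<CARD('N). emb k (g k))"
  by (auto simp: vec_eq_iff unblock_def emb_def pos_less if_distrib if_distribR cong: if_cong)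

lemma block_block_matrix:
  fixes v :: "complex ^ ('N::{finite,linorder} \<times> 'n::finite)"
  assumes "p < CARD('N)"
  shows "block p (block_matrix B *v v) = (\<Sum>k<CARD('N). B p k *v block k v)"
proof -
  have "block p (block_matrix B *v v) $ i = (\<Sum>k<CARD('N). B p k *v block k v) $ i" for i
  proof -
    have "block p (block_matrix B *v v) $ i
        = (\<Sum>c\<in>UNIV. B p (pos (fst c)) $ i $ snd c * v $ c)"
      using assms by (simp add: block_def block_matrix_def matrix_vector_mult_def pos_idx)
    also have "\<dots> = (\<Sum>l\<in>(UNIV :: 'N set). \<Sum>j\<in>UNIV. B p (pos l) $ i $ j * v $ (l, j))"
      by (simp add: sum.cartesian_product split_beta flip: UNIV_Times_UNIV)
    also have "\<dots> = (\<Sum>l\<in>(UNIV :: 'N set). (B p (pos l) *v block (pos l) v) $ i)"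
      by (simp add: matrix_vector_mult_def block_def)
    also have "\<dots> = (\<Sum>k<CARD('N). (B p k *v block k v) $ i)"
      using bij_betw_pos by (rule sum.reindex_bij_betw)
    finally show ?thesis by simp
  qed
  then show ?thesis by (simp add: vec_eq_iff)
qed

lemma cdot_block:
  "cdot v w = (\<Sum>k<CARD('N). cdot (block k v) (block k w))"
  for v w :: "complex ^ ('N::{finite,linorder} \<times> 'n::finite)"
proof -
  have "cdot v w = (\<Sum>l\<in>(UNIV :: 'N set). \<Sum>i\<in>UNIV. cnj (v $ (l, i)) * w $ (l, i))"
    unfolding cdot_def by (simp add: sum.cartesian_product split_beta flip: UNIV_Times_UNIV)
  also have "\<dots> = (\<Sum>l\<in>(UNIV :: 'N set). cdot (block (pos l) v) (block (pos l) w))"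
    by (simp add: cdot_def block_def)
  also have "\<dots> = (\<Sum>k<CARD('N). cdot (block k v) (block k w))"
    using bij_betw_pos by (rule sum.reindex_bij_betw)
  finally show ?thesis .
qed

subsection \<open>Weak derivatives\<close>

lemma sobolev_derivs_continuous:
  assumes "sobolev_derivs a b N u g" "k < N" shows "continuous_on {a..b} (g k)"
proof (cases "a \<le> b")
  case True
  have int: "(g (Suc k) has_integral (g k t - g k a)) {a..t}" if "t \<in> {a..b}" for t
    using assms that by (simp add: sobolev_derivs_def)
  have "continuous_on {a..b} (\<lambda>t. g k a + integral {a..t} (g (Suc k)))"
    using int[of b] True by (intro continuous_intros indefinite_integral_continuous_1) auto
  then show ?thesis
    by (rule continuous_on_eq) (simp add: integral_unique[OF int])
qed simp

text \<open>By induction on the order: continuity turns equality almost everywhere into equality at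
  every point, and then the difference of the next derivatives has vanishing indefinite integral. It
  makes the choice in \<open>sobolev_deriv\<close> harmless.\<close>

lemma sobolev_derivs_unique:
  assumes "a < b" and g: "sobolev_derivs a b N u g" and g': "sobolev_derivs a b N u g'"
  shows "\<And>k t. k < N \<Longrightarrow> t \<in> {a..b} \<Longrightarrow> g k t = g' k t"
    and "\<And>k. k \<le> N \<Longrightarrow> ae_eq a b (g k) (g' k)"
proof -
  have ae: "ae_eq a b (g k) (g' k)" if "k \<le> N" for k
    using that
  proof (induction k)
    case 0
    have "ae_eq a b (g 0) u" "ae_eq a b (g' 0) u" using g g' by (auto simp: sobolev_derivs_def)
    then show ?case unfolding ae_eq_def by eventually_elim simp
  next
    case (Suc k)
    then have ae: "AE \<zeta> in lebesgue_on {a<..<b}. g k \<zeta> - g' k \<zeta> = 0"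
      by (simp add: ae_eq_def)
    have "continuous_on {a..b} (\<lambda>\<zeta>. g k \<zeta> - g' k \<zeta>)"
      using Suc.prems by (intro continuous_intros sobolev_derivs_continuous[OF g]
          sobolev_derivs_continuous[OF g']) auto
    then have eq: "g k t - g' k t = 0" if "t \<in> {a..b}" for t
      by (rule ae_continuous_zero[OF \<open>a < b\<close> _ ae that])
    have "AE \<zeta> in lebesgue_on {a<..<b}. g (Suc k) \<zeta> + (-1) *\<^sub>R g' (Suc k) \<zeta> = 0"
    proof (rule zero_indefinite_integral[OF _ _ \<open>a < b\<close>])
      show "(\<lambda>\<zeta>. g (Suc k) \<zeta> + (-1) *\<^sub>R g' (Suc k) \<zeta>) \<in> L2 a b"
        using g g' Suc.prems by (intro L2_add L2_scaleR) (auto simp: sobolev_derivs_def)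
      fix t assume t: "t \<in> {a..b}"
      have "((\<lambda>\<zeta>. g (Suc k) \<zeta> - g' (Suc k) \<zeta>) has_integral (g k t - g k a) - (g' k t - g' k a)) {a..t}"
        using g g' Suc.prems t by (intro has_integral_diff) (auto simp: sobolev_derivs_def)
      moreover have "(g k t - g k a) - (g' k t - g' k a) = 0"
        using eq[OF t] eq[of a] \<open>a < b\<close> by (simp add: algebra_simps)
      ultimately show "((\<lambda>\<zeta>. g (Suc k) \<zeta> + (-1) *\<^sub>R g' (Suc k) \<zeta>) has_integral 0) {a..t}"
        by simp
    qed
    then show ?case by (simp add: ae_eq_def)
  qed
  then show "ae_eq a b (g k) (g' k)" if "k \<le> N" for k using that .
  show "g k t = g' k t" if k: "k < N" and t: "t \<in> {a..b}" for k t
  proof -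
    have "AE \<zeta> in lebesgue_on {a<..<b}. g k \<zeta> - g' k \<zeta> = 0"
      using ae[of k] k by (simp add: ae_eq_def)
    moreover have "continuous_on {a..b} (\<lambda>\<zeta>. g k \<zeta> - g' k \<zeta>)"
      using k by (intro continuous_intros sobolev_derivs_continuous[OF g] sobolev_derivs_continuous[OF g'])
    ultimately have "g k t - g' k t = 0" using ae_continuous_zero[OF \<open>a < b\<close>] t by blast
    then show ?thesis by simp
  qed
qed

lemma sobolev_deriv_works:
  "u \<in> Sobolev a b N \<Longrightarrow> sobolev_derivs a b N u (sobolev_deriv a b N u)"
  using someI_ex[of "sobolev_derivs a b N u"] by (simp add: Sobolev_def sobolev_deriv_def)

lemma L2_zero: "(\<lambda>_. 0) \<in> L2 a b"
  by (simp add: L2_def)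

lemma L2_sum:
  fixes f :: "'i \<Rightarrow> real \<Rightarrow> 'a::euclidean_space"
  assumes "\<And>i. i \<in> I \<Longrightarrow> f i \<in> L2 a b" shows "(\<lambda>\<zeta>. \<Sum>i\<in>I. f i \<zeta>) \<in> L2 a b"
  using assms by (induction I rule: infinite_finite_induct) (auto simp: L2_zero L2_add)

lemma borel_measurable_matrix_vector_mult:
  fixes A :: "'x \<Rightarrow> complex ^ 'c ^ 'r"
  assumes "A \<in> borel_measurable M" "x \<in> borel_measurable M"
  shows "(\<lambda>s. A s *v x s) \<in> borel_measurable M"
  using assms by (rule borel_measurable_continuous_Pair)
    (intro bounded_bilinear.continuous_on[OF bounded_bilinear_matrix_vector_mult] continuous_intros)

lemma bounded_linear_matrix_vector: "bounded_linear ((*v) A)" for A :: "complex ^ 'c ^ 'r"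
  by (rule bounded_bilinear.bounded_linear_right[OF bounded_bilinear_matrix_vector_mult])

lemma bounded_linear_vector_scale: "bounded_linear (\<lambda>x :: complex ^ 'k. c *s x)"
  by (rule linear_conv_bounded_linear[THEN iffD1], rule linearI)
    (auto simp: vec_eq_iff algebra_simps)

definition vpair :: "'a ^ 'r \<Rightarrow> 'a ^ 's \<Rightarrow> 'a ^ ('r + 's)" where
  "vpair v w = (\<chi> r. case r of Inl i \<Rightarrow> v $ i | Inr i \<Rightarrow> w $ i)"

lemma vstack_mult: "vstack A B *v x = vpair (A *v x) (B *v x)" for x :: "complex ^ 'c"
  by (auto simp: vstack_def vpair_def matrix_vector_mult_def vec_eq_iff split: sum.split)

subsection \<open>The eigenvalue problem as a first-order system\<close>

text \<open>The operator is a parameter because its type does not mention \<open>'N\<close>.\<close>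

locale port_hamiltonian =
  fixes a b m :: real
    and P :: "nat \<Rightarrow> complex ^ 'n ^ 'n"
    and \<H> :: "real \<Rightarrow> complex ^ 'n ^ 'n"
    and W :: "complex ^ (('N::{finite,linorder} \<times> 'n) + ('N \<times> 'n)) ^ ('N \<times> 'n)"
    and A :: "(real \<Rightarrow> complex ^ 'n) \<Rightarrow> real \<Rightarrow> complex ^ 'n"
  assumes ab: "a < b"
    and A_def: "A = phs_op a b CARD('N) P \<H>"
    and P_adjoint: "\<And>k. k \<le> CARD('N) \<Longrightarrow> cmat_adjoint (P k) = (-1) ^ (k + 1) *\<^sub>R P k"
    and P_invertible: "invertible (P CARD('N))"
    and H_measurable: "\<H> \<in> borel_measurable (lebesgue_on {a<..<b})"
    and H_bounded: "bounded (\<H> ` {a<..<b})"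
    and m_pos: "0 < m"
    and H_coercive: "AE \<zeta> in lebesgue_on {a<..<b}. cmat_adjoint (\<H> \<zeta>) = \<H> \<zeta> \<and>
           (\<forall>v. Re (cdot v (\<H> \<zeta> *v v)) \<ge> m * (norm v)\<^sup>2)"
begin

text \<open>Fixes the block type, which the arguments of \<open>companion\<close> do not
  determine.\<close>

definition comp :: "complex \<Rightarrow> real \<Rightarrow> complex ^ ('N \<times> 'n) ^ ('N \<times> 'n)" where
  "comp \<mu> \<zeta> = companion P \<H> \<mu> \<zeta>"

text \<open>In the first-order system for \<open>A x = \<mu> x + y\<close> the inhomogeneity appears
  only in the last block, where the equation is solved for the derivative of order
  \<open>CARD('N)\<close>.\<close>

definition forcing :: "complex ^ 'n \<Rightarrow> complex ^ ('N \<times> 'n)" where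
  "forcing y = emb (CARD('N) - 1) (matrix_inv (P CARD('N)) *v y)"

text \<open>Block 0 of a trajectory represents \<open>\<H> x\<close>; this recovers
  \<open>x\<close>.\<close>

definition state :: "(real \<Rightarrow> complex ^ ('N \<times> 'n)) \<Rightarrow> real \<Rightarrow> complex ^ 'n" where
  "state v \<zeta> = matrix_inv (\<H> \<zeta>) *v block 0 (v \<zeta>)"

text \<open>Coercivity and the Cauchy-Schwarz inequality give
  \<open>m * norm v \<le> norm (\<H> \<zeta> *v v)\<close>, which yields both injectivity and the
  bound for the inverse.\<close>

lemma H_inverse:
  "AE \<zeta> in lebesgue_on {a<..<b}. invertible (\<H> \<zeta>) \<and> (\<forall>u. norm (matrix_inv (\<H> \<zeta>) *v u) \<le> 1 / m * norm u)"
  using H_coercive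
proof eventually_elim
  case (elim \<zeta>)
  have le: "m * norm v \<le> norm (\<H> \<zeta> *v v)" for v
  proof (cases "v = 0")
    case False
    have "m * (norm v)\<^sup>2 \<le> v \<bullet> (\<H> \<zeta> *v v)" using elim by (simp add: Re_cdot)
    also have "\<dots> \<le> norm v * norm (\<H> \<zeta> *v v)" by (rule norm_cauchy_schwarz)
    finally have "norm v * (m * norm v) \<le> norm v * norm (\<H> \<zeta> *v v)"
      by (simp add: power2_eq_square algebra_simps)
    then show ?thesis using False by simp
  qed simp
  have "v = 0" if "\<H> \<zeta> *v v = 0" for v
  proof -
    have "m * norm v \<le> 0" using le[of v] that by simp
    then show ?thesis using m_pos by (simp add: mult_le_0_iff)
  qed
  then have inv: "invertible (\<H> \<zeta>)"
    by (simp add: invertible_left_inverse matrix_left_invertible_ker)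
  have "norm (matrix_inv (\<H> \<zeta>) *v u) \<le> 1 / m * norm u" for u
    using le[of "matrix_inv (\<H> \<zeta>) *v u"] m_pos by (simp add: matrix_inv_vector[OF inv] field_simps)
  with inv show ?case by blast
qed

lemma L2_H_inverse:
  assumes "u \<in> L2 a b" shows "(\<lambda>\<zeta>. matrix_inv (\<H> \<zeta>) *v u \<zeta>) \<in> L2 a b"
proof (rule L2_dominated[OF _ assms])
  show "(\<lambda>\<zeta>. matrix_inv (\<H> \<zeta>) *v u \<zeta>) \<in> borel_measurable (lebesgue_on {a<..<b})"
    using assms by (intro borel_measurable_matrix_vector_mult borel_measurable_matrix_inv H_measurable)
      (simp add: L2_def)
  show "AE \<zeta> in lebesgue_on {a<..<b}. norm (matrix_inv (\<H> \<zeta>) *v u \<zeta>) \<le> 1 / m * norm (u \<zeta>)"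
    using H_inverse by eventually_elim blast
qed

lemma H_mult_bound: "\<exists>C. \<forall>\<zeta>\<in>{a<..<b}. \<forall>v. norm (\<H> \<zeta> *v v) \<le> C * norm v"
proof -
  obtain B where B: "\<forall>\<zeta>\<in>{a<..<b}. norm (\<H> \<zeta>) \<le> B"
    using H_bounded by (auto simp: bounded_iff)
  obtain K where K: "0 < K" "\<And>A :: complex ^ 'n ^ 'n. \<And>v. norm (A *v v) \<le> norm A * norm v * K"
    using bounded_bilinear.pos_bounded[OF bounded_bilinear_matrix_vector_mult] by blast
  have "norm (\<H> \<zeta> *v v) \<le> (B * K) * norm v" if "\<zeta> \<in> {a<..<b}" for \<zeta> v
  proof -
    have "norm (\<H> \<zeta>) * norm v * K \<le> B * norm v * K"
      using B that K(1) by (intro mult_right_mono) auto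
    then show ?thesis using K(2)[of "\<H> \<zeta>" v] by (simp add: mult_ac)
  qed
  then show ?thesis by blast
qed

lemma L2_H:
  assumes "u \<in> L2 a b" shows "(\<lambda>\<zeta>. \<H> \<zeta> *v u \<zeta>) \<in> L2 a b"
proof -
  obtain C where C: "\<forall>\<zeta>\<in>{a<..<b}. \<forall>v. norm (\<H> \<zeta> *v v) \<le> C * norm v" using H_mult_bound by blast
  show ?thesis
  proof (rule L2_dominated[OF borel_measurable_matrix_vector_mult[OF H_measurable] assms])
    show "u \<in> borel_measurable (lebesgue_on {a<..<b})" using assms by (simp add: L2_def)
    show "AE \<zeta> in lebesgue_on {a<..<b}. norm (\<H> \<zeta> *v u \<zeta>) \<le> C * norm (u \<zeta>)"
      using C by (intro AE_I2) simp
  qed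
qed

lemma R_works: "P CARD('N) *v (matrix_inv (P CARD('N)) *v y) = y" "matrix_inv (P CARD('N)) *v (P CARD('N) *v y) = y"
  by (simp_all add: matrix_inv_vector[OF P_invertible])

lemma bounded_linear_forcing: "bounded_linear forcing"
  unfolding forcing_def
  by (rule bounded_linear_compose[OF bounded_linear_emb bounded_linear_matrix_vector])

lemma forcing_zero: "forcing 0 = 0"
  by (rule linear_0[OF bounded_linear.linear[OF bounded_linear_forcing]])

lemma forcing_diff: "forcing (x - y) = forcing x - forcing y"
  by (rule linear_diff[OF bounded_linear.linear[OF bounded_linear_forcing]])

lemma block_forcing: "p < CARD('N) \<Longrightarrow> block p (forcing y) = (if p + 1 < CARD('N) then 0 else matrix_inv (P CARD('N)) *v y)"
  by (auto simp: forcing_def block_emb)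

lemma block_comp:
  assumes p: "p < CARD('N)"
  shows "block p (comp \<mu> \<zeta> *v v) = (if p + 1 < CARD('N) then block (p + 1) v
    else matrix_inv (P CARD('N)) *v (\<mu> *s (matrix_inv (\<H> \<zeta>) *v block 0 v) - (\<Sum>k<CARD('N). P k *v block k v)))"
proof -
  have mat_mult: "(mat \<mu> :: complex ^ 'n ^ 'n) *v y = \<mu> *s y" for y
    by (simp add: matrix_vector_mult_def mat_def vec_eq_iff if_distrib if_distribR cong: if_cong)
  have neg: "(- A) *v y = - (A *v y)" for A :: "complex ^ 'n ^ 'n" and y
    by (simp add: matrix_vector_mult_def vec_eq_iff sum_negf)
  have R_scale: "matrix_inv (P CARD('N)) *v (\<mu> *s y) = \<mu> *s (matrix_inv (P CARD('N)) *v y)" for y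
    by (simp add: matrix_vector_mult_def vec_eq_iff sum_distrib_left algebra_simps)
  show ?thesis
  proof (cases "p + 1 < CARD('N)")
    case True
    have "block p (comp \<mu> \<zeta> *v v) = (\<Sum>k<CARD('N). (if k = p + 1 then mat 1 else 0) *v block k v)"
      using True p by (simp add: comp_def companion_def Let_def block_block_matrix)
    also have "\<dots> = (\<Sum>k<CARD('N). if k = p + 1 then block k v else 0)"
      by (intro sum.cong) auto
    finally show ?thesis using True by simp
  next
    case False
    have "block p (comp \<mu> \<zeta> *v v) = (\<Sum>k<CARD('N). (if k = 0 then mat \<mu> ** matrix_inv (P CARD('N)) ** matrix_inv (\<H> \<zeta>) - matrix_inv (P CARD('N)) ** P 0
        else - (matrix_inv (P CARD('N)) ** P k)) *v block k v)"
      using False p by (simp add: comp_def companion_def Let_def block_block_matrix)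
    also have "\<dots> = (\<Sum>k<CARD('N). (if k = 0 then \<mu> *s (matrix_inv (P CARD('N)) *v (matrix_inv (\<H> \<zeta>) *v block 0 v)) else 0)
        - matrix_inv (P CARD('N)) *v (P k *v block k v))"
      by (intro sum.cong refl)
        (simp add: matrix_vector_mult_diff_rdistrib mat_mult neg flip: matrix_vector_mul_assoc)
    also have "\<dots> = \<mu> *s (matrix_inv (P CARD('N)) *v (matrix_inv (\<H> \<zeta>) *v block 0 v)) - matrix_inv (P CARD('N)) *v (\<Sum>k<CARD('N). P k *v block k v)"
      by (simp add: sum_subtractf vec.sum)
    finally show ?thesis using False by (simp add: matrix_vector_mult_diff_distrib R_scale)
  qed
qed

text \<open>Splits off the only part depending on \<open>\<zeta>\<close>, which passes through the
  inverse of \<open>\<H>\<close>. For \<mu> = 0 that part vanishes, so the point 0 in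
  \<open>comp 0 0\<close> is arbitrary.\<close>

lemma comp_eq: "comp \<mu> \<zeta> *v v = comp 0 0 *v v + forcing (\<mu> *s (matrix_inv (\<H> \<zeta>) *v block 0 v))"
  by (rule block_eqI) (simp add: block_add block_comp block_forcing matrix_vector_mult_diff_distrib vec.neg)

lemma comp_bound:
  "\<exists>K\<ge>0. AE \<zeta> in lebesgue_on {a<..<b}. \<forall>v. norm (comp \<mu> \<zeta> *v v) \<le> K * norm v"
proof -
  obtain K1 where K1: "0 \<le> K1" "\<And>v. norm (comp 0 0 *v v) \<le> K1 * norm v"
    using bounded_linear.nonneg_bounded[OF bounded_linear_matrix_vector, of "comp 0 0"] by (auto simp: mult.commute)
  have lin: "bounded_linear (\<lambda>y. forcing (\<mu> *s y))"
    by (rule bounded_linear_compose[OF bounded_linear_forcing bounded_linear_vector_scale])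
  obtain K2 where K2: "0 \<le> K2" "\<And>y. norm (forcing (\<mu> *s y)) \<le> K2 * norm y"
    using bounded_linear.nonneg_bounded[OF lin] by (auto simp: mult.commute)
  obtain K3 where K3: "0 \<le> K3" "\<And>v :: complex ^ ('N \<times> 'n). norm (block 0 v) \<le> K3 * norm v"
    using bounded_linear.nonneg_bounded[OF bounded_linear_block, of 0] by (auto simp: mult.commute)
  have "AE \<zeta> in lebesgue_on {a<..<b}. \<forall>v. norm (comp \<mu> \<zeta> *v v) \<le> (K1 + K2 * (1 / m * K3)) * norm v"
    using H_inverse
  proof eventually_elim
    case (elim \<zeta>)
    show ?case
    proof
      fix v :: "complex ^ ('N \<times> 'n)"
      have "norm (forcing (\<mu> *s (matrix_inv (\<H> \<zeta>) *v block 0 v))) \<le> K2 * norm (matrix_inv (\<H> \<zeta>) *v block 0 v)"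
        by (rule K2)
      also have "\<dots> \<le> K2 * (1 / m * norm (block 0 v))" using elim K2(1) by (intro mult_left_mono) auto
      also have "\<dots> \<le> K2 * (1 / m * (K3 * norm v))" using K2(1) K3(2) m_pos by (intro mult_left_mono) auto
      finally show "norm (comp \<mu> \<zeta> *v v) \<le> (K1 + K2 * (1 / m * K3)) * norm v"
        using K1(2)[of v] norm_triangle_ineq[of "comp 0 0 *v v" "forcing (\<mu> *s (matrix_inv (\<H> \<zeta>) *v block 0 v))"]
        unfolding comp_eq[of \<mu> \<zeta> v] by (simp add: algebra_simps)
    qed
  qed
  moreover have "0 \<le> K1 + K2 * (1 / m * K3)" using K1(1) K2(1) K3(1) m_pos by simp
  ultimately show ?thesis by blast
qed

lemma L2_comp:
  assumes "continuous_on {a..b} v" shows "(\<lambda>\<zeta>. comp \<mu> \<zeta> *v v \<zeta>) \<in> L2 a b"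
  unfolding comp_eq[of \<mu>]
  by (intro L2_add L2_linear[OF bounded_linear_matrix_vector] L2_linear[OF bounded_linear_forcing]
      L2_linear[OF bounded_linear_vector_scale] L2_H_inverse L2_linear[OF bounded_linear_block]
      L2_continuous assms)

text \<open>The system in integrated form (a Caratheodory solution), since \<open>\<H>\<close> is
  only measurable. The initial value is left free.\<close>

definition solves :: "complex \<Rightarrow> (real \<Rightarrow> complex ^ 'n) \<Rightarrow> (real \<Rightarrow> complex ^ ('N \<times> 'n)) \<Rightarrow> bool" where
  "solves \<mu> f v \<longleftrightarrow> continuous_on {a..b} v \<and>
    (\<forall>t\<in>{a..b}. ((\<lambda>s. comp \<mu> s *v v s + forcing (f s)) has_integral (v t - v a)) {a..t})"

lemma solves_exists:
  assumes "f \<in> L2 a b" shows "\<exists>v. solves \<mu> f v \<and> v a = c"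
proof -
  obtain K where K: "0 \<le> K" "AE \<zeta> in lebesgue_on {a<..<b}. \<forall>v. norm (comp \<mu> \<zeta> *v v) \<le> K * norm v"
    using comp_bound by blast
  obtain S where S: "negligible S"
    "\<And>\<zeta>. \<zeta> \<in> {a..b} - S \<Longrightarrow> \<forall>v. norm (comp \<mu> \<zeta> *v v) \<le> K * norm v"
    by (rule ae_eq_negligible[OF K(2)]) (rule that)
  \<comment> \<open>Picard iteration asks for the Lipschitz bound at every point, while
    \<open>comp\<close> satisfies it only outside a null set.\<close>
  define G where "G s v = (if s \<in> S then 0 else comp \<mu> s *v v + forcing (f s))" for s v
  have "\<exists>v. continuous_on {a..b} v \<and> (\<forall>t\<in>{a..b}. ((\<lambda>s. G s (v s)) has_integral (v t - c)) {a..t})"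
  proof (rule integral_equation_solution[OF _ K(1)])
    show "a \<le> b" using ab by simp
    show "(\<lambda>s. G s (v s)) integrable_on {a..b}" if "continuous_on {a..b} v" for v
    proof -
      have "(\<lambda>s. comp \<mu> s *v v s + forcing (f s)) \<in> L2 a b"
        by (intro L2_add L2_comp that L2_linear[OF bounded_linear_forcing] assms)
      then have "(\<lambda>s. comp \<mu> s *v v s + forcing (f s)) integrable_on {a..b}"
        using L2_absolutely_integrable absolutely_integrable_on_def by blast
      then show ?thesis by (rule integrable_spike[OF _ S(1)]) (simp add: G_def)
    qed
    show "norm (G s v - G s w) \<le> K * norm (v - w)" if "s \<in> {a..b}" for s v w
      using S(2)[of s, THEN spec, of "v - w"] that K(1) by (simp add: G_def matrix_vector_mult_diff_distrib)
  qed
  then obtain v where v: "continuous_on {a..b} v"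
    "\<And>t. t \<in> {a..b} \<Longrightarrow> ((\<lambda>s. G s (v s)) has_integral (v t - c)) {a..t}" by blast
  \<comment> \<open>At \<open>t = a\<close> the interval is a single point, so the equation yields
    the initial value.\<close>
  have "((\<lambda>s. G s (v s)) has_integral (v a - c)) {a}" using v(2)[of a] ab by simp
  then have "v a - c = 0" using has_integral_refl(2) by (rule has_integral_unique)
  then have va: "v a = c" by simp
  have "((\<lambda>s. comp \<mu> s *v v s + forcing (f s)) has_integral (v t - v a)) {a..t}" if "t \<in> {a..b}" for t
    by (rule has_integral_spike[OF S(1) _ v(2)[OF that, folded va]]) (simp add: G_def)
  then show ?thesis using v(1) va by (auto simp: solves_def)
qed

lemma solves_diff:
  assumes "solves \<mu> f v" "solves \<mu> g w"
  shows "solves \<mu> (\<lambda>s. f s - g s) (\<lambda>s. v s - w s)"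
  unfolding solves_def
proof (intro conjI ballI)
  show "continuous_on {a..b} (\<lambda>s. v s - w s)"
    using assms by (intro continuous_intros) (auto simp: solves_def)
  fix t assume "t \<in> {a..b}"
  then have "((\<lambda>s. (comp \<mu> s *v v s + forcing (f s)) - (comp \<mu> s *v w s + forcing (g s)))
      has_integral (v t - v a) - (w t - w a)) {a..t}"
    using assms by (intro has_integral_diff) (auto simp: solves_def)
  then show "((\<lambda>s. comp \<mu> s *v (v s - w s) + forcing (f s - g s)) has_integral (v t - w t - (v a - w a))) {a..t}"
    by (simp add: matrix_vector_mult_diff_distrib algebra_simps
        forcing_diff)
qed

lemma solves_bound:
  "\<exists>C\<ge>0. \<forall>f v t. f \<in> L2 a b \<longrightarrow> solves \<mu> f v \<longrightarrow> t \<in> {a..b} \<longrightarrow>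
     norm (v t) \<le> C * (norm (v a) + integral {a..b} (\<lambda>s. norm (forcing (f s))))"
proof -
  obtain K where K: "0 \<le> K" "AE \<zeta> in lebesgue_on {a<..<b}. \<forall>v. norm (comp \<mu> \<zeta> *v v) \<le> K * norm v"
    using comp_bound by blast
  have "norm (v t) \<le> exp (K * (b - a)) * (norm (v a) + integral {a..b} (\<lambda>s. norm (forcing (f s))))"
    if f: "f \<in> L2 a b" and v: "solves \<mu> f v" and t: "t \<in> {a..b}" for f v t
  proof -
    have int: "(\<lambda>s. norm (forcing (f s))) integrable_on {a..b}"
      using L2_absolutely_integrable[OF L2_linear[OF bounded_linear_forcing f]]
      by (simp add: absolutely_integrable_on_def)
    have le: "AE s in lebesgue_on {a<..<b}. norm (comp \<mu> s *v v s + forcing (f s))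
        \<le> K * norm (v s) + norm (forcing (f s))"
      using K(2)
    proof eventually_elim
      case (elim s)
      then show ?case
        using norm_triangle_ineq[of "comp \<mu> s *v v s" "forcing (f s)"] by (meson add_right_mono order_trans)
    qed
    have "norm (v t) \<le> (norm (v a) + integral {a..b} (\<lambda>s. norm (forcing (f s)))) * exp (K * (t - a))"
      using v by (intro integral_equation_bound[OF _ K(1) _ le int _ t]) (auto simp: solves_def)
    also have "\<dots> \<le> (norm (v a) + integral {a..b} (\<lambda>s. norm (forcing (f s)))) * exp (K * (b - a))"
    proof (rule mult_left_mono)
      show "exp (K * (t - a)) \<le> exp (K * (b - a))" using t K(1) by (simp add: mult_left_mono)
      show "0 \<le> norm (v a) + integral {a..b} (\<lambda>s. norm (forcing (f s)))"
        using int by (intro add_nonneg_nonneg Henstock_Kurzweil_Integration.integral_nonneg) auto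
    qed
    finally show ?thesis by (simp add: mult.commute)
  qed
  then show ?thesis by (intro exI[of _ "exp (K * (b - a))"]) auto
qed

lemma solves_unique:
  assumes "solves \<mu> f v" "solves \<mu> f w" "v a = w a" "t \<in> {a..b}"
  shows "v t = w t"
proof -
  obtain C where C: "\<And>f v t. f \<in> L2 a b \<Longrightarrow> solves \<mu> f v \<Longrightarrow> t \<in> {a..b} \<Longrightarrow>
     norm (v t) \<le> C * (norm (v a) + integral {a..b} (\<lambda>s. norm (forcing (f s))))"
    using solves_bound[of \<mu>] by blast
  have "solves \<mu> (\<lambda>_. 0) (\<lambda>s. v s - w s)" using solves_diff[OF assms(1,2)] by simp
  from C[OF L2_zero this assms(4)] show ?thesis
    using assms(3) by (simp add: forcing_zero)
qed

text \<open>Its columns are the solutions starting at the unit vectors.\<close>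

lemma fundamental_solution_exists:
  "\<exists>\<Psi> :: real \<Rightarrow> complex ^ ('N \<times> 'n) ^ ('N \<times> 'n). is_fundamental_solution a b P \<H> \<mu> \<Psi>"
proof -
  have "\<forall>c. \<exists>v. solves \<mu> (\<lambda>_. 0) v \<and> v a = axis c 1" using solves_exists[OF L2_zero] by blast
  then obtain V where V: "\<And>c. solves \<mu> (\<lambda>_. 0) (V c)" "\<And>c. V c a = axis c 1" by metis
  \<comment> \<open>A matrix is a vector of rows, so a column is inserted through a linear map,
    along which continuity, \<open>L2\<close> and integrals are transported.\<close>
  define colemb :: "'N \<times> 'n \<Rightarrow> complex ^ ('N \<times> 'n) \<Rightarrow> complex ^ ('N \<times> 'n) ^ ('N \<times> 'n)" where
    "colemb c y = (\<chi> r c'. if c' = c then y $ r else 0)" for c y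
  have lin: "bounded_linear (colemb c)" for c
    by (rule linear_conv_bounded_linear[THEN iffD1], rule linearI) (auto simp: colemb_def vec_eq_iff)
  define \<Psi> where "\<Psi> \<zeta> = (\<Sum>c\<in>UNIV. colemb c (V c \<zeta>))" for \<zeta>
  define g where "g k = (if k = 0 then \<Psi> else (\<lambda>\<zeta>. \<Sum>c\<in>UNIV. colemb c (comp \<mu> \<zeta> *v V c \<zeta>)))" for k :: nat
  have Vc: "continuous_on {a..b} (V c)" for c using V(1) by (simp add: solves_def)
  have cont: "continuous_on {a..b} \<Psi>"
    unfolding \<Psi>_def by (intro continuous_intros bounded_linear.continuous_on[OF lin] Vc)
  have mult: "comp \<mu> \<zeta> ** \<Psi> \<zeta> = (\<Sum>c\<in>UNIV. colemb c (comp \<mu> \<zeta> *v V c \<zeta>))" for \<zeta>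
    by (simp add: \<Psi>_def colemb_def vec_eq_iff matrix_matrix_mult_def matrix_vector_mult_def
        if_distrib if_distribR cong: if_cong)
  have der: "sobolev_derivs a b 1 \<Psi> g"
    unfolding sobolev_derivs_def
  proof (intro conjI allI impI ballI)
    show "ae_eq a b (g 0) \<Psi>" by (simp add: ae_eq_def g_def)
    show "g k \<in> L2 a b" if "k \<le> 1" for k
      using L2_continuous[OF cont] L2_sum[of UNIV "\<lambda>c \<zeta>. colemb c (comp \<mu> \<zeta> *v V c \<zeta>)" a b]
        L2_linear[OF lin L2_comp[OF Vc]]
      by (simp add: g_def)
    fix k :: nat and t assume "k < 1" and t: "t \<in> {a..b}"
    have "((\<lambda>\<zeta>. \<Sum>c\<in>UNIV. colemb c (comp \<mu> \<zeta> *v V c \<zeta>)) has_integral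
        (\<Sum>c\<in>UNIV. colemb c (V c t - V c a))) {a..t}"
    proof (intro has_integral_sum)
      fix c
      have "((\<lambda>\<zeta>. comp \<mu> \<zeta> *v V c \<zeta>) has_integral (V c t - V c a)) {a..t}"
        using V(1)[of c] t by (simp add: solves_def forcing_zero)
      from has_integral_linear[OF this lin]
      show "((\<lambda>\<zeta>. colemb c (comp \<mu> \<zeta> *v V c \<zeta>)) has_integral colemb c (V c t - V c a)) {a..t}"
        by (simp add: o_def)
    qed simp
    then show "(g (Suc k) has_integral g k t - g k a) {a..t}"
      using \<open>k < 1\<close> by (simp add: g_def \<Psi>_def linear_diff[OF bounded_linear.linear[OF lin]] sum_subtractf)
  qed
  then have Sob: "\<Psi> \<in> Sobolev a b 1" by (auto simp: Sobolev_def)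
  have "ae_eq a b (sobolev_deriv a b 1 \<Psi> 1) (g 1)"
    using sobolev_derivs_unique(2)[OF ab sobolev_deriv_works[OF Sob] der, of 1] by simp
  then have "ae_eq a b (sobolev_deriv a b 1 \<Psi> 1) (\<lambda>\<zeta>. companion P \<H> \<mu> \<zeta> ** \<Psi> \<zeta>)"
    by (simp add: g_def mult[symmetric, unfolded comp_def] comp_def)
  moreover have "\<Psi> a = mat 1"
  proof -
    have "\<Psi> a $ r $ c = mat 1 $ r $ c" for r c
    proof -
      have "\<Psi> a $ r $ c = (\<Sum>c'\<in>UNIV. if c = c' then axis c' 1 $ r else 0)"
        by (simp add: \<Psi>_def V(2) colemb_def)
      also have "\<dots> = axis c 1 $ r" by simp
      finally show ?thesis by (simp add: axis_def mat_def)
    qed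
    then show ?thesis by (simp add: vec_eq_iff)
  qed
  ultimately show ?thesis using cont Sob by (auto simp: is_fundamental_solution_def)
qed

definition \<Psi> :: "complex \<Rightarrow> real \<Rightarrow> complex ^ ('N \<times> 'n) ^ ('N \<times> 'n)" where
  "\<Psi> = fundamental_solution a b P \<H>"

lemma fundamental_solution_solves: "solves \<mu> (\<lambda>_. 0) (\<lambda>\<zeta>. \<Psi> \<mu> \<zeta> *v c)" and \<Psi>_a: "\<Psi> \<mu> a = mat 1"
proof -
  have F: "is_fundamental_solution a b P \<H> \<mu> (\<Psi> \<mu>)"
    unfolding \<Psi>_def fundamental_solution_def by (rule someI_ex[OF fundamental_solution_exists])
  then show "\<Psi> \<mu> a = mat 1" by (simp add: is_fundamental_solution_def)
  define g where "g = sobolev_deriv a b 1 (\<Psi> \<mu>)"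
  have g: "sobolev_derivs a b 1 (\<Psi> \<mu>) g"
    using F sobolev_deriv_works unfolding g_def is_fundamental_solution_def by blast
  \<comment> \<open>The chosen derivative of order 0 agrees with \<open>\<Psi> \<mu>\<close> only
    almost everywhere by definition; continuity of both gives equality on the closed
    interval.\<close>
  have ae: "AE \<zeta> in lebesgue_on {a<..<b}. g 0 \<zeta> - \<Psi> \<mu> \<zeta> = 0"
    using g by (simp add: sobolev_derivs_def ae_eq_def)
  have eq: "g 0 t = \<Psi> \<mu> t" if "t \<in> {a..b}" for t
  proof -
    have "continuous_on {a..b} (\<lambda>\<zeta>. g 0 \<zeta> - \<Psi> \<mu> \<zeta>)"
      using F sobolev_derivs_continuous[OF g, of 0]
      by (intro continuous_intros) (auto simp: is_fundamental_solution_def)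
    then have "g 0 t - \<Psi> \<mu> t = 0" using ae_continuous_zero[OF ab _ ae that] by blast
    then show ?thesis by simp
  qed
  have lin: "bounded_linear (\<lambda>M :: complex ^ ('N \<times> 'n) ^ ('N \<times> 'n). M *v c)"
    by (rule bounded_bilinear.bounded_linear_left[OF bounded_bilinear_matrix_vector_mult])
  show "solves \<mu> (\<lambda>_. 0) (\<lambda>\<zeta>. \<Psi> \<mu> \<zeta> *v c)"
    unfolding solves_def
  proof (intro conjI ballI)
    show "continuous_on {a..b} (\<lambda>\<zeta>. \<Psi> \<mu> \<zeta> *v c)"
      using F by (intro bounded_linear.continuous_on[OF lin]) (simp add: is_fundamental_solution_def)
    fix t assume t: "t \<in> {a..b}"
    have "(g 1 has_integral (g 0 t - g 0 a)) {a..t}" using g t by (simp add: sobolev_derivs_def)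
    then have int: "(g 1 has_integral (\<Psi> \<mu> t - \<Psi> \<mu> a)) {a..t}" using eq t ab by simp
    have ae': "AE \<zeta> in lebesgue_on {a<..<b}. g 1 \<zeta> = comp \<mu> \<zeta> ** \<Psi> \<mu> \<zeta>"
      using F by (simp add: is_fundamental_solution_def ae_eq_def g_def comp_def)
    have "((\<lambda>\<zeta>. comp \<mu> \<zeta> ** \<Psi> \<mu> \<zeta>) has_integral (\<Psi> \<mu> t - \<Psi> \<mu> a)) {a..t}"
      by (rule has_integral_ae_cong[OF ae' t int])
    from has_integral_linear[OF this lin]
    show "((\<lambda>s. comp \<mu> s *v (\<Psi> \<mu> s *v c) + forcing 0) has_integral \<Psi> \<mu> t *v c - \<Psi> \<mu> a *v c) {a..t}"
      by (simp add: o_def forcing_zero matrix_vector_mul_assoc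
          matrix_vector_mult_diff_rdistrib)
  qed
qed

lemma solves_eq_\<Psi>:
  assumes "solves \<mu> (\<lambda>_. 0) v" "t \<in> {a..b}" shows "v t = \<Psi> \<mu> t *v v a"
  using solves_unique[OF assms(1) fundamental_solution_solves _ assms(2), of "v a"] by (simp add: \<Psi>_a)

end

section \<open>Trajectories and the boundary matrix\<close>

context port_hamiltonian
begin

definition traj :: "(real \<Rightarrow> complex ^ 'n) \<Rightarrow> real \<Rightarrow> complex ^ ('N \<times> 'n)" where
  "traj x \<zeta> = unblock (\<lambda>k. sobolev_deriv a b CARD('N) (\<lambda>\<xi>. \<H> \<xi> *v x \<xi>) k \<zeta>)"

lemma sum_le_N: "(\<Sum>k\<le>CARD('N). f k) = (\<Sum>k<CARD('N). f k) + f CARD('N)" for f :: "nat \<Rightarrow> complex ^ 'n"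
  by (simp flip: lessThan_Suc_atMost)

lemma phs_op_L2:
  assumes "(\<lambda>\<zeta>. \<H> \<zeta> *v x \<zeta>) \<in> Sobolev a b CARD('N)"
  shows "A x \<in> L2 a b"
  unfolding A_def phs_op_def using sobolev_deriv_works[OF assms]
  by (intro L2_sum L2_linear[OF bounded_linear_matrix_vector]) (simp add: sobolev_derivs_def)

lemma boundary_values_eq:
  "boundary_values a b (\<lambda>\<zeta>. \<H> \<zeta> *v x \<zeta>) = vpair (traj x b) (traj x a)"
  by (auto simp: boundary_values_def vpair_def traj_def unblock_def vec_eq_iff split: sum.split)

text \<open>Reduction of order. With an arbitrary \<mu> the residual \<open>A x - \<mu> x\<close> is
  the forcing: it is zero almost everywhere for an eigenvector, and it is \<open>A x\<close> itself
  for \<mu> = 0.\<close>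

lemma traj_solves:
  assumes x: "x \<in> L2 a b" and Sob: "(\<lambda>\<zeta>. \<H> \<zeta> *v x \<zeta>) \<in> Sobolev a b CARD('N)"
  shows "solves \<mu> (\<lambda>\<zeta>. A x \<zeta> - \<mu> *s x \<zeta>) (traj x)"
    and "ae_eq a b x (state (traj x))"
proof -
  define g where "g = sobolev_deriv a b CARD('N) (\<lambda>\<xi>. \<H> \<xi> *v x \<xi>)"
  define f where "f \<zeta> = A x \<zeta> - \<mu> *s x \<zeta>" for \<zeta>
  have g: "sobolev_derivs a b CARD('N) (\<lambda>\<xi>. \<H> \<xi> *v x \<xi>) g"
    unfolding g_def by (rule sobolev_deriv_works[OF Sob])
  have traj: "traj x \<zeta> = (\<Sum>k<CARD('N). emb k (g k \<zeta>))" for \<zeta>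
    unfolding traj_def g_def by (rule unblock_sum_emb)
  have block_traj: "block k (traj x \<zeta>) = g k \<zeta>" if "k < CARD('N)" for k \<zeta>
    using that by (simp add: traj_def g_def block_unblock)
  have ae0: "AE \<zeta> in lebesgue_on {a<..<b}. g 0 \<zeta> = \<H> \<zeta> *v x \<zeta>"
    using g by (simp add: sobolev_derivs_def ae_eq_def)
  have x_eq: "AE \<zeta> in lebesgue_on {a<..<b}. x \<zeta> = matrix_inv (\<H> \<zeta>) *v g 0 \<zeta>"
    using ae0 H_inverse by eventually_elim (simp add: matrix_inv_vector)
  then show "ae_eq a b x (state (traj x))"
    by (simp add: ae_eq_def state_def block_traj)
  show "solves \<mu> f (traj x)"
    unfolding solves_def
  proof (intro conjI ballI)
    show "continuous_on {a..b} (traj x)"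
      unfolding traj
      by (intro continuous_intros bounded_linear.continuous_on[OF bounded_linear_emb]
          sobolev_derivs_continuous[OF g]) simp
    fix t assume t: "t \<in> {a..b}"
    have int: "((\<lambda>s. \<Sum>k<CARD('N). emb k (g (Suc k) s)) has_integral (traj x t - traj x a)) {a..t}"
    proof -
      have "((\<lambda>s. \<Sum>k<CARD('N). emb k (g (Suc k) s)) has_integral
          (\<Sum>k<CARD('N). emb k (g k t - g k a) :: complex ^ ('N \<times> 'n))) {a..t}"
      proof (intro has_integral_sum)
        fix k assume "k \<in> {..<CARD('N)}"
        then have "(g (Suc k) has_integral (g k t - g k a)) {a..t}"
          using g t by (simp add: sobolev_derivs_def)
        from has_integral_linear[OF this bounded_linear_emb]
        show "((\<lambda>s. emb k (g (Suc k) s)) has_integral (emb k (g k t - g k a) :: complex ^ ('N \<times> 'n))) {a..t}"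
          by (simp add: o_def)
      qed simp
      then show ?thesis
        by (simp add: traj linear_diff[OF bounded_linear.linear[OF bounded_linear_emb]] sum_subtractf)
    qed
    have "AE s in lebesgue_on {a<..<b}. (\<Sum>k<CARD('N). emb k (g (Suc k) s)) = comp \<mu> s *v traj x s + forcing (f s)"
      using x_eq
    proof eventually_elim
      case (elim s)
      show ?case
      proof (rule block_eqI)
        fix p assume p: "p < CARD('N)"
        have "block p (\<Sum>k<CARD('N). emb k (g (Suc k) s) :: complex ^ ('N \<times> 'n)) = g (Suc p) s"
          unfolding unblock_sum_emb[symmetric, of "\<lambda>k. g (Suc k) s"] using p by (rule block_unblock)
        also have "g (Suc p) s = block p (comp \<mu> s *v traj x s + forcing (f s))"
        proof (cases "p + 1 < CARD('N)")
          case True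
          then show ?thesis using p by (simp add: block_add block_comp block_forcing block_traj)
        next
          case False
          then have Sp: "Suc p = CARD('N)" using p by simp
          have "f s = (\<Sum>k<CARD('N). P k *v g k s) + P CARD('N) *v g CARD('N) s - \<mu> *s x s"
            by (simp add: f_def A_def phs_op_def g_def[symmetric] sum_le_N)
          moreover have "(\<Sum>k<CARD('N). P k *v block k (traj x s)) = (\<Sum>k<CARD('N). P k *v g k s)"
            by (intro sum.cong) (auto simp: block_traj)
          moreover have "matrix_inv (\<H> s) *v block 0 (traj x s) = x s" using elim by (simp add: block_traj)
          ultimately have "block p (comp \<mu> s *v traj x s + forcing (f s))
              = matrix_inv (P CARD('N)) *v (P CARD('N) *v g CARD('N) s)"
            using p False by (simp add: block_add block_comp block_forcing flip: matrix_vector_right_distrib)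
          then show ?thesis using Sp by (simp add: R_works)
        qed
        finally show "block p (\<Sum>k<CARD('N). emb k (g (Suc k) s) :: complex ^ ('N \<times> 'n))
          = block p (comp \<mu> s *v traj x s + forcing (f s))" .
      qed
    qed
    from has_integral_ae_cong[OF this t int]
    show "((\<lambda>s. comp \<mu> s *v traj x s + forcing (f s)) has_integral traj x t - traj x a) {a..t}" .
  qed
qed

text \<open>The converse reduction: all blocks but the last say that consecutive blocks are
  derivatives of each other, and the last one, multiplied by \<open>P CARD('N)\<close>, is the
  differential equation.\<close>

lemma state_solves:
  assumes f: "f \<in> L2 a b" and v: "solves \<mu> f v"
  shows "state v \<in> L2 a b" and "(\<lambda>\<zeta>. \<H> \<zeta> *v state v \<zeta>) \<in> Sobolev a b CARD('N)"
    and "ae_eq a b (A (state v)) (\<lambda>\<zeta>. \<mu> *s state v \<zeta> + f \<zeta>)"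
    and "t \<in> {a..b} \<Longrightarrow> traj (state v) t = v t"
proof -
  have cont: "continuous_on {a..b} v" using v by (simp add: solves_def)
  \<comment> \<open>A trajectory has no block for the top order; that derivative is read off from
    the last block of the right-hand side.\<close>
  define g where "g k = (if k < CARD('N) then (\<lambda>\<zeta>. block k (v \<zeta>))
    else (\<lambda>\<zeta>. block (CARD('N) - 1) (comp \<mu> \<zeta> *v v \<zeta> + forcing (f \<zeta>))))" for k
  have g: "sobolev_derivs a b CARD('N) (\<lambda>\<zeta>. \<H> \<zeta> *v state v \<zeta>) g"
    unfolding sobolev_derivs_def
  proof (intro conjI allI impI ballI)
    show "ae_eq a b (g 0) (\<lambda>\<zeta>. \<H> \<zeta> *v state v \<zeta>)"
      unfolding ae_eq_def using H_inverse
      by eventually_elim (simp add: g_def state_def matrix_inv_vector)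
    show "g k \<in> L2 a b" if "k \<le> CARD('N)" for k
    proof (cases "k < CARD('N)")
      case True
      then show ?thesis
        by (simp add: g_def) (intro L2_linear[OF bounded_linear_block] L2_continuous cont)
    next
      case False
      then show ?thesis
        by (simp add: g_def)
          (intro L2_linear[OF bounded_linear_block] cont L2_add L2_comp L2_linear[OF bounded_linear_forcing] f)
    qed
    fix k t assume k: "k < CARD('N)" and t: "t \<in> {a..b}"
    have "((\<lambda>s. comp \<mu> s *v v s + forcing (f s)) has_integral (v t - v a)) {a..t}"
      using v t by (simp add: solves_def)
    from has_integral_linear[OF this bounded_linear_block[of k]]
    have "((\<lambda>s. block k (comp \<mu> s *v v s + forcing (f s))) has_integral (block k (v t) - block k (v a))) {a..t}"
      by (simp add: o_def linear_diff[OF bounded_linear.linear[OF bounded_linear_block]])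
    moreover have "block k (comp \<mu> s *v v s + forcing (f s)) = g (Suc k) s" for s
    proof (cases "Suc k < CARD('N)")
      case True
      then show ?thesis using k by (simp add: g_def block_add block_comp block_forcing)
    next
      case False
      then have "k = CARD('N) - 1" using k by simp
      then show ?thesis using False by (simp add: g_def)
    qed
    ultimately show "(g (Suc k) has_integral g k t - g k a) {a..t}"
      using k by (simp add: g_def[of k])
  qed
  show 1: "state v \<in> L2 a b"
    unfolding state_def by (intro L2_H_inverse L2_linear[OF bounded_linear_block] L2_continuous cont)
  show Sob: "(\<lambda>\<zeta>. \<H> \<zeta> *v state v \<zeta>) \<in> Sobolev a b CARD('N)" using g by (auto simp: Sobolev_def)
  define d where "d = sobolev_deriv a b CARD('N) (\<lambda>\<zeta>. \<H> \<zeta> *v state v \<zeta>)"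
  have d: "sobolev_derivs a b CARD('N) (\<lambda>\<zeta>. \<H> \<zeta> *v state v \<zeta>) d"
    unfolding d_def by (rule sobolev_deriv_works[OF Sob])
  have "AE \<zeta> in lebesgue_on {a<..<b}. \<forall>k\<in>{..CARD('N)}. d k \<zeta> = g k \<zeta>"
    using sobolev_derivs_unique(2)[OF ab d g] by (intro AE_finite_allI) (auto simp: ae_eq_def)
  then show "ae_eq a b (A (state v)) (\<lambda>\<zeta>. \<mu> *s state v \<zeta> + f \<zeta>)"
    unfolding ae_eq_def
  proof eventually_elim
    case (elim \<zeta>)
    have "A (state v) \<zeta> = (\<Sum>k\<le>CARD('N). P k *v g k \<zeta>)"
      unfolding A_def phs_op_def d_def[symmetric] using elim by (intro sum.cong) auto
    also have "\<dots> = (\<Sum>k<CARD('N). P k *v block k (v \<zeta>)) + P CARD('N) *v g CARD('N) \<zeta>"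
      by (simp add: sum_le_N g_def)
    also have "g CARD('N) \<zeta> = matrix_inv (P CARD('N)) *v
        (\<mu> *s state v \<zeta> - (\<Sum>k<CARD('N). P k *v block k (v \<zeta>)) + f \<zeta>)"
      by (simp add: g_def block_add block_comp block_forcing state_def matrix_vector_right_distrib)
    finally show ?case by (simp add: R_works)
  qed
  show "traj (state v) t = v t" if t: "t \<in> {a..b}"
  proof (rule block_eqI)
    fix k assume k: "k < CARD('N)"
    have "block k (traj (state v) t) = d k t" using k by (simp add: traj_def d_def block_unblock)
    also have "\<dots> = g k t" by (rule sobolev_derivs_unique(1)[OF ab d g k t])
    finally show "block k (traj (state v) t) = block k (v t)" using k by (simp add: g_def)
  qed
qed

abbreviation "D \<equiv> phs_dom a b \<H> W"

definition \<Q> :: "complex \<Rightarrow> complex ^ ('N \<times> 'n) ^ ('N \<times> 'n)" where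
  "\<Q> \<mu> = W ** vstack (\<Psi> \<mu> b) (mat 1)"

lemma \<Q>_mult: "\<Q> \<mu> *v c = W *v vpair (\<Psi> \<mu> b *v c) c"
  by (simp add: \<Q>_def vstack_mult flip: matrix_vector_mul_assoc)

lemma state_solves_in_D:
  assumes "f \<in> L2 a b" "solves \<mu> f v" "W *v vpair (v b) (v a) = 0"
  shows "state v \<in> D"
  using state_solves[OF assms(1,2)] assms(3) ab by (simp add: phs_dom_def boundary_values_eq)

lemma D_D: "x \<in> D \<Longrightarrow> x \<in> L2 a b" "x \<in> D \<Longrightarrow> (\<lambda>\<zeta>. \<H> \<zeta> *v x \<zeta>) \<in> Sobolev a b CARD('N)"
  "x \<in> D \<Longrightarrow> W *v vpair (traj x b) (traj x a) = 0"
  by (auto simp: phs_dom_def boundary_values_eq)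

lemma singular_imp_eigenvalue:
  assumes "\<Q> \<mu> *v c = 0" "c \<noteq> 0" shows "is_eigenvalue a b D A \<mu>"
proof -
  define v where "v = (\<lambda>\<zeta>. \<Psi> \<mu> \<zeta> *v c)"
  have v: "solves \<mu> (\<lambda>_. 0) v" unfolding v_def by (rule fundamental_solution_solves)
  have va: "v a = c" by (simp add: v_def \<Psi>_a)
  have "state v \<in> D" using assms(1) by (intro state_solves_in_D[OF L2_zero v]) (simp add: \<Psi>_a \<Q>_mult v_def)
  moreover have "ae_eq a b (A (state v)) (\<lambda>\<zeta>. \<mu> *s state v \<zeta>)"
    using state_solves(3)[OF L2_zero v] by simp
  moreover have "\<not> ae_eq a b (state v) (\<lambda>_. 0)"
  proof
    assume "ae_eq a b (state v) (\<lambda>_. 0)"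
    then have "ae_eq a b (\<lambda>_. 0) (\<lambda>\<zeta>. \<H> \<zeta> *v state v \<zeta>)"
      unfolding ae_eq_def by eventually_elim simp
    \<comment> \<open>If the state vanishes, the zero family is also a family of derivatives of
      \<open>\<H> x\<close>, and uniqueness forces the initial value \<open>c\<close> of the
      trajectory to be 0.\<close>
    then have z: "sobolev_derivs a b CARD('N) (\<lambda>\<zeta>. \<H> \<zeta> *v state v \<zeta>) (\<lambda>k \<zeta>. 0)"
      by (simp add: sobolev_derivs_def L2_zero)
    have "traj (state v) a = 0"
    proof (rule block_eqI)
      fix k assume k: "k < CARD('N)"
      have "block k (traj (state v) a) = 0"
        using sobolev_derivs_unique(1)[OF ab sobolev_deriv_works[OF state_solves(2)[OF L2_zero v]] z k, of a]
          k ab by (simp add: traj_def block_unblock)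
      then show "block k (traj (state v) a) = block k 0" by simp
    qed
    then show False using state_solves(4)[OF L2_zero v, of a] va assms(2) ab by simp
  qed
  ultimately show ?thesis by (auto simp: is_eigenvalue_def)
qed

lemma eigenvalue_imp_singular:
  assumes "is_eigenvalue a b D A \<mu>" obtains c where "\<Q> \<mu> *v c = 0" "c \<noteq> 0"
proof -
  obtain x where x: "x \<in> D" "\<not> ae_eq a b x (\<lambda>_. 0)" "ae_eq a b (A x) (\<lambda>\<zeta>. \<mu> *s x \<zeta>)"
    using assms by (auto simp: is_eigenvalue_def)
  note s = traj_solves[OF D_D(1,2)[OF x(1)]]
  have ae: "AE s in lebesgue_on {a<..<b}. comp \<mu> s *v traj x s + forcing (A x s - \<mu> *s x s)
      = comp \<mu> s *v traj x s + forcing 0"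
    using x(3) unfolding ae_eq_def by eventually_elim simp
  have v: "solves \<mu> (\<lambda>_. 0) (traj x)"
    unfolding solves_def
  proof (intro conjI ballI)
    show "continuous_on {a..b} (traj x)" using s(1)[of \<mu>] by (simp add: solves_def)
    fix t assume t: "t \<in> {a..b}"
    show "((\<lambda>s. comp \<mu> s *v traj x s + forcing 0) has_integral traj x t - traj x a) {a..t}"
      by (rule has_integral_ae_cong[OF ae t]) (use s(1)[of \<mu>] t in \<open>simp add: solves_def\<close>)
  qed
  have v_eq: "traj x t = \<Psi> \<mu> t *v traj x a" if "t \<in> {a..b}" for t
    by (rule solves_eq_\<Psi>[OF v that])
  have "\<Q> \<mu> *v traj x a = 0" using D_D(3)[OF x(1)] v_eq[of b] ab by (simp add: \<Q>_mult)
  moreover have "traj x a \<noteq> 0"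
  proof
    assume "traj x a = 0"
    then have "traj x t = 0" if "t \<in> {a..b}" for t using v_eq[OF that] by simp
    then have "AE \<zeta> in lebesgue_on {a<..<b}. state (traj x) \<zeta> = 0"
      by (intro AE_I2) (simp add: state_def)
    then have "ae_eq a b x (\<lambda>_. 0)" using s(2) unfolding ae_eq_def by eventually_elim simp
    then show False using x(2) by blast
  qed
  ultimately show thesis by (rule that)
qed

text \<open>For a square matrix injectivity is invertibility; here uniqueness in the boundary value
  problem turns into solvability.\<close>

lemma invertible_iff_no_eigenvalue: "invertible (\<Q> \<mu>) \<longleftrightarrow> \<not> is_eigenvalue a b D A \<mu>"
proof -
  have "invertible (\<Q> \<mu>) \<longleftrightarrow> (\<forall>c. \<Q> \<mu> *v c = 0 \<longrightarrow> c = 0)"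
    by (simp add: invertible_left_inverse matrix_left_invertible_ker)
  then show ?thesis using singular_imp_eigenvalue eigenvalue_imp_singular by metis
qed

text \<open>A particular solution with initial value 0 is corrected by a homogeneous one to meet the
  boundary condition.\<close>

lemma resolvent_solution:
  assumes inv: "invertible (\<Q> \<mu>)" and f: "f \<in> L2 a b"
  shows "\<exists>x\<in>D. ae_eq a b (A x) (\<lambda>\<zeta>. \<mu> *s x \<zeta> + f \<zeta>)"
proof -
  obtain v where v: "solves \<mu> f v" "v a = 0" using solves_exists[OF f] by blast
  \<comment> \<open>The particular solution misses the boundary condition by
    \<open>W *v vpair (v b) 0\<close>, and subtracting the homogeneous solution started at
    \<open>c\<close> changes this by \<open>\<Q> \<mu> *v c\<close>.\<close>
  define c where "c = matrix_inv (\<Q> \<mu>) *v (W *v vpair (v b) 0)"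
  define w where "w \<zeta> = v \<zeta> - \<Psi> \<mu> \<zeta> *v c" for \<zeta>
  have w: "solves \<mu> f w"
    using solves_diff[OF v(1) fundamental_solution_solves] by (simp add: w_def[abs_def])
  have "vpair (w b) (w a) = vpair (v b) 0 - vpair (\<Psi> \<mu> b *v c) c"
    by (auto simp: w_def v(2) \<Psi>_a vpair_def vec_eq_iff split: sum.split)
  then have "W *v vpair (w b) (w a) = W *v vpair (v b) 0 - \<Q> \<mu> *v c"
    by (simp add: matrix_vector_mult_diff_distrib \<Q>_mult)
  also have "\<dots> = 0" by (simp add: c_def matrix_inv_vector[OF inv])
  finally have "state w \<in> D" by (intro state_solves_in_D[OF f w])
  then show ?thesis using state_solves(3)[OF f w] by blast
qed

text \<open>The boundary condition determines the initial value from the inhomogeneity.\<close>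

lemma traj_bound:
  assumes inv: "invertible (\<Q> 0)"
  obtains C where "0 \<le> C"
    "\<And>x t. x \<in> D \<Longrightarrow> t \<in> {a..b} \<Longrightarrow> norm (traj x t) \<le> C * integral {a..b} (\<lambda>s. norm (forcing (A x s)))"
proof -
  obtain C0 where C0: "0 \<le> C0" "\<And>f v t. f \<in> L2 a b \<Longrightarrow> solves 0 f v \<Longrightarrow> t \<in> {a..b} \<Longrightarrow>
     norm (v t) \<le> C0 * (norm (v a) + integral {a..b} (\<lambda>s. norm (forcing (f s))))"
    using solves_bound[of 0] by blast
  define J :: "complex ^ ('N \<times> 'n) \<Rightarrow> complex ^ ('N \<times> 'n)" where
    "J y = matrix_inv (\<Q> 0) *v (W *v vpair y 0)" for y
  have "bounded_linear J"
  proof -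
    have "linear (\<lambda>y :: complex ^ ('N \<times> 'n). vpair y (0 :: complex ^ ('N \<times> 'n)))"
      by (rule linearI) (auto simp: vpair_def vec_eq_iff split: sum.split)
    then have "bounded_linear (\<lambda>y :: complex ^ ('N \<times> 'n). vpair y (0 :: complex ^ ('N \<times> 'n)))"
      by (simp add: linear_conv_bounded_linear)
    then show ?thesis unfolding J_def
      by (intro bounded_linear_compose[OF bounded_linear_matrix_vector])
  qed
  then obtain C1 where C1: "0 \<le> C1" "\<And>y. norm (J y) \<le> C1 * norm y"
    using bounded_linear.nonneg_bounded[of J] by (auto simp: mult.commute)
  have "norm (traj x t) \<le> (C0 * (C1 * C0 + 1)) * integral {a..b} (\<lambda>s. norm (forcing (A x s)))"
    if x: "x \<in> D" and t: "t \<in> {a..b}" for x t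
  proof -
    define I where "I = integral {a..b} (\<lambda>s. norm (forcing (A x s)))"
    have Ax: "A x \<in> L2 a b" using phs_op_L2 D_D(2)[OF x] .
    have v: "solves 0 (A x) (traj x)" using traj_solves(1)[OF D_D(1,2)[OF x], of 0] by simp
    \<comment> \<open>Starting at 0, \<open>w\<close> is controlled by the forcing alone; the
      boundary condition then expresses \<open>traj x a\<close> through \<open>w b\<close>.\<close>
    define w where "w \<zeta> = traj x \<zeta> - \<Psi> 0 \<zeta> *v traj x a" for \<zeta>
    have w: "solves 0 (A x) w"
      using solves_diff[OF v fundamental_solution_solves] by (simp add: w_def[abs_def])
    have wa: "w a = 0" by (simp add: w_def \<Psi>_a)
    have wb: "norm (w b) \<le> C0 * I" using C0(2)[OF Ax w, of b] ab wa by (simp add: I_def)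
    have "vpair (traj x b) (traj x a) = vpair (w b) 0 + vpair (\<Psi> 0 b *v traj x a) (traj x a)"
      by (auto simp: w_def vpair_def vec_eq_iff split: sum.split)
    then have "W *v vpair (w b) 0 + \<Q> 0 *v traj x a = 0"
      using D_D(3)[OF x] by (simp add: matrix_vector_right_distrib \<Q>_mult)
    then have "\<Q> 0 *v traj x a = - (W *v vpair (w b) 0)" by (simp add: eq_neg_iff_add_eq_0 add.commute)
    then have "matrix_inv (\<Q> 0) *v (\<Q> 0 *v traj x a) = matrix_inv (\<Q> 0) *v - (W *v vpair (w b) 0)"
      by simp
    then have "traj x a = - J (w b)" by (simp add: matrix_inv_vector[OF inv] J_def vec.neg)
    then have "norm (traj x a) \<le> C1 * norm (w b)" using C1(2)[of "w b"] by simp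
    also have "\<dots> \<le> C1 * (C0 * I)" using wb C1(1) by (rule mult_left_mono)
    finally have "norm (traj x a) + I \<le> (C1 * C0 + 1) * I" by (simp add: algebra_simps)
    then have "C0 * (norm (traj x a) + I) \<le> C0 * ((C1 * C0 + 1) * I)"
      using C0(1) by (rule mult_left_mono)
    then show ?thesis using C0(2)[OF Ax v t] by (simp add: I_def mult.assoc)
  qed
  then show thesis using that[of "C0 * (C1 * C0 + 1)"] C0(1) C1(1) by simp
qed

end

subsection \<open>Conservation of the boundary form\<close>

lemma sum_UNIV_sum_type:
  "sum g UNIV = (\<Sum>i\<in>UNIV. g (Inl i)) + (\<Sum>j\<in>UNIV. g (Inr j))"
  for g :: "'x::finite + 'y::finite \<Rightarrow> 'a::comm_monoid_add"
  by (subst UNIV_Plus_UNIV[symmetric]) (simp add: sum.Plus o_def del: UNIV_Plus_UNIV)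

lemma hstack_mult: "hstack A B *v vpair x y = A *v x + B *v y" for x :: "complex ^ 'c"
  by (simp add: hstack_def vpair_def matrix_vector_mult_def vec_eq_iff sum_UNIV_sum_type)

lemma diag2_mult: "diag2 A B *v vpair x y = vpair (A *v x) (B *v y)" for x :: "complex ^ 'c"
  by (simp add: diag2_def vstack_mult hstack_mult)

text \<open>Over \<open>n\<close> equal steps the quadratic increments add up to
  \<open>O(1/n)\<close>.\<close>

lemma quadratic_if_constant:
  fixes \<phi> :: "real \<Rightarrow> real"
  assumes "a < b" and le: "\<And>s t. s \<in> {a..b} \<Longrightarrow> t \<in> {a..b} \<Longrightarrow> s \<le> t \<Longrightarrow> \<bar>\<phi> t - \<phi> s\<bar> \<le> M * (t - s)\<^sup>2"
  shows "\<phi> b = \<phi> a"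
proof -
  have M: "0 \<le> M"
  proof -
    have "0 \<le> M * (b - a)\<^sup>2" using le[of a b] \<open>a < b\<close> by (meson abs_ge_zero atLeastAtMost_iff less_imp_le order_refl order_trans)
    then show ?thesis using \<open>a < b\<close> by (simp add: zero_le_mult_iff)
  qed
  have bound: "\<bar>\<phi> b - \<phi> a\<bar> \<le> M * (b - a)\<^sup>2 / real (Suc n)" for n
  proof -
    define h where "h = (b - a) / real (Suc n)"
    have h: "0 < h" "real (Suc n) * h = b - a" using \<open>a < b\<close> by (auto simp: h_def)
    have "\<bar>\<phi> (a + real k * h) - \<phi> a\<bar> \<le> real k * (M * h\<^sup>2)" if "k \<le> Suc n" for k
      using that
    proof (induction k)
      case (Suc k)
      have "real (Suc k) * h \<le> b - a"
        unfolding h(2)[symmetric] using Suc.prems h(1) by (intro mult_right_mono) auto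
      then have "\<bar>\<phi> (a + real (Suc k) * h) - \<phi> (a + real k * h)\<bar> \<le> M * (a + real (Suc k) * h - (a + real k * h))\<^sup>2"
        using h(1) by (intro le) (auto simp: algebra_simps)
      also have "a + real (Suc k) * h - (a + real k * h) = h" by (simp add: algebra_simps)
      finally show ?case using Suc by (simp add: algebra_simps)
    qed simp
    from this[of "Suc n"] have "\<bar>\<phi> b - \<phi> a\<bar> \<le> real (Suc n) * (M * h\<^sup>2)" using h(2) by simp
    also have "\<dots> = M * (b - a)\<^sup>2 / real (Suc n)"
      by (simp add: h_def power2_eq_square field_simps del: of_nat_Suc)
    finally show ?thesis .
  qed
  have "(\<lambda>n. M * (b - a)\<^sup>2 / real (Suc n)) \<longlonglongrightarrow> 0"
    by (rule LIMSEQ_Suc[OF lim_const_over_n])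
  then have "\<bar>\<phi> b - \<phi> a\<bar> \<le> 0" using bound by (intro Lim_bounded2) auto
  then show ?thesis by simp
qed

context port_hamiltonian
begin

definition Q :: "complex ^ ('N \<times> 'n) ^ ('N \<times> 'n)" where "Q = Q_matrix P"

lemma P_inner: "k \<le> CARD('N) \<Longrightarrow> x \<bullet> (P k *v y) = (-1) ^ (k + 1) * (y \<bullet> (P k *v x))"
proof -
  assume k: "k \<le> CARD('N)"
  have scale: "(c *\<^sub>R M) *v z = c *\<^sub>R (M *v z)" for c and M :: "complex ^ 'n ^ 'n" and z
    by (simp add: matrix_vector_mult_def vec_eq_iff scaleR_sum_right)
  have "x \<bullet> (P k *v y) = Re (cdot (cmat_adjoint (P k) *v x) y)"
    by (simp add: Re_cdot[symmetric] cdot_adjoint)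
  also have "\<dots> = (-1) ^ (k + 1) * ((P k *v x) \<bullet> y)"
    unfolding P_adjoint[OF k] scale by (simp add: Re_cdot)
  finally show ?thesis by (simp add: inner_commute)
qed

text \<open>In 0-based positions the adjoint of \<open>P (i + j + 1)\<close> contributes the sign
  \<open>(-1) ^ (i + j)\<close>, which exchanges the row signs \<open>(-1) ^ j\<close> and
  \<open>(-1) ^ i\<close>.\<close>

lemma cmat_adjoint_Q: "cmat_adjoint Q = Q"
proof -
  have "cnj (Q $ c $ r) = Q $ r $ c" for r c
  proof -
    define i where "i = pos (fst r)"
    define j where "j = pos (fst c)"
    have "cnj (P (i + j + 1) $ snd c $ snd r) = (-1) ^ (i + j + 2) *\<^sub>R P (i + j + 1) $ snd r $ snd c"
      if "i + j + 1 \<le> CARD('N)"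
      using arg_cong[OF P_adjoint[OF that], of "\<lambda>M. M $ snd r $ snd c"] by (simp add: cmat_adjoint_def)
    then show ?thesis
      by (auto simp: Q_def Q_matrix_def block_matrix_def i_def[symmetric] j_def[symmetric] add.commute
          power_add)
  qed
  then show ?thesis by (simp add: cmat_adjoint_def vec_eq_iff)
qed

lemma Q_symmetric: "x \<bullet> (Q *v y) = y \<bullet> (Q *v x)"
proof -
  have "x \<bullet> (Q *v y) = (Q *v x) \<bullet> y"
    by (simp add: Re_cdot[symmetric] cdot_adjoint cmat_adjoint_Q)
  then show ?thesis by (simp add: inner_commute)
qed

text \<open>Condition (v) is a complex equation, the conservation law a real one; for the Hermitian
  \<open>Q\<close> they agree.\<close>

lemma cdot_Q: "cdot x (Q *v x) = of_real (x \<bullet> (Q *v x))"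
proof -
  have "cdot x (Q *v x) = cnj (cdot x (Q *v x))"
    by (metis cdot_adjoint cdot_commute cmat_adjoint_Q)
  then have "Im (cdot x (Q *v x)) = 0" by (metis complex_cnj complex_surj complex.sel(2) neg_equal_zero)
  then show ?thesis by (simp add: complex_eq_iff Re_cdot)
qed

lemma H_inverse_real:
  assumes "invertible (\<H> s)" "cmat_adjoint (\<H> s) = \<H> s"
  shows "Im (cdot w (matrix_inv (\<H> s) *v w)) = 0"
proof -
  define y where "y = matrix_inv (\<H> s) *v w"
  have w: "w = \<H> s *v y" by (simp add: y_def matrix_inv_vector[OF assms(1)])
  have "cdot w y = cdot y w"
    unfolding w using cdot_adjoint[of y "\<H> s" y] assms(2) by simp
  then have "cdot w y = cnj (cdot w y)" using cdot_commute[of y w] by simp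
  then show ?thesis unfolding y_def by (metis complex_cnj complex_surj complex.sel(2) neg_equal_zero)
qed

text \<open>In the blocks \<open>w\<^sub>k\<close> of \<open>w\<close> the form is a sum of the \<open>(-1)\<^sup>i \<langle>w\<^sub>i, P\<^bsub>i+k\<^esub> w\<^sub>k\<rangle>\<close> over \<open>i, k \<ge> 1\<close>, which are
  antisymmetric under \<open>i \<leftrightarrow> k\<close>, of the skew term \<open>\<langle>w\<^sub>0, P\<^sub>0 w\<^sub>0\<rangle>\<close>, and of \<open>Re (\<mu> \<langle>w\<^sub>0, H\<^sup>-\<^sup>1 w\<^sub>0\<rangle>)\<close>.\<close>

lemma Q_comp_skew:
  assumes inv: "invertible (\<H> s)" and adj: "cmat_adjoint (\<H> s) = \<H> s" and \<mu>: "Re \<mu> = 0"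
  shows "w \<bullet> (Q *v (comp \<mu> s *v w)) = 0"
proof -
  define M where "M = CARD('N) - 1"
  have M: "CARD('N) = Suc M" by (simp add: M_def)
  define u where "u = comp \<mu> s *v w"
  define w' where "w' k = block k w" for k
  define \<beta> where "\<beta> i k = w' i \<bullet> (P (i + k) *v w' k)" for i k
  \<comment> \<open>The second index is shifted by one against the columns of \<open>Q\<close>,
    because block \<open>j\<close> of \<open>u\<close> is block \<open>j + 1\<close> of
    \<open>w\<close>. With this shift the terms become antisymmetric.\<close>
  define r where "r i k = (if i + k \<le> Suc M then (-1) ^ i * \<beta> i k else 0)" for i k
  have anti: "r k i = - r i k" for i k
  proof (cases "i + k \<le> Suc M")
    case True
    have "\<beta> k i = (-1) ^ (i + k + 1) * \<beta> i k"
      unfolding \<beta>_def using P_inner[of "k + i" "w' k" "w' i"] True M by (simp add: add.commute)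
    then have "r k i = (-1) ^ k * (-1) ^ (i + k + 1) * \<beta> i k" using True by (simp add: r_def add.commute)
    also have "(-1) ^ k * (-1) ^ (i + k + 1) = - ((-1) ^ i :: real)"
      by (simp add: power_add flip: power_mult_distrib)
    finally show ?thesis using True by (simp add: r_def)
  qed (simp add: r_def add.commute)
  have u_block: "block j u = w' (Suc j)" if "j < M" for j
    using that M by (simp add: u_def block_comp w'_def)
  have u_last: "P (Suc M) *v block M u = \<mu> *s (matrix_inv (\<H> s) *v w' 0) - (\<Sum>k<Suc M. P k *v w' k)"
    using M R_works(1) by (simp add: u_def block_comp w'_def)
  have scale: "(c *\<^sub>R B) *v z = c *\<^sub>R (B *v z)" for c and B :: "complex ^ 'n ^ 'n" and z
    by (simp add: matrix_vector_mult_def vec_eq_iff scaleR_sum_right)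
  have zero: "(0 :: complex ^ 'n ^ 'n) *v z = 0" for z
    by (simp add: matrix_vector_mult_def vec_eq_iff)
  have "w \<bullet> (Q *v u) = Re (\<Sum>i<Suc M. cdot (w' i) (block i (Q *v u)))"
    unfolding M[symmetric] w'_def by (simp only: Re_cdot[symmetric] cdot_block)
  also have "\<dots> = (\<Sum>i<Suc M. w' i \<bullet> block i (Q *v u))"
    by (simp add: Re_cdot)
  also have "\<dots> = (\<Sum>i<Suc M. \<Sum>j<Suc M. if i + j + 1 \<le> Suc M then (-1) ^ i * (w' i \<bullet> (P (i + j + 1) *v block j u)) else 0)"
  proof (rule sum.cong[OF refl])
    fix i assume "i \<in> {..<Suc M}"
    then have "block i (Q *v u) = (\<Sum>j<Suc M. (if i + j + 1 \<le> Suc M then (-1) ^ i *\<^sub>R P (i + j + 1) else 0) *v block j u)"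
      using M by (simp add: Q_def Q_matrix_def block_block_matrix)
    then have "w' i \<bullet> block i (Q *v u) = (\<Sum>j<Suc M. w' i \<bullet> ((if i + j + 1 \<le> Suc M then (-1) ^ i *\<^sub>R P (i + j + 1) else 0) *v block j u))"
      by (simp only: inner_sum_right)
    also have "\<dots> = (\<Sum>j<Suc M. if i + j + 1 \<le> Suc M then (-1) ^ i * (w' i \<bullet> (P (i + j + 1) *v block j u)) else 0)"
      by (intro sum.cong refl) (simp add: scale zero)
    finally show "w' i \<bullet> block i (Q *v u) = (\<Sum>j<Suc M. if i + j + 1 \<le> Suc M then (-1) ^ i * (w' i \<bullet> (P (i + j + 1) *v block j u)) else 0)" .
  qed
  \<comment> \<open>The last column \<open>j = M\<close> lies in the support of \<open>Q\<close>
    only for \<open>i = 0\<close>; it is kept apart because block \<open>M\<close> of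
    \<open>u\<close> is given by the differential equation instead of a shift.\<close>
  also have "\<dots> = (\<Sum>i<Suc M. (\<Sum>j<M. r i (Suc j)) + (if i = 0 then w' 0 \<bullet> (P (Suc M) *v block M u) else 0))"
    by (intro sum.cong refl) (auto simp: u_block r_def \<beta>_def intro!: sum.cong)
  also have "\<dots> = (\<Sum>i<Suc M. \<Sum>j<M. r i (Suc j)) + w' 0 \<bullet> (P (Suc M) *v block M u)"
    by (simp add: sum.distrib)
  also have "(\<Sum>i<Suc M. \<Sum>j<M. r i (Suc j)) = (\<Sum>j<M. r 0 (Suc j)) + (\<Sum>i<M. \<Sum>j<M. r (Suc i) (Suc j))"
    by (rule sum.lessThan_Suc_shift)
  also have "(\<Sum>i<M. \<Sum>j<M. r (Suc i) (Suc j)) = 0"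
  proof -
    have "(\<Sum>i<M. \<Sum>j<M. r (Suc i) (Suc j)) = (\<Sum>j<M. \<Sum>i<M. r (Suc i) (Suc j))" by (rule sum.swap)
    also have "\<dots> = - (\<Sum>i<M. \<Sum>j<M. r (Suc i) (Suc j))"
      by (subst anti) (simp add: sum_negf)
    finally show ?thesis by simp
  qed
  \<comment> \<open>The differential equation replaces the top term by the lower ones with a minus
    sign, which cancels the row \<open>i = 0\<close>; the terms with \<mu> and \<open>P 0\<close>
    have real part zero.\<close>
  also have "w' 0 \<bullet> (P (Suc M) *v block M u) = - (\<Sum>j<M. r 0 (Suc j))"
  proof -
    have "w' 0 \<bullet> (\<mu> *s (matrix_inv (\<H> s) *v w' 0)) = Re (\<mu> * cdot (w' 0) (matrix_inv (\<H> s) *v w' 0))"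
      using cdot_scale[of 1 "w' 0" \<mu>] by (simp add: Re_cdot[symmetric])
    also have "\<dots> = 0" using \<mu> H_inverse_real[OF inv adj] by simp
    finally have 1: "w' 0 \<bullet> (\<mu> *s (matrix_inv (\<H> s) *v w' 0)) = 0" .
    have "w' 0 \<bullet> (P 0 *v w' 0) = 0" using P_inner[of 0 "w' 0" "w' 0"] by simp
    then have "w' 0 \<bullet> (\<Sum>k<Suc M. P k *v w' k) = (\<Sum>j<M. w' 0 \<bullet> (P (Suc j) *v w' (Suc j)))"
      unfolding inner_sum_right by (simp add: sum.lessThan_Suc_shift del: sum.lessThan_Suc)
    also have "\<dots> = (\<Sum>j<M. r 0 (Suc j))" by (intro sum.cong) (auto simp: r_def \<beta>_def)
    finally show ?thesis using 1 by (simp add: u_last inner_diff_right)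
  qed
  finally show ?thesis by (simp add: u_def)
qed

text \<open>By skewness the form changes by \<open>O((t - s)\<^sup>2)\<close> on \<open>[s,t]\<close>, which avoids a product rule for
  absolutely continuous functions.\<close>

lemma Q_conserved:
  assumes \<mu>: "Re \<mu> = 0" and v: "solves \<mu> (\<lambda>_. 0) v"
  shows "v b \<bullet> (Q *v v b) = v a \<bullet> (Q *v v a)"
proof -
  obtain K where K: "0 \<le> K" "AE \<zeta> in lebesgue_on {a<..<b}. \<forall>v. norm (comp \<mu> \<zeta> *v v) \<le> K * norm v"
    using comp_bound by blast
  have "AE \<zeta> in lebesgue_on {a<..<b}. (\<forall>v. norm (comp \<mu> \<zeta> *v v) \<le> K * norm v) \<and>
      (\<forall>w. w \<bullet> (Q *v (comp \<mu> \<zeta> *v w)) = 0)"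
    using K(2) H_coercive H_inverse by eventually_elim (use \<mu> Q_comp_skew in blast)
  then obtain S where S: "negligible S" "\<And>\<zeta>. \<zeta> \<in> {a..b} - S \<Longrightarrow> (\<forall>v. norm (comp \<mu> \<zeta> *v v) \<le> K * norm v) \<and>
      (\<forall>w. w \<bullet> (Q *v (comp \<mu> \<zeta> *v w)) = 0)"
    by (rule ae_eq_negligible) (rule that)
  have cont: "continuous_on {a..b} v" using v by (simp add: solves_def)
  then have "bounded (v ` {a..b})" by (intro compact_imp_bounded compact_continuous_image) auto
  then obtain B where B: "\<forall>t\<in>{a..b}. norm (v t) \<le> B" by (auto simp: bounded_iff)
  obtain KQ where KQ: "0 \<le> KQ" "\<And>x. norm (Q *v x) \<le> KQ * norm x"
    using bounded_linear.nonneg_bounded[OF bounded_linear_matrix_vector, of Q] by (auto simp: mult.commute)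
  have B0: "0 \<le> B" using B ab by (metis atLeastAtMost_iff less_imp_le norm_ge_zero order_refl order_trans)
  define G where "G s = (if s \<in> S then 0 else comp \<mu> s *v v s)" for s
  have G: "(G has_integral (v t - v s)) {s..t}" if "s \<in> {a..b}" "t \<in> {a..b}" "s \<le> t" for s t
  proof -
    have *: "(G has_integral (v t - v a)) {a..t}" if "t \<in> {a..b}" for t
      by (rule has_integral_spike[OF S(1)]) (use v that in \<open>auto simp: solves_def G_def forcing_zero\<close>)
    have "integral {a..s} G + integral {s..t} G = integral {a..t} G" "G integrable_on {s..t}"
      using *[of t] that
      by (auto intro!: Henstock_Kurzweil_Integration.integral_combine integrable_on_subinterval[of G "{a..t}" s t])
    then have "integral {s..t} G = v t - v s"
      using *[OF that(1)] *[OF that(2)] by (simp add: integral_unique algebra_simps)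
    then show ?thesis using \<open>G integrable_on {s..t}\<close> by (simp add: has_integral_iff)
  qed
  have G_le: "norm (G s) \<le> K * B" if "s \<in> {a..b}" for s
  proof (cases "s \<in> S")
    case False
    then have "norm (G s) \<le> K * norm (v s)" using S(2)[of s] that by (simp add: G_def)
    also have "\<dots> \<le> K * B" using B that K(1) by (intro mult_left_mono) auto
    finally show ?thesis .
  qed (use K(1) B0 in \<open>simp add: G_def\<close>)
  have lip: "norm (v t - v s) \<le> K * B * (t - s)" if "s \<in> {a..b}" "t \<in> {a..b}" "s \<le> t" for s t
    using has_integral_bound_real[OF _ _ G[OF that], of "K * B" "{}"] G_le that K(1) B0 by simp
  have "\<bar>v t \<bullet> (Q *v v t) - v s \<bullet> (Q *v v s)\<bar> \<le> (2 * B * KQ * K * K * B + KQ * (K * B)\<^sup>2) * (t - s)\<^sup>2"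
    if st: "s \<in> {a..b}" "t \<in> {a..b}" "s \<le> t" for s t
  proof -
    define d where "d = v t - v s"
    have d: "norm d \<le> K * B * (t - s)" unfolding d_def by (rule lip[OF st])
    have lin: "bounded_linear (\<lambda>x. v s \<bullet> (Q *v x))"
      by (rule bounded_linear_compose[OF bounded_linear_inner_right bounded_linear_matrix_vector])
    have int: "((\<lambda>\<tau>. v s \<bullet> (Q *v G \<tau>)) has_integral (v s \<bullet> (Q *v d))) {s..t}"
      using has_integral_linear[OF G[OF st] lin] by (simp add: o_def d_def)
    have "norm (v s \<bullet> (Q *v G \<tau>)) \<le> B * (KQ * (K * (K * B * (t - s))))" if \<tau>: "\<tau> \<in> {s..t}" for \<tau>
    proof (cases "\<tau> \<in> S")
      case True
      then show ?thesis using B0 KQ(1) K(1) st by (simp add: G_def)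
    next
      case False
      have \<tau>': "\<tau> \<in> {a..b}" using \<tau> st by auto
      \<comment> \<open>Skewness at the fixed vector \<open>v s\<close> permits subtracting it under
        \<open>comp\<close>. What remains is of order \<open>t - s\<close>, and integration supplies
        the second factor \<open>t - s\<close>.\<close>
      have "v s \<bullet> (Q *v G \<tau>) = v s \<bullet> (Q *v (comp \<mu> \<tau> *v (v \<tau> - v s)))"
        using S(2)[of \<tau>] \<tau>' False by (simp add: G_def matrix_vector_mult_diff_distrib inner_diff_right)
      also have "norm \<dots> \<le> norm (v s) * norm (Q *v (comp \<mu> \<tau> *v (v \<tau> - v s)))"
        by (simp add: Cauchy_Schwarz_ineq2)
      also have "\<dots> \<le> B * (KQ * (K * (K * B * (t - s))))"
      proof (intro mult_mono B0)
        show "norm (v s) \<le> B" using B st by blast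
        have "norm (v \<tau> - v s) \<le> K * B * (\<tau> - s)" using \<tau> \<tau>' st by (intro lip) auto
        also have "\<dots> \<le> K * B * (t - s)" using \<tau> K(1) B0 by (intro mult_left_mono) auto
        finally have "K * norm (v \<tau> - v s) \<le> K * (K * B * (t - s))" using K(1) by (rule mult_left_mono)
        then have "norm (comp \<mu> \<tau> *v (v \<tau> - v s)) \<le> K * (K * B * (t - s))"
          using S(2)[of \<tau>] \<tau>' False by (meson DiffI order_trans)
        then have "KQ * norm (comp \<mu> \<tau> *v (v \<tau> - v s)) \<le> KQ * (K * (K * B * (t - s)))"
          using KQ(1) by (rule mult_left_mono)
        then show "norm (Q *v (comp \<mu> \<tau> *v (v \<tau> - v s))) \<le> KQ * (K * (K * B * (t - s)))"
          using KQ(2) order_trans by blast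
      qed simp
      finally show ?thesis .
    qed
    then have "norm (v s \<bullet> (Q *v d)) \<le> B * (KQ * (K * (K * B * (t - s)))) * (t - s)"
      using has_integral_bound_real[OF _ _ int, of "B * (KQ * (K * (K * B * (t - s))))" "{}"] B0 KQ(1) K(1) st
      by simp
    moreover have "norm (d \<bullet> (Q *v d)) \<le> KQ * (K * B * (t - s))\<^sup>2"
    proof -
      have "norm (d \<bullet> (Q *v d)) \<le> norm d * norm (Q *v d)" by (simp add: Cauchy_Schwarz_ineq2)
      also have "\<dots> \<le> norm d * (KQ * norm d)" using KQ(2) by (intro mult_left_mono) auto
      also have "\<dots> = KQ * (norm d)\<^sup>2" by (simp add: power2_eq_square)
      also have "\<dots> \<le> KQ * (K * B * (t - s))\<^sup>2" using d KQ(1) by (intro mult_left_mono power_mono) auto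
      finally show ?thesis .
    qed
    moreover have "v t \<bullet> (Q *v v t) - v s \<bullet> (Q *v v s) = 2 * (v s \<bullet> (Q *v d)) + d \<bullet> (Q *v d)"
    proof -
      have "v t = v s + d" by (simp add: d_def)
      then show ?thesis using Q_symmetric[of d "v s"]
        by (simp add: matrix_vector_right_distrib inner_add_left inner_add_right)
    qed
    ultimately have "\<bar>v t \<bullet> (Q *v v t) - v s \<bullet> (Q *v v s)\<bar>
        \<le> 2 * (B * (KQ * (K * (K * B * (t - s)))) * (t - s)) + KQ * (K * B * (t - s))\<^sup>2"
      unfolding real_norm_def by linarith
    then show ?thesis by (simp add: power2_eq_square algebra_simps)
  qed
  then show ?thesis by (rule quadratic_if_constant[OF ab])
qed

lemma boundary_form_zero:
  assumes "Re \<mu> = 0"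
  shows "cdot c ((hstack (cmat_adjoint (\<Psi> \<mu> b)) (mat 1) ** diag2 Q (- Q) ** vstack (\<Psi> \<mu> b) (mat 1)) *v c) = 0"
proof -
  have neg: "(- Q) *v y = - (Q *v y)" for y
    by (simp add: matrix_vector_mult_def vec_eq_iff sum_negf)
  have "(hstack (cmat_adjoint (\<Psi> \<mu> b)) (mat 1) ** diag2 Q (- Q) ** vstack (\<Psi> \<mu> b) (mat 1)) *v c
      = cmat_adjoint (\<Psi> \<mu> b) *v (Q *v (\<Psi> \<mu> b *v c)) - Q *v c"
    by (simp add: vstack_mult hstack_mult diag2_mult neg flip: matrix_vector_mul_assoc)
  moreover have "cdot c (x - y) = cdot c x - cdot c y" for x y
    by (simp add: cdot_def algebra_simps sum_subtractf)
  moreover have "cdot c (cmat_adjoint (\<Psi> \<mu> b) *v y) = cdot (\<Psi> \<mu> b *v c) y" for y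
  proof -
    have "cmat_adjoint (cmat_adjoint M) = M" for M :: "complex ^ ('N \<times> 'n) ^ ('N \<times> 'n)"
      by (simp add: cmat_adjoint_def vec_eq_iff)
    then show ?thesis by (simp add: cdot_adjoint)
  qed
  ultimately show ?thesis
    using Q_conserved[OF assms fundamental_solution_solves, of c] by (simp add: cdot_Q \<Psi>_a)
qed

end

subsection \<open>The state space and compactness of the inverse\<close>

definition scf :: "complex \<Rightarrow> (real \<Rightarrow> complex ^ 'n) \<Rightarrow> real \<Rightarrow> complex ^ 'n" where
  "scf c x = (\<lambda>\<zeta>. c *s x \<zeta>)"

lemma scf_of_real: "scf (complex_of_real r) x = (\<lambda>\<zeta>. r *\<^sub>R x \<zeta>)"
  by (simp add: scf_def fun_eq_iff vec_eq_iff flip: scaleR_conv_of_real)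

lemma scf_closed: "x \<in> L2 a b \<Longrightarrow> scf c x \<in> L2 a b"
  unfolding scf_def by (rule L2_linear[OF bounded_linear_vector_scale])

lemma integrable_cdot:
  assumes f: "f \<in> L2 a b" and g: "g \<in> L2 a b"
  shows "integrable (lebesgue_on {a<..<b}) (\<lambda>\<zeta>. cdot (f \<zeta>) (g \<zeta>))"
proof -
  obtain K where K: "0 < K" "\<And>x y :: complex ^ 'a. norm (cdot x y) \<le> norm x * norm y * K"
    using bounded_bilinear.pos_bounded[OF bounded_bilinear_cdot] by blast
  show ?thesis
  proof (rule Bochner_Integration.integrable_bound)
    show "integrable (lebesgue_on {a<..<b}) (\<lambda>\<zeta>. K * ((norm (f \<zeta>))\<^sup>2 + (norm (g \<zeta>))\<^sup>2))"
      using f g by (simp add: L2_def)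
    show "(\<lambda>\<zeta>. cdot (f \<zeta>) (g \<zeta>)) \<in> borel_measurable (lebesgue_on {a<..<b})"
      using f g unfolding L2_def
      by (intro borel_measurable_continuous_Pair[where H = cdot]
          bounded_bilinear.continuous_on[OF bounded_bilinear_cdot] continuous_intros) auto
    have "norm (cdot x y) \<le> norm (K * ((norm x)\<^sup>2 + (norm y)\<^sup>2))" for x y :: "complex ^ 'a"
    proof -
      have "norm x * norm y \<le> (norm x)\<^sup>2 + (norm y)\<^sup>2"
        using sum_squares_bound[of "norm x" "norm y"] mult_nonneg_nonneg[OF norm_ge_zero[of x] norm_ge_zero[of y]]
        by linarith
      then have "norm x * norm y * K \<le> ((norm x)\<^sup>2 + (norm y)\<^sup>2) * K" using K(1) by (intro mult_right_mono) auto
      moreover have "norm (K * ((norm x)\<^sup>2 + (norm y)\<^sup>2)) = ((norm x)\<^sup>2 + (norm y)\<^sup>2) * K"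
        using K(1) by simp
      ultimately show ?thesis using K(2)[of x y] by linarith
    qed
    then show "AE \<zeta> in lebesgue_on {a<..<b}. norm (cdot (f \<zeta>) (g \<zeta>))
        \<le> norm (K * ((norm (f \<zeta>))\<^sup>2 + (norm (g \<zeta>))\<^sup>2))"
      by (intro always_eventually) blast
  qed
qed

lemma L2_norm_sq_integral:
  assumes "f \<in> L2 a b"
  shows "((\<lambda>\<zeta>. (norm (f \<zeta>))\<^sup>2) has_integral (LINT \<zeta>|lebesgue_on {a<..<b}. (norm (f \<zeta>))\<^sup>2)) {a..b}"
proof -
  have "((\<lambda>\<zeta>. (norm (f \<zeta>))\<^sup>2) has_integral (LINT \<zeta>|lebesgue_on {a<..<b}. (norm (f \<zeta>))\<^sup>2)) {a<..<b}"
    using assms by (intro has_integral_integral_lebesgue_on) (auto simp: L2_def)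
  then show ?thesis by (simp add: has_integral_Icc_iff_Ioo)
qed

context port_hamiltonian
begin

definition ipX :: "(real \<Rightarrow> complex ^ 'n) \<Rightarrow> (real \<Rightarrow> complex ^ 'n) \<Rightarrow> real" where
  "ipX f g = Re (innerX a b \<H> f g)"

lemma ipX_eq:
  assumes "f \<in> L2 a b" "g \<in> L2 a b"
  shows "ipX f g = 1 / 2 * (LINT \<zeta>|lebesgue_on {a<..<b}. g \<zeta> \<bullet> (\<H> \<zeta> *v f \<zeta>))"
    and "integrable (lebesgue_on {a<..<b}) (\<lambda>\<zeta>. g \<zeta> \<bullet> (\<H> \<zeta> *v f \<zeta>))"
proof -
  have int: "integrable (lebesgue_on {a<..<b}) (\<lambda>\<zeta>. cdot (g \<zeta>) (\<H> \<zeta> *v f \<zeta>))"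
    by (rule integrable_cdot[OF assms(2) L2_H[OF assms(1)]])
  show "integrable (lebesgue_on {a<..<b}) (\<lambda>\<zeta>. g \<zeta> \<bullet> (\<H> \<zeta> *v f \<zeta>))"
    unfolding Re_cdot[symmetric] by (rule integrable_Re[OF int])
  have "(LINT \<zeta>|lebesgue_on {a<..<b}. g \<zeta> \<bullet> (\<H> \<zeta> *v f \<zeta>))
      = Re (LINT \<zeta>|lebesgue_on {a<..<b}. cdot (g \<zeta>) (\<H> \<zeta> *v f \<zeta>))"
    unfolding Re_cdot[symmetric] by (rule integral_Re[OF int])
  then show "ipX f g = 1 / 2 * (LINT \<zeta>|lebesgue_on {a<..<b}. g \<zeta> \<bullet> (\<H> \<zeta> *v f \<zeta>))"
    by (simp add: ipX_def innerX_def)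
qed

text \<open>The vector space is the type of all functions, on which the integrals are meaningless in
  general; hence the carrier set in the abstract locale.\<close>

sublocale L: complex_semi_inner_space scf "L2 a b" ipX
proof (unfold_locales)
  show "scf c (x + y) = scf c x + scf c y" "scf (c + d) x = scf c x + scf d x"
    "scf c (scf d x) = scf (c * d) x" "scf 1 x = x" for c d and x y :: "real \<Rightarrow> complex ^ 'n"
    by (simp_all add: scf_def fun_eq_iff vec_eq_iff algebra_simps)
  show "0 \<in> L2 a b" by (simp add: zero_fun_def L2_zero)
  show "x + y \<in> L2 a b" if "x \<in> L2 a b" "y \<in> L2 a b" for x y
    using L2_add[OF that] by (simp add: plus_fun_def)
  show "scf c x \<in> L2 a b" if "x \<in> L2 a b" for c x using that by (rule scf_closed)
  show "ipX (x + y) z = ipX x z + ipX y z" if "x \<in> L2 a b" "y \<in> L2 a b" "z \<in> L2 a b" for x y z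
  proof -
    have "x + y \<in> L2 a b" using L2_add[OF that(1,2)] by (simp add: plus_fun_def)
    then show ?thesis
      using that by (simp add: ipX_eq matrix_vector_right_distrib inner_add_right algebra_simps)
  qed
  show "ipX x y = ipX y x" if "x \<in> L2 a b" "y \<in> L2 a b" for x y
  proof -
    have "(LINT \<zeta>|lebesgue_on {a<..<b}. y \<zeta> \<bullet> (\<H> \<zeta> *v x \<zeta>)) = (LINT \<zeta>|lebesgue_on {a<..<b}. x \<zeta> \<bullet> (\<H> \<zeta> *v y \<zeta>))"
    proof (rule integral_cong_AE)
      show "AE \<zeta> in lebesgue_on {a<..<b}. y \<zeta> \<bullet> (\<H> \<zeta> *v x \<zeta>) = x \<zeta> \<bullet> (\<H> \<zeta> *v y \<zeta>)"
        using H_coercive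
      proof eventually_elim
        case (elim \<zeta>)
        have "y \<zeta> \<bullet> (\<H> \<zeta> *v x \<zeta>) = (\<H> \<zeta> *v y \<zeta>) \<bullet> x \<zeta>"
          using elim cdot_adjoint[of "y \<zeta>" "\<H> \<zeta>" "x \<zeta>"] by (simp flip: Re_cdot)
        then show ?case by (simp add: inner_commute)
      qed
    qed (use ipX_eq(2) that in auto)
    then show ?thesis using that by (simp add: ipX_eq)
  qed
  show "ipX (scf (complex_of_real r) x) y = r * ipX x y" if "x \<in> L2 a b" "y \<in> L2 a b" for r x y
  proof -
    have "A' *v (r *\<^sub>R z) = r *\<^sub>R (A' *v z)" for A' :: "complex ^ 'n ^ 'n" and z
      by (rule linear_scale[OF bounded_linear.linear[OF bounded_linear_matrix_vector]])
    then show ?thesis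
      using that scf_closed[OF that(1), of "complex_of_real r"] by (simp add: ipX_eq) (simp add: scf_of_real)
  qed
  show "ipX (scf c x) (scf c x) = (cmod c)\<^sup>2 * ipX x x" if "x \<in> L2 a b" for c x
  proof -
    have "(c *s z) \<bullet> (A' *v (c *s z)) = (cmod c)\<^sup>2 * (z \<bullet> (A' *v z))" for A' :: "complex ^ 'n ^ 'n" and z
    proof -
      have "A' *v (c *s z) = c *s (A' *v z)"
        by (simp add: matrix_vector_mult_def vec_eq_iff sum_distrib_left algebra_simps)
      then have "(c *s z) \<bullet> (A' *v (c *s z)) = Re ((cnj c * c) * cdot z (A' *v z))"
        by (simp add: cdot_scale flip: Re_cdot)
      also have "cnj c * c = of_real ((cmod c)\<^sup>2)"
        by (metis complex_norm_square mult.commute)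
      finally show ?thesis by (simp add: Re_cdot del: of_real_power)
    qed
    then show ?thesis
      using that scf_closed[OF that, of c] by (simp add: ipX_eq) (simp add: scf_def)
  qed
  show "0 \<le> ipX x x" if "x \<in> L2 a b" for x
  proof -
    have "0 \<le> (LINT \<zeta>|lebesgue_on {a<..<b}. x \<zeta> \<bullet> (\<H> \<zeta> *v x \<zeta>))"
    proof (rule integral_nonneg_AE)
      show "AE \<zeta> in lebesgue_on {a<..<b}. 0 \<le> x \<zeta> \<bullet> (\<H> \<zeta> *v x \<zeta>)"
        using H_coercive
      proof eventually_elim
        case (elim \<zeta>)
        have "0 \<le> m * (norm (x \<zeta>))\<^sup>2" using m_pos by simp
        also have "\<dots> \<le> x \<zeta> \<bullet> (\<H> \<zeta> *v x \<zeta>)" using elim by (simp flip: Re_cdot)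
        finally show ?case .
      qed
    qed
    then show ?thesis using that by (simp add: ipX_eq)
  qed
qed

lemma nrm_eq: "L.nrm = normX a b \<H>"
  by (simp add: fun_eq_iff L.nrm_def normX_def ipX_def)

lemma nrm_lower:
  assumes "f \<in> L2 a b"
  shows "m / 2 * (LINT \<zeta>|lebesgue_on {a<..<b}. (norm (f \<zeta>))\<^sup>2) \<le> (L.nrm f)\<^sup>2"
proof -
  have "(LINT \<zeta>|lebesgue_on {a<..<b}. m * (norm (f \<zeta>))\<^sup>2) \<le> (LINT \<zeta>|lebesgue_on {a<..<b}. f \<zeta> \<bullet> (\<H> \<zeta> *v f \<zeta>))"
  proof (rule integral_mono_AE)
    show "integrable (lebesgue_on {a<..<b}) (\<lambda>\<zeta>. m * (norm (f \<zeta>))\<^sup>2)" using assms by (simp add: L2_def)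
    show "integrable (lebesgue_on {a<..<b}) (\<lambda>\<zeta>. f \<zeta> \<bullet> (\<H> \<zeta> *v f \<zeta>))" by (rule ipX_eq(2)[OF assms assms])
    show "AE \<zeta> in lebesgue_on {a<..<b}. m * (norm (f \<zeta>))\<^sup>2 \<le> f \<zeta> \<bullet> (\<H> \<zeta> *v f \<zeta>)"
      using H_coercive by eventually_elim (simp flip: Re_cdot)
  qed
  then show ?thesis using assms by (simp add: L.nrm_sq ipX_eq)
qed

text \<open>Lets uniform convergence of trajectories pass to the norm of the state space.\<close>

lemma nrm_upper:
  obtains C where "0 \<le> C"
    "\<And>f e. f \<in> L2 a b \<Longrightarrow> 0 \<le> e \<Longrightarrow> AE \<zeta> in lebesgue_on {a<..<b}. norm (f \<zeta>) \<le> e \<Longrightarrow> L.nrm f \<le> C * e"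
proof -
  obtain C where C: "\<forall>\<zeta>\<in>{a<..<b}. \<forall>v. norm (\<H> \<zeta> *v v) \<le> C * norm v" using H_mult_bound by blast
  define C' where "C' = \<bar>C\<bar>"
  define M where "M = 1 / 2 * (measure (lebesgue_on {a<..<b}) (space (lebesgue_on {a<..<b})) * C')"
  interpret finite_measure "lebesgue_on {a<..<b}" by (rule finite_measure_lebesgue_on) simp
  have M: "0 \<le> M" by (simp add: M_def C'_def)
  have "L.nrm f \<le> sqrt M * e"
    if f: "f \<in> L2 a b" and e: "0 \<le> e" and le: "AE \<zeta> in lebesgue_on {a<..<b}. norm (f \<zeta>) \<le> e" for f e
  proof -
    have "(LINT \<zeta>|lebesgue_on {a<..<b}. f \<zeta> \<bullet> (\<H> \<zeta> *v f \<zeta>)) \<le> (LINT \<zeta>|lebesgue_on {a<..<b}. C' * e\<^sup>2)"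
    proof (rule integral_mono_AE)
      show "integrable (lebesgue_on {a<..<b}) (\<lambda>\<zeta>. f \<zeta> \<bullet> (\<H> \<zeta> *v f \<zeta>))" by (rule ipX_eq(2)[OF f f])
      have "AE \<zeta> in lebesgue_on {a<..<b}. \<forall>v. norm (\<H> \<zeta> *v v) \<le> C * norm v" using C by (intro AE_I2) simp
      with le show "AE \<zeta> in lebesgue_on {a<..<b}. f \<zeta> \<bullet> (\<H> \<zeta> *v f \<zeta>) \<le> C' * e\<^sup>2"
      proof eventually_elim
        case (elim \<zeta>)
        have "f \<zeta> \<bullet> (\<H> \<zeta> *v f \<zeta>) \<le> norm (f \<zeta>) * norm (\<H> \<zeta> *v f \<zeta>)" by (rule norm_cauchy_schwarz)
        also have "norm (\<H> \<zeta> *v f \<zeta>) \<le> C' * norm (f \<zeta>)"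
        proof -
          have "norm (\<H> \<zeta> *v f \<zeta>) \<le> C * norm (f \<zeta>)" using elim by blast
          also have "\<dots> \<le> C' * norm (f \<zeta>)" by (intro mult_right_mono) (auto simp: C'_def)
          finally show ?thesis .
        qed
        then have "norm (f \<zeta>) * norm (\<H> \<zeta> *v f \<zeta>) \<le> norm (f \<zeta>) * (C' * norm (f \<zeta>))"
          by (intro mult_left_mono) auto
        also have "\<dots> = C' * (norm (f \<zeta>))\<^sup>2" by (simp add: power2_eq_square)
        also have "\<dots> \<le> C' * e\<^sup>2" using elim by (intro mult_left_mono power_mono) (auto simp: C'_def)
        finally show ?case .
      qed
    qed simp
    then have "(L.nrm f)\<^sup>2 \<le> M * e\<^sup>2"
      using f by (simp add: L.nrm_sq ipX_eq M_def)
    also have "\<dots> = (sqrt M * e)\<^sup>2" using M by (simp add: power_mult_distrib)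
    finally show ?thesis using M e by (auto intro: power2_le_imp_le)
  qed
  then show thesis using that[of "sqrt M"] M by simp
qed

lemma nrm_eq_0_iff:
  assumes "f \<in> L2 a b" shows "L.nrm f = 0 \<longleftrightarrow> ae_eq a b f (\<lambda>_. 0)"
proof
  assume "L.nrm f = 0"
  then have "m / 2 * (LINT \<zeta>|lebesgue_on {a<..<b}. (norm (f \<zeta>))\<^sup>2) \<le> 0"
    using nrm_lower[OF assms] by simp
  then have "(LINT \<zeta>|lebesgue_on {a<..<b}. (norm (f \<zeta>))\<^sup>2) \<le> 0"
    using m_pos by (simp add: mult_le_0_iff)
  moreover have "0 \<le> (LINT \<zeta>|lebesgue_on {a<..<b}. (norm (f \<zeta>))\<^sup>2)" by simp
  ultimately have "(LINT \<zeta>|lebesgue_on {a<..<b}. (norm (f \<zeta>))\<^sup>2) = 0" by linarith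
  moreover have "integrable (lebesgue_on {a<..<b}) (\<lambda>\<zeta>. (norm (f \<zeta>))\<^sup>2)" using assms by (simp add: L2_def)
  ultimately have "AE \<zeta> in lebesgue_on {a<..<b}. (norm (f \<zeta>))\<^sup>2 = 0"
    by (subst (asm) integral_nonneg_eq_0_iff_AE) auto
  then show "ae_eq a b f (\<lambda>_. 0)" by (simp add: ae_eq_def)
next
  assume "ae_eq a b f (\<lambda>_. 0)"
  then have "AE \<zeta> in lebesgue_on {a<..<b}. norm (f \<zeta>) \<le> 0" by (simp add: ae_eq_def)
  then obtain C where "L.nrm f \<le> C * 0" using nrm_upper assms by (metis order_refl)
  then show "L.nrm f = 0" using assms by (simp add: L.nrm_zero_iff_le)
qed

lemma eqv_iff: "x \<in> L2 a b \<Longrightarrow> y \<in> L2 a b \<Longrightarrow> L.eqv x y \<longleftrightarrow> ae_eq a b x y"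
  using nrm_eq_0_iff[of "x - y"] L.diff_closed[of x y] by (simp add: L.eqv_def ae_eq_def)

text \<open>From \<open>y \<le> 1 / \<eta> + \<eta> * y\<^sup>2\<close>, a form of Cauchy-Schwarz
  with a free weight: \<eta> is chosen small against \<open>S\<close> first, then
  \<open>t - s\<close> small against \<eta>. This gives equicontinuity from
  square-integrability.\<close>

lemma forcing_integral_bound:
  obtains K where "0 \<le> K"
    "\<And>f s t \<eta> S. f \<in> L2 a b \<Longrightarrow> (LINT \<zeta>|lebesgue_on {a<..<b}. (norm (f \<zeta>))\<^sup>2) \<le> S \<Longrightarrow> a \<le> s \<Longrightarrow> s \<le> t \<Longrightarrow> t \<le> b \<Longrightarrow> 0 < \<eta> \<Longrightarrow>
      integral {s..t} (\<lambda>\<tau>. norm (forcing (f \<tau>))) \<le> K * ((t - s) / \<eta> + \<eta> * S)"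
proof -
  obtain K where K: "0 \<le> K" "\<And>y. norm (forcing y) \<le> K * norm y"
    using bounded_linear.nonneg_bounded[OF bounded_linear_forcing] by (auto simp: mult.commute)
  have "integral {s..t} (\<lambda>\<tau>. norm (forcing (f \<tau>))) \<le> K * ((t - s) / \<eta> + \<eta> * S)"
    if f: "f \<in> L2 a b" and S: "(LINT \<zeta>|lebesgue_on {a<..<b}. (norm (f \<zeta>))\<^sup>2) \<le> S"
      and st: "a \<le> s" "s \<le> t" "t \<le> b" and \<eta>: "0 < \<eta>" for f s t \<eta> S
  proof -
    have sub: "{s..t} \<subseteq> {a..b}" using st by auto
    have I: "((\<lambda>\<zeta>. (norm (f \<zeta>))\<^sup>2) has_integral (LINT \<zeta>|lebesgue_on {a<..<b}. (norm (f \<zeta>))\<^sup>2)) {a..b}"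
      by (rule L2_norm_sq_integral[OF f])
    have sq: "(\<lambda>\<zeta>. (norm (f \<zeta>))\<^sup>2) integrable_on {s..t}"
      by (rule integrable_on_subinterval[OF has_integral_integrable[OF I] sub])
    have "(\<lambda>\<tau>. norm (forcing (f \<tau>))) integrable_on {a..b}"
      using L2_absolutely_integrable[OF L2_linear[OF bounded_linear_forcing f]]
      by (simp add: absolutely_integrable_on_def)
    then have "(\<lambda>\<tau>. norm (forcing (f \<tau>))) integrable_on {s..t}" using sub by (rule integrable_on_subinterval)
    moreover have "(\<lambda>\<tau>. K * (1 / \<eta> + \<eta> * (norm (f \<tau>))\<^sup>2)) integrable_on {s..t}"
      using sq by (intro integrable_on_mult_right integrable_add integrable_const_ivl)
    moreover have "norm (forcing (f \<tau>)) \<le> K * (1 / \<eta> + \<eta> * (norm (f \<tau>))\<^sup>2)" for \<tau>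
    proof -
      define y where "y = norm (f \<tau>)"
      have "2 * (\<eta> * y) * 1 \<le> (\<eta> * y)\<^sup>2 + 1\<^sup>2" by (rule sum_squares_bound)
      moreover have "0 \<le> \<eta> * y" using \<eta> by (simp add: y_def)
      ultimately have "\<eta> * y \<le> 1 + \<eta>\<^sup>2 * y\<^sup>2" by (simp add: power_mult_distrib)
      then have "y \<le> 1 / \<eta> + \<eta> * y\<^sup>2" using \<eta> by (simp add: field_simps power2_eq_square)
      then have "K * y \<le> K * (1 / \<eta> + \<eta> * y\<^sup>2)" using K(1) by (rule mult_left_mono)
      then show ?thesis using K(2)[of "f \<tau>"] by (simp add: y_def)
    qed
    ultimately have "integral {s..t} (\<lambda>\<tau>. norm (forcing (f \<tau>))) \<le> integral {s..t} (\<lambda>\<tau>. K * (1 / \<eta> + \<eta> * (norm (f \<tau>))\<^sup>2))"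
      by (intro integral_le) auto
    also have "\<dots> = K * ((t - s) / \<eta> + \<eta> * integral {s..t} (\<lambda>\<tau>. (norm (f \<tau>))\<^sup>2))"
      using sq st \<eta> by (simp add: Henstock_Kurzweil_Integration.integral_add integrable_on_mult_right integrable_const_ivl)
    also have "\<dots> \<le> K * ((t - s) / \<eta> + \<eta> * S)"
    proof -
      have "integral {s..t} (\<lambda>\<tau>. (norm (f \<tau>))\<^sup>2) \<le> integral {a..b} (\<lambda>\<tau>. (norm (f \<tau>))\<^sup>2)"
        using sq I sub by (intro integral_subset_le) auto
      also have "\<dots> \<le> S" using I S by (simp add: integral_unique)
      finally show ?thesis using K(1) \<eta> by (intro mult_left_mono add_left_mono) auto
    qed
    finally show ?thesis .
  qed
  then show thesis using that K(1) by blast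
qed

text \<open>Arzela-Ascoli is applied to the trajectories: the \<open>xs n\<close> need not be
  continuous, as the inverse of \<open>\<H>\<close> is merely measurable. Multiplying the uniform
  limit by this inverse gives the limit in the state space.\<close>

lemma compact_embedding:
  assumes inv: "invertible (\<Q> 0)" and D: "\<And>n. xs n \<in> D" and bound: "\<And>n. L.nrm (A (xs n)) \<le> C"
  shows "\<exists>(r :: nat \<Rightarrow> nat) y. strict_mono r \<and> y \<in> L2 a b \<and> (\<lambda>n. L.nrm (xs (r n) - y)) \<longlonglongrightarrow> 0"
proof -
  have AL2: "A (xs n) \<in> L2 a b" for n using phs_op_L2 D_D(2)[OF D] .
  define S where "S = 2 * C\<^sup>2 / m"
  have S: "(LINT \<zeta>|lebesgue_on {a<..<b}. (norm (A (xs n) \<zeta>))\<^sup>2) \<le> S" for n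
  proof -
    have "m / 2 * (LINT \<zeta>|lebesgue_on {a<..<b}. (norm (A (xs n) \<zeta>))\<^sup>2) \<le> C\<^sup>2"
      using nrm_lower[OF AL2[of n]] power_mono[OF bound[of n] L.nrm_ge_0[OF AL2[of n]], of 2] by linarith
    then show ?thesis using m_pos by (simp add: S_def field_simps)
  qed
  have S0: "0 \<le> S" using m_pos by (simp add: S_def)
  obtain C1 where C1: "0 \<le> C1"
    "\<And>x t. x \<in> D \<Longrightarrow> t \<in> {a..b} \<Longrightarrow> norm (traj x t) \<le> C1 * integral {a..b} (\<lambda>s. norm (forcing (A x s)))"
    by (rule traj_bound[OF inv]) (rule that)
  obtain K where K: "0 \<le> K"
    "\<And>f s t \<eta> S. f \<in> L2 a b \<Longrightarrow> (LINT \<zeta>|lebesgue_on {a<..<b}. (norm (f \<zeta>))\<^sup>2) \<le> S \<Longrightarrow> a \<le> s \<Longrightarrow> s \<le> t \<Longrightarrow> t \<le> b \<Longrightarrow> 0 < \<eta> \<Longrightarrow>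
      integral {s..t} (\<lambda>\<tau>. norm (forcing (f \<tau>))) \<le> K * ((t - s) / \<eta> + \<eta> * S)"
    by (rule forcing_integral_bound) (rule that)
  define B where "B = C1 * (K * ((b - a) + S))"
  have B: "norm (traj (xs n) t) \<le> B" if "t \<in> {a..b}" for n t
  proof -
    have "integral {a..b} (\<lambda>s. norm (forcing (A (xs n) s))) \<le> K * ((b - a) / 1 + 1 * S)"
      using ab by (intro K(2) AL2 S) auto
    then have "C1 * integral {a..b} (\<lambda>s. norm (forcing (A (xs n) s))) \<le> B"
      unfolding B_def using C1(1) by (intro mult_left_mono) auto
    then show ?thesis using C1(2)[OF D that] order_trans by blast
  qed
  obtain K1 where K1: "0 \<le> K1" "\<And>v. norm (comp 0 0 *v v) \<le> K1 * norm v"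
    using bounded_linear.nonneg_bounded[OF bounded_linear_matrix_vector, of "comp 0 0"] by (auto simp: mult.commute)
  have comp0: "comp 0 s *v v = comp 0 0 *v v" for s v
    using comp_eq[of 0 s v] by (simp add: forcing_zero)
  have B0: "0 \<le> B" using B[of a 0] ab norm_ge_zero order_trans by (metis atLeastAtMost_iff less_imp_le order_refl)
  have diff: "norm (traj (xs n) t - traj (xs n) s) \<le> K1 * B * (t - s) + K * ((t - s) / \<eta> + \<eta> * S)"
    if st: "a \<le> s" "s \<le> t" "t \<le> b" and \<eta>: "0 < \<eta>" for n s t \<eta>
  proof -
    define G where "G \<tau> = comp 0 \<tau> *v traj (xs n) \<tau> + forcing (A (xs n) \<tau>)" for \<tau>
    have G: "(G has_integral (traj (xs n) u - traj (xs n) a)) {a..u}" if "u \<in> {a..b}" for u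
      using traj_solves(1)[OF D_D(1,2)[OF D[of n]], of 0] that unfolding solves_def G_def by simp
    have sub: "{s..t} \<subseteq> {a..t}" "{s..t} \<subseteq> {a..b}" using st by auto
    have Gst: "G integrable_on {s..t}"
      using G[of t] st by (intro integrable_on_subinterval[OF _ sub(1)]) auto
    have "integral {a..s} G + integral {s..t} G = integral {a..t} G"
      using G[of t] st by (intro Henstock_Kurzweil_Integration.integral_combine) auto
    then have eq: "traj (xs n) t - traj (xs n) s = integral {s..t} G"
      using integral_unique[OF G[of s]] integral_unique[OF G[of t]] st by (simp add: algebra_simps)
    have "(\<lambda>\<tau>. norm (forcing (A (xs n) \<tau>))) integrable_on {a..b}"
      using L2_absolutely_integrable[OF L2_linear[OF bounded_linear_forcing AL2]]
      by (simp add: absolutely_integrable_on_def)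
    then have int: "(\<lambda>\<tau>. norm (forcing (A (xs n) \<tau>))) integrable_on {s..t}" using sub(2) by (rule integrable_on_subinterval)
    have "norm (integral {s..t} G) \<le> integral {s..t} (\<lambda>\<tau>. K1 * B + norm (forcing (A (xs n) \<tau>)))"
    proof (rule Henstock_Kurzweil_Integration.integral_norm_bound_integral[OF Gst])
      show "(\<lambda>\<tau>. K1 * B + norm (forcing (A (xs n) \<tau>))) integrable_on {s..t}"
        using int by (intro integrable_add integrable_const_ivl)
      fix \<tau> assume "\<tau> \<in> {s..t}"
      then have "norm (traj (xs n) \<tau>) \<le> B" using sub by (intro B) auto
      then have "K1 * norm (traj (xs n) \<tau>) \<le> K1 * B" using K1(1) by (rule mult_left_mono)
      then show "norm (G \<tau>) \<le> K1 * B + norm (forcing (A (xs n) \<tau>))"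
        unfolding G_def comp0[of \<tau>]
        using norm_triangle_ineq[of "comp 0 0 *v traj (xs n) \<tau>" "forcing (A (xs n) \<tau>)"] K1(2)[of "traj (xs n) \<tau>"]
        by linarith
    qed
    also have "\<dots> = K1 * B * (t - s) + integral {s..t} (\<lambda>\<tau>. norm (forcing (A (xs n) \<tau>)))"
      using int st by (simp add: Henstock_Kurzweil_Integration.integral_add integrable_const_ivl)
    also have "integral {s..t} (\<lambda>\<tau>. norm (forcing (A (xs n) \<tau>))) \<le> K * ((t - s) / \<eta> + \<eta> * S)"
      by (rule K(2)[OF AL2 S st \<eta>])
    finally show ?thesis unfolding eq by simp
  qed
  have equi: "\<exists>d. 0 < d \<and> (\<forall>n y. y \<in> {a..b} \<and> norm (x - y) < d \<longrightarrow> norm (traj (xs n) x - traj (xs n) y) < e)"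
    if x: "x \<in> {a..b}" and e: "0 < e" for x e
  proof -
    \<comment> \<open>Makes the part of the estimate that does not shrink with \<open>t - s\<close>
      at most \<open>e / 2\<close>; adding one avoids division by zero. The other half is left to
      \<open>d\<close>.\<close>
    define \<eta> where "\<eta> = e / 2 / (K * S + 1)"
    have KS: "0 < K * S + 1" using K(1) S0 by (intro add_nonneg_pos) auto
    have \<eta>: "0 < \<eta>" using e KS by (simp add: \<eta>_def)
    define L where "L = K1 * B + K / \<eta> + 1"
    have L: "0 < L" unfolding L_def using K1(1) B0 K(1) \<eta> by (intro add_nonneg_pos add_nonneg_nonneg) auto
    define d where "d = e / (2 * L)"
    have "norm (traj (xs n) x - traj (xs n) y) < e" if y: "y \<in> {a..b}" and xy: "norm (x - y) < d" for n y
    proof -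
      define s where "s = min x y"
      define t where "t = max x y"
      have st: "a \<le> s" "s \<le> t" "t \<le> b" "t - s = norm (x - y)" using x y by (auto simp: s_def t_def)
      have "norm (traj (xs n) x - traj (xs n) y) = norm (traj (xs n) t - traj (xs n) s)"
        by (auto simp: s_def t_def min_def max_def norm_minus_commute)
      also have "\<dots> \<le> K1 * B * (t - s) + K * ((t - s) / \<eta> + \<eta> * S)" by (rule diff[OF st(1-3) \<eta>])
      also have "\<dots> = (K1 * B + K / \<eta>) * (t - s) + K * S * \<eta>" by (simp add: algebra_simps)
      also have "\<dots> \<le> L * (t - s) + (K * S + 1) * \<eta>"
      proof (rule add_mono)
        show "(K1 * B + K / \<eta>) * (t - s) \<le> L * (t - s)"
          using st(2) by (intro mult_right_mono) (auto simp: L_def)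
        show "K * S * \<eta> \<le> (K * S + 1) * \<eta>" using \<eta> by (intro mult_right_mono) auto
      qed
      also have "(K * S + 1) * \<eta> = e / 2"
      proof -
        have "c * (x / c) = x" if "0 < c" for c x :: real using that by simp
        then show ?thesis unfolding \<eta>_def using KS by blast
      qed
      also have "L * (t - s) < L * d" using xy st(4) L by simp
      then have "L * (t - s) + e / 2 < e" using L by (simp add: d_def)
      finally show ?thesis .
    qed
    moreover have "0 < d" using e L by (simp add: d_def)
    ultimately show ?thesis by blast
  qed
  have "\<exists>g k. continuous_on {a..b} g \<and> strict_mono (k :: nat \<Rightarrow> nat) \<and>
      (\<forall>e>0. \<exists>N. \<forall>n x. n \<ge> N \<and> x \<in> {a..b} \<longrightarrow> norm (traj (xs (k n)) x - g x) < e)"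
    by (rule Arzela_Ascoli[of "{a..b}" "\<lambda>n. traj (xs n)" B, OF _ B equi]) auto
  then obtain g k where g: "continuous_on {a..b} g" and k: "strict_mono (k :: nat \<Rightarrow> nat)" and
    conv: "\<forall>e>0. \<exists>N. \<forall>n x. n \<ge> N \<and> x \<in> {a..b} \<longrightarrow> norm (traj (xs (k n)) x - g x) < e"
    by blast
  have y: "state g \<in> L2 a b"
    unfolding state_def by (intro L2_H_inverse L2_linear[OF bounded_linear_block] L2_continuous g)
  obtain Cn where Cn: "0 \<le> Cn"
    "\<And>f e. f \<in> L2 a b \<Longrightarrow> 0 \<le> e \<Longrightarrow> AE \<zeta> in lebesgue_on {a<..<b}. norm (f \<zeta>) \<le> e \<Longrightarrow> L.nrm f \<le> Cn * e"
    by (rule nrm_upper) (rule that)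
  obtain K3 where K3: "0 \<le> K3" "\<And>v :: complex ^ ('N \<times> 'n). norm (block 0 v) \<le> K3 * norm v"
    using bounded_linear.nonneg_bounded[OF bounded_linear_block, of 0] by (auto simp: mult.commute)
  \<comment> \<open>The bound \<open>1 / m\<close> for the inverse of \<open>\<H>\<close> turns
    uniform closeness of trajectories into closeness of states almost everywhere.\<close>
  have close: "L.nrm (xs n - state g) \<le> Cn * (1 / m * (K3 * e))"
    if e: "0 < e" and near: "\<forall>x\<in>{a..b}. norm (traj (xs n) x - g x) < e" for n e
  proof (rule Cn(2))
    show "xs n - state g \<in> L2 a b" using D_D(1)[OF D[of n]] y by simp
    show "0 \<le> 1 / m * (K3 * e)" using m_pos K3(1) e by simp
    have near': "AE \<zeta> in lebesgue_on {a<..<b}. norm (traj (xs n) \<zeta> - g \<zeta>) < e"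
      using near by (intro AE_I2) simp
    have "AE \<zeta> in lebesgue_on {a<..<b}. xs n \<zeta> = state (traj (xs n)) \<zeta>"
      using traj_solves(2)[OF D_D(1,2)[OF D[of n]]] by (simp add: ae_eq_def)
    then show "AE \<zeta> in lebesgue_on {a<..<b}. norm ((xs n - state g) \<zeta>) \<le> 1 / m * (K3 * e)"
      using H_inverse near'
    proof eventually_elim
      case (elim \<zeta>)
      have "(xs n - state g) \<zeta> = matrix_inv (\<H> \<zeta>) *v block 0 (traj (xs n) \<zeta> - g \<zeta>)"
        using elim(1) by (simp add: state_def matrix_vector_mult_diff_distrib
            linear_diff[OF bounded_linear.linear[OF bounded_linear_block]])
      then have "norm ((xs n - state g) \<zeta>) \<le> 1 / m * norm (block 0 (traj (xs n) \<zeta> - g \<zeta>))"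
        using elim(2) by simp
      also have "\<dots> \<le> 1 / m * (K3 * norm (traj (xs n) \<zeta> - g \<zeta>))"
        using K3(2) m_pos by (intro mult_left_mono) auto
      also have "\<dots> \<le> 1 / m * (K3 * e)" using elim(3) K3(1) m_pos by (intro mult_left_mono) auto
      finally show ?case .
    qed
  qed
  have "(\<lambda>n. L.nrm (xs (k n) - state g)) \<longlonglongrightarrow> 0"
  proof (rule LIMSEQ_I)
    fix r :: real assume r: "0 < r"
    define M where "M = Cn * (1 / m * K3) + 1"
    have M: "0 < M" unfolding M_def using Cn(1) K3(1) m_pos by (intro add_nonneg_pos) auto
    define e where "e = r / M"
    have e: "0 < e" using r M by (simp add: e_def)
    obtain n0 where n0: "\<forall>n x. n \<ge> n0 \<and> x \<in> {a..b} \<longrightarrow> norm (traj (xs (k n)) x - g x) < e"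
      using conv e by blast
    have "norm (L.nrm (xs (k n) - state g) - 0) < r" if "n \<ge> n0" for n
    proof -
      have "L.nrm (xs (k n) - state g) \<le> Cn * (1 / m * (K3 * e))" using n0 that by (intro close[OF e]) auto
      also have "\<dots> = (M - 1) * e" by (simp add: M_def)
      also have "\<dots> < M * e" using e by (intro mult_strict_right_mono) auto
      also have "\<dots> = r" using M by (simp add: e_def)
      finally show ?thesis using L.nrm_ge_0[of "xs (k n) - state g"] D_D(1)[OF D[of "k n"]] y by simp
    qed
    then show "\<exists>n0. \<forall>n\<ge>n0. norm (L.nrm (xs (k n) - state g) - 0) < r" by blast
  qed
  then show ?thesis using k y by blast
qed


lemma eigenvalue_iff: "is_eigenvalue a b D A \<mu> \<longleftrightarrow> (\<exists>x\<in>D. L.nrm x \<noteq> 0 \<and> L.eqv (A x) (scf \<mu> x))"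
proof -
  have "ae_eq a b (A x) (\<lambda>\<zeta>. \<mu> *s x \<zeta>) \<longleftrightarrow> L.eqv (A x) (scf \<mu> x)" if "x \<in> D" for x
    using eqv_iff[OF phs_op_L2[OF D_D(2)[OF that]] scf_closed[OF D_D(1)[OF that], of \<mu>]] by (simp add: scf_def)
  moreover have "ae_eq a b x (\<lambda>_. 0) \<longleftrightarrow> L.nrm x = 0" if "x \<in> D" for x
    using nrm_eq_0_iff[OF D_D(1)[OF that]] by simp
  ultimately show ?thesis by (auto simp: is_eigenvalue_def)
qed

section \<open>Transfer to the given semigroup\<close>

context
  fixes T
  assumes sg: "contraction_semigroup a b \<H> T" and gen: "is_generator a b \<H> T D A"
begin

lemma generator: "contraction_semigroup_generator scf (L2 a b) ipX T D A"
proof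
  note sg' = sg[unfolded contraction_semigroup_def]
  show cl: "T t x \<in> L2 a b" if "0 \<le> t" "x \<in> L2 a b" for t x using sg' that by simp
  show "L.eqv (T t (x + y)) (T t x + T t y)" if "0 \<le> t" "x \<in> L2 a b" "y \<in> L2 a b" for t x y
  proof -
    have "ae_eq a b (T t (x + y)) (T t x + T t y)" using sg' that by (simp add: plus_fun_def)
    then show ?thesis using that cl by (subst eqv_iff) auto
  qed
  show "L.eqv (T t (scf c x)) (scf c (T t x))" if "0 \<le> t" "x \<in> L2 a b" for t x c
  proof -
    have "ae_eq a b (T t (scf c x)) (scf c (T t x))" using sg' that by (simp add: scf_def)
    then show ?thesis using that cl by (subst eqv_iff) auto
  qed
  show "L.nrm (T t x) \<le> L.nrm x" if "0 \<le> t" "x \<in> L2 a b" for t x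
    using sg' that by (simp add: nrm_eq)
  show "L.eqv (T 0 x) x" if "x \<in> L2 a b" for x
    using sg' that cl by (subst eqv_iff) auto
  show "L.eqv (T (s + t) x) (T s (T t x))" if "0 \<le> s" "0 \<le> t" "x \<in> L2 a b" for s t x
    using sg' that cl by (subst eqv_iff) auto
  show "((\<lambda>h. L.nrm (T h x - x)) \<longlongrightarrow> 0) (at_right 0)" if "x \<in> L2 a b" for x
    using sg' that by (simp add: nrm_eq fun_diff_def)
  have der: "right_derivative_at_0 a b \<H> T x y \<longleftrightarrow>
      ((\<lambda>h. L.nrm (scf (complex_of_real (1 / h)) (T h x - x) - y)) \<longlongrightarrow> 0) (at_right 0)" for x y
    unfolding right_derivative_at_0_def scf_of_real nrm_eq fun_diff_def ..
  show "D = {x \<in> L2 a b. \<exists>y\<in>L2 a b.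
      ((\<lambda>h. L.nrm (scf (complex_of_real (1 / h)) (T h x - x) - y)) \<longlongrightarrow> 0) (at_right 0)}"
    using gen unfolding is_generator_def der by blast
  show "A x \<in> L2 a b" if "x \<in> D" for x using phs_op_L2 D_D(2)[OF that] .
  show "((\<lambda>h. L.nrm (scf (complex_of_real (1 / h)) (T h x - x) - A x)) \<longlongrightarrow> 0) (at_right 0)" if "x \<in> D" for x
    using gen that unfolding is_generator_def der by blast
qed

interpretation G: contraction_semigroup_generator scf "L2 a b" ipX T D A
  by (rule generator)

lemma asymptotically_stable_iff:
  "asymptotically_stable a b \<H> T \<longleftrightarrow> (\<forall>x\<in>L2 a b. ((\<lambda>t. L.nrm (T t x)) \<longlongrightarrow> 0) at_top)"
  by (simp add: asymptotically_stable_def nrm_eq)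

lemma semi_uniformly_stable_iff:
  "semi_uniformly_stable a b \<H> T D A \<longleftrightarrow>
    (\<exists>f :: real \<Rightarrow> real. (\<forall>t\<ge>0. 0 \<le> f t) \<and> (f \<longlongrightarrow> 0) at_top \<and>
      (\<forall>x\<in>D. \<forall>t\<ge>0. L.nrm (T t x) \<le> f t * sqrt ((L.nrm x)\<^sup>2 + (L.nrm (A x))\<^sup>2)))"
  by (simp add: semi_uniformly_stable_def graph_norm_def nrm_eq)

lemma no_eigenvalue_imp_compact:
  assumes "\<not> is_eigenvalue a b D A 0" shows "G.compact_inverse"
  unfolding G.compact_inverse_def
proof (intro allI impI)
  fix xs :: "nat \<Rightarrow> real \<Rightarrow> complex ^ 'n" and C
  assume "\<forall>n. xs n \<in> D \<and> L.nrm (A (xs n)) \<le> C"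
  then show "\<exists>(r :: nat \<Rightarrow> nat) y. strict_mono r \<and> y \<in> L2 a b \<and> (\<lambda>n. L.nrm (xs (r n) - y)) \<longlonglongrightarrow> 0"
    using assms by (intro compact_embedding[of xs C]) (auto simp: invertible_iff_no_eigenvalue)
qed

text \<open>Compactness and surjectivity come from the invertible boundary matrix at 0. Solvability
  at \<open>l > 0\<close> comes from contractivity, which excludes the eigenvalue
  \<open>l\<close>.\<close>

lemma no_eigenvalue_imp_asymptotically_stable:
  assumes no_ev: "\<And>\<mu>. Re \<mu> = 0 \<Longrightarrow> \<not> is_eigenvalue a b D A \<mu>"
  shows "asymptotically_stable a b \<H> T"
  unfolding asymptotically_stable_iff
proof
  fix x :: "real \<Rightarrow> complex ^ 'n" assume x: "x \<in> L2 a b"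
  show "((\<lambda>t. L.nrm (T t x)) \<longlongrightarrow> 0) at_top"
  proof (rule G.asymptotic_stability[OF _ _ _ _ x])
    show "G.compact_inverse" using no_ev[of 0] by (intro no_eigenvalue_imp_compact) simp
    show "\<exists>x\<in>D. L.eqv (A x) f" if f: "f \<in> L2 a b" for f
    proof -
      have "invertible (\<Q> 0)" using no_ev[of 0] by (simp add: invertible_iff_no_eigenvalue)
      from resolvent_solution[OF this f] obtain y where "y \<in> D" "ae_eq a b (A y) f" by auto
      then show ?thesis using f eqv_iff[of "A y" f] G.A_closed by auto
    qed
    show "\<exists>y\<in>D. L.eqv (scf (complex_of_real l) y - A y) f" if l: "0 < l" and f: "f \<in> L2 a b" for l f
    proof -
      have "\<not> is_eigenvalue a b D A (of_real l)"
      proof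
        assume "is_eigenvalue a b D A (of_real l)"
        then obtain y where y: "y \<in> D" "L.nrm y \<noteq> 0" "L.eqv (A y) (scf (of_real l) y)"
          by (auto simp: eigenvalue_iff)
        then show False using G.no_positive_eigenvalue[OF G.rder_A[OF y(1)] y(3)] l by simp
      qed
      then have inv: "invertible (\<Q> (of_real l))" by (simp add: invertible_iff_no_eigenvalue)
      \<comment> \<open>\<open>resolvent_solution\<close> solves \<open>A y = l y + f\<close>, so
        the resolvent equation takes the opposite sign of \<open>f\<close>.\<close>
      have "- f \<in> L2 a b" using f by simp
      from resolvent_solution[OF inv this] obtain y where y: "y \<in> D"
        "ae_eq a b (A y) (\<lambda>\<zeta>. of_real l *s y \<zeta> + (- f) \<zeta>)" by blast
      have "ae_eq a b (scf (of_real l) y - A y) f"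
        using y(2) unfolding ae_eq_def by eventually_elim (simp add: scf_def)
      then have "L.eqv (scf (of_real l) y - A y) f"
        using f y(1) G.D_subset by (subst eqv_iff) auto
      then show ?thesis using y(1) by blast
    qed
    show "L.nrm x = 0" if "x \<in> D" "Re \<mu> = 0" "L.eqv (A x) (scf \<mu> x)" for x \<mu>
      using no_ev[OF that(2)] that(1,3) by (auto simp: eigenvalue_iff)
  qed
qed

lemma asymptotically_stable_imp_semi_uniformly_stable:
  assumes "\<not> is_eigenvalue a b D A 0" "asymptotically_stable a b \<H> T"
  shows "semi_uniformly_stable a b \<H> T D A"
  unfolding semi_uniformly_stable_iff
  by (rule G.semi_uniform_decay[OF no_eigenvalue_imp_compact[OF assms(1)]])
    (use assms(2) in \<open>simp add: asymptotically_stable_iff\<close>)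

lemma eigenvector_isometric:
  assumes "is_eigenvalue a b D A \<mu>" "Re \<mu> = 0"
  obtains x where "x \<in> D" "0 < L.nrm x" "\<And>t. 0 \<le> t \<Longrightarrow> L.nrm (T t x) = L.nrm x"
proof -
  obtain x where x: "x \<in> D" "L.nrm x \<noteq> 0" "L.eqv (A x) (scf \<mu> x)"
    using assms(1) by (auto simp: eigenvalue_iff)
  have "0 < L.nrm x" using x(2) L.nrm_ge_0[OF D_D(1)[OF x(1)]] by linarith
  with x(1) show thesis using G.imaginary_eigenvector_nrm[OF x(1,3) assms(2)] by (intro that) auto
qed

lemma asymptotically_stable_imp_no_eigenvalue:
  assumes "asymptotically_stable a b \<H> T" "Re \<mu> = 0" shows "\<not> is_eigenvalue a b D A \<mu>"
proof
  assume "is_eigenvalue a b D A \<mu>"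
  then obtain x where x: "x \<in> D" "0 < L.nrm x" "\<And>t. 0 \<le> t \<Longrightarrow> L.nrm (T t x) = L.nrm x"
    using assms(2) by (rule eigenvector_isometric) (rule that)
  have "((\<lambda>t. L.nrm (T t x)) \<longlongrightarrow> 0) at_top"
    using assms(1) D_D(1)[OF x(1)] by (simp add: asymptotically_stable_iff)
  moreover have "\<forall>\<^sub>F t in at_top. L.nrm (T t x) = L.nrm x"
    using eventually_ge_at_top[of 0] by eventually_elim (rule x(3))
  then have "((\<lambda>t. L.nrm (T t x)) \<longlongrightarrow> L.nrm x) at_top" by (rule tendsto_eventually)
  ultimately have "L.nrm x = 0" using tendsto_unique[of at_top] by force
  then show False using x(2) by simp
qed

lemma semi_uniformly_stable_imp_no_eigenvalue:
  assumes "semi_uniformly_stable a b \<H> T D A" "Re \<mu> = 0" shows "\<not> is_eigenvalue a b D A \<mu>"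
proof
  assume "is_eigenvalue a b D A \<mu>"
  then obtain x where x: "x \<in> D" "0 < L.nrm x" "\<And>t. 0 \<le> t \<Longrightarrow> L.nrm (T t x) = L.nrm x"
    using assms(2) by (rule eigenvector_isometric) (rule that)
  obtain f :: "real \<Rightarrow> real" where f: "(f \<longlongrightarrow> 0) at_top" and
    le: "\<forall>x\<in>D. \<forall>t\<ge>0. L.nrm (T t x) \<le> f t * sqrt ((L.nrm x)\<^sup>2 + (L.nrm (A x))\<^sup>2)"
    using assms(1) by (auto simp: semi_uniformly_stable_iff)
  define g where "g = sqrt ((L.nrm x)\<^sup>2 + (L.nrm (A x))\<^sup>2)"
  have "((\<lambda>t. f t * g) \<longlongrightarrow> 0 * g) at_top" by (intro tendsto_mult f tendsto_const)
  moreover have "\<forall>\<^sub>F t in at_top. L.nrm x \<le> f t * g"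
    using eventually_ge_at_top[of 0]
  proof eventually_elim
    case (elim t)
    then show ?case using le[rule_format, OF x(1) elim] x(3)[OF elim] by (simp add: g_def)
  qed
  ultimately have "L.nrm x \<le> 0 * g" by (intro tendsto_lowerbound) auto
  then show False using x(2) by simp
qed

end

end

text \<open>Conditions (iii), (iv) and (v) agree frequency by frequency. Both (i) and (ii) imply
  (iii) by testing an eigenvector, and (iii) implies (ii); the step from (ii) to (i) passes through
  (iii), because compactness is available once 0 is no eigenvalue.\<close>

theorem theorem1p3:
  fixes a b m :: real
    and P :: "nat \<Rightarrow> complex ^ 'n ^ 'n"
    and \<H> :: "real \<Rightarrow> complex ^ 'n ^ 'n"
    and W :: "complex ^ (('N::{finite,linorder} \<times> 'n) + ('N \<times> 'n)) ^ ('N \<times> 'n)"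
    and T :: "real \<Rightarrow> (real \<Rightarrow> complex ^ 'n) \<Rightarrow> real \<Rightarrow> complex ^ 'n"
  defines "A \<equiv> phs_op a b CARD('N) P \<H>"
    and "D \<equiv> phs_dom a b \<H> W"
    and "\<Psi> \<equiv> (fundamental_solution a b P \<H> ::
                complex \<Rightarrow> real \<Rightarrow> complex ^ ('N \<times> 'n) ^ ('N \<times> 'n))"
    and "Q \<equiv> (Q_matrix P :: complex ^ ('N \<times> 'n) ^ ('N \<times> 'n))"
  defines "\<Q> \<equiv> (\<lambda>\<mu>. W ** vstack (\<Psi> \<mu> b) (mat 1))"
  assumes "a < b"
    and "\<forall>k\<le>CARD('N). cmat_adjoint (P k) = (-1) ^ (k + 1) *\<^sub>R P k"
    and "invertible (P CARD('N))"
    and "\<H> \<in> borel_measurable (lebesgue_on {a<..<b})"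
    and "bounded (\<H> ` {a<..<b})"
    and "m > 0"
    and "AE \<zeta> in lebesgue_on {a<..<b}. cmat_adjoint (\<H> \<zeta>) = \<H> \<zeta> \<and>
           (\<forall>v. Re (cdot v (\<H> \<zeta> *v v)) \<ge> m * (norm v)\<^sup>2)"
    and "rank W = CARD('N \<times> 'n)"
    and "contraction_semigroup a b \<H> T"
    and "is_generator a b \<H> T D A"
  shows "(semi_uniformly_stable a b \<H> T D A \<longleftrightarrow> asymptotically_stable a b \<H> T) \<and>
    (asymptotically_stable a b \<H> T \<longleftrightarrow> (\<forall>\<mu>. Re \<mu> = 0 \<longrightarrow> \<not> is_eigenvalue a b D A \<mu>)) \<and>
    ((\<forall>\<mu>. Re \<mu> = 0 \<longrightarrow> \<not> is_eigenvalue a b D A \<mu>) \<longleftrightarrow>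
      (\<forall>\<omega>::real. invertible (\<Q> (\<i> * of_real \<omega>)))) \<and>
    ((\<forall>\<omega>::real. invertible (\<Q> (\<i> * of_real \<omega>))) \<longleftrightarrow>
      (\<forall>\<omega>::real. {v. \<Q> (\<i> * of_real \<omega>) *v v = 0 \<and>
          cdot v ((hstack (cmat_adjoint (\<Psi> (\<i> * of_real \<omega>) b)) (mat 1) ** diag2 Q (- Q)
            ** vstack (\<Psi> (\<i> * of_real \<omega>) b) (mat 1)) *v v) = 0} = {0}))"
proof -
  interpret S: port_hamiltonian a b m P \<H> W A
    by unfold_locales (use assms in auto)
  have \<Psi>: "\<Psi> = S.\<Psi>" by (simp add: \<Psi>_def S.\<Psi>_def)
  have Q: "Q = S.Q" by (simp add: Q_def S.Q_def)
  have \<Q>: "\<Q> = S.\<Q>" by (simp add: \<Q>_def S.\<Q>_def \<Psi> fun_eq_iff)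
  note sg = assms(14) and gen = assms(15)[unfolded D_def]
  let ?no_ev = "\<forall>\<mu>. Re \<mu> = 0 \<longrightarrow> \<not> is_eigenvalue a b D A \<mu>"
  have 1: "semi_uniformly_stable a b \<H> T D A \<Longrightarrow> ?no_ev"
    using S.semi_uniformly_stable_imp_no_eigenvalue[OF sg gen] by (simp add: D_def)
  have 2: "asymptotically_stable a b \<H> T \<longleftrightarrow> ?no_ev"
    using S.asymptotically_stable_imp_no_eigenvalue[OF sg gen]
      S.no_eigenvalue_imp_asymptotically_stable[OF sg gen] unfolding D_def by blast
  have 3: "semi_uniformly_stable a b \<H> T D A" if "asymptotically_stable a b \<H> T"
    using S.asymptotically_stable_imp_semi_uniformly_stable[OF sg gen _ that] 2 that by (simp add: D_def)
  have imag: "(\<forall>\<mu>. Re \<mu> = 0 \<longrightarrow> R \<mu>) \<longleftrightarrow> (\<forall>\<omega>::real. R (\<i> * of_real \<omega>))" for R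
  proof -
    have "\<mu> = \<i> * of_real (Im \<mu>)" if "Re \<mu> = 0" for \<mu> using that by (simp add: complex_eq_iff)
    then show ?thesis by (metis Re_i_times Im_complex_of_real neg_0_equal_iff_equal)
  qed
  have 4: "?no_ev \<longleftrightarrow> (\<forall>\<omega>::real. invertible (\<Q> (\<i> * of_real \<omega>)))"
    unfolding imag by (simp add: \<Q> S.invertible_iff_no_eigenvalue D_def)
  have "invertible (\<Q> (\<i> * of_real \<omega>)) \<longleftrightarrow> {v. \<Q> (\<i> * of_real \<omega>) *v v = 0 \<and>
          cdot v ((hstack (cmat_adjoint (\<Psi> (\<i> * of_real \<omega>) b)) (mat 1) ** diag2 Q (- Q)
            ** vstack (\<Psi> (\<i> * of_real \<omega>) b) (mat 1)) *v v) = 0} = {0}" for \<omega> :: real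
  proof -
    have "invertible (\<Q> (\<i> * of_real \<omega>)) \<longleftrightarrow> {v. \<Q> (\<i> * of_real \<omega>) *v v = 0} = {0}"
      by (auto simp: invertible_left_inverse matrix_left_invertible_ker)
    then show ?thesis using S.boundary_form_zero[of "\<i> * of_real \<omega>"] by (simp add: \<Psi> Q)
  qed
  with 1 2 3 4 show ?thesis by blast
qed

end
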